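(* Let $D\subset\mathbb{R}^d$ ($d\ge1$) be a bounded domain with $C^\infty$ boundary (an open bounded interval if $d=1$). Let $\gamma>\frac d4$, and let $\dot\xi$ be a symmetric Lévy white noise on $D$ with characteristic triplet $(0,0,\nu)$. Let $u$ be the mild solution of $$(-\Delta)^\gamma u=\dot\xi\ \text{ in }D,\qquad u=0\ \text{ on }\partial D,$$ where $(-\Delta)^\gamma$ is the spectral power of the Dirichlet Laplacian. Then for every $r<2\gamma-\frac d2$, $$u(\omega,\cdot)\in H_r(D)\quad\text{for almost all }\omega\in\Omega.$$ Moreover, if $\gamma\in(\frac d2,\infty)$, then $u$ admits a continuous modification in $\overline D$.
   Context: $(\Omega,\mathcal{F},\mathbb{P})$ is a complete probability space. $\mathcal{B}(D)$ is the Borel $\sigma$-field and $|A|$ is the Lebesgue measure of $A$. $\{e_k\}_{k\ge1}$ is an orthonormal basis of $L^2(D)$ of eigenfunctions of the Dirichlet Laplacian, $-\Delta e_k=\lambda_ke_k$ in $D$, $e_k=0$ on $\partial D$, with eigenvalues $\lambda_k>0$, $\lambda_k\to\infty$. The spectral power is $(-\Delta)^\gamma h=\sum_{k\ge1}\lambda_k^\gamma\langle h,e_k\rangle_{L^2(D)}e_k$, and its Green function is $G_\gamma(x,y)=\sum_{k=1}^\infty\lambda_k^{-\gamma}e_k(x)e_k(y)$ (for $\gamma>d/4$ and fixed $x\in D$ understood as a function of $y$ in $L^2(D)$). Fractional Sobolev space of order $r\in\mathbb{R}$: $H_r(D)$ is the completion of the finite linear combinations of the $e_k$ under $\|f\|_{H_r(D)}=\bigl(\sum_k\lambda_k^r|\langle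 f,e_k\rangle_{L^2(D)}|^2\bigr)^{1/2}$; its elements are identified with series $\Phi=\sum_ka_k(\Phi)e_k$ with $\sum_k\lambda_k^ra_k(\Phi)^2<\infty$. A function $u(\omega,\cdot)$ on $D$ is regarded as an element of $H_r(D)$ through its coefficients $\int_Du(\omega,x)e_k(x)\,dx$. Symmetric Lévy white noise with characteristic triplet $(0,0,\nu)$: an independently scattered random measure $\dot\xi=\{\xi(A)\}_{A\in\mathcal{B}(D)}$ (i.e. for pairwise disjoint $A_1,A_2,\dots$ the variables $\xi(A_n)$ are independent and $\xi(\bigcup_nA_n)=\sum_n\xi(A_n)$ a.s.) with $$\mathbb{E}[e^{iu\xi(A)}]=\exp\Bigl(|A|\int_{\mathbb{R}_0}\bigl(e^{iuz}-1-iuz\mathbf{1}_{\{|z|\le1\}}\bigr)\nu(dz)\Bigr),$$ where $\mathbb{R}_0=\mathbb{R}\setminus\{0\}$ and $\nu$ is a measure on $\mathbb{R}_0$ with $\int(|z|^2\wedge1)\nu(dz)<\infty$ and $\nu(A)=\nu(-A)$ for all Borel $A\subset\mathbb{R}_0$. Stochastic integral: for a simple function $f=\sum_{i=1}^n\alpha_i1_{A_i}$ (disjoint $A_i\in\mathcal{B}(D)$, $\alpha_i\in\mathbb{R}$) and $A\in\mathcal{B}(D)$, $\langle\dot\xi,f1_A\rangle=\sum_i\alpha_i\xi(A\cap A_i)$. A Borel function $f:D\to\mathbb{R}$ is $\dot\xi$-integrable if there are simple functions $f_n\to f$ a.e. such that for every $A\in\mathcal{B}(D)$ the sequence $\langle\dot\xi,f_n1_A\rangle$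 converges in probability; then $\int_Df(x)\,\xi(dx)=\langle\dot\xi,f\rangle$ is the limit in probability of $\langle\dot\xi,f_n\rangle$. Mild solution: a process $u=\{u(x);x\in D\}$, measurable with respect to the $\sigma$-field on $\Omega\times D$ generated by $\mathcal{F}\times\mathcal{B}(D)$, such that $u(x)=\int_DG_\gamma(x,y)\,\xi(dy)$ a.s. for every $x\in D$ (for $\gamma>d/4$ it exists and is unique up to modification). *)

theory Defs
  imports "HOL-Probability.Probability"
begin

section \<open>Domains with smooth boundary\<close>

text \<open>Continuous differentiability of order \<open>k\<close> on an open set \<open>U\<close>.\<close>

primrec Ck_on :: "nat \<Rightarrow> ('a::euclidean_space \<Rightarrow> real) \<Rightarrow> 'a set \<Rightarrow> bool" where
  "Ck_on 0 f U \<longleftrightarrow> continuous_on U f"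
| "Ck_on (Suc k) f U \<longleftrightarrow>
     (\<forall>x\<in>U. f differentiable (at x)) \<and>
     (\<forall>b\<in>Basis. Ck_on k (\<lambda>x. frechet_derivative f (at x) b) U)"

text \<open>Near each boundary point \<open>D\<close> is the part of a ball lying strictly on one side of a smooth
  graph: \<open>n\<close> is the vertical direction and \<open>x - (x \<bullet> n) *\<^sub>R n\<close> the horizontal coordinate of \<open>x\<close>.
  In dimension one the horizontal coordinate is always \<open>0\<close>, so the graph is a point.\<close>

definition smooth_boundary :: "'a::euclidean_space set \<Rightarrow> bool" where
  "smooth_boundary D \<longleftrightarrow>
     (\<forall>p\<in>frontier D. \<exists>r>0. \<exists>n g. norm n = 1 \<and> (\<forall>k. Ck_on k g UNIV) \<and>
        D \<inter> ball p r = {x \<in> ball p r. g (x - (x \<bullet> n) *\<^sub>R n) < x \<bullet> n})"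

definition smooth_bounded_domain :: "'a::euclidean_space set \<Rightarrow> bool" where
  "smooth_bounded_domain D \<longleftrightarrow>
     D \<noteq> {} \<and> open D \<and> connected D \<and> bounded D \<and> smooth_boundary D"


section \<open>Spectral decomposition of the Dirichlet Laplacian\<close>

text \<open>The measurable sets of \<open>leb D\<close> are exactly the Borel subsets of \<open>D\<close> (for Borel \<open>D\<close>).\<close>

abbreviation leb :: "'a::euclidean_space set \<Rightarrow> 'a measure" where
  "leb D \<equiv> restrict_space lborel D"

definition L2_on :: "'a::euclidean_space set \<Rightarrow> ('a \<Rightarrow> real) set" where
  "L2_on D = {f \<in> borel_measurable (leb D). integrable (leb D) (\<lambda>x. (f x)\<^sup>2)}"

definition L2_inner :: "'a::euclidean_space set \<Rightarrow> ('a \<Rightarrow> real) \<Rightarrow> ('a \<Rightarrow> real) \<Rightarrow> real" where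
  "L2_inner D f g = (LINT x|leb D. f x * g x)"

definition L2_sums ::
    "'a::euclidean_space set \<Rightarrow> (nat \<Rightarrow> 'a \<Rightarrow> real) \<Rightarrow> ('a \<Rightarrow> real) \<Rightarrow> bool" where
  "L2_sums D h f \<longleftrightarrow> f \<in> L2_on D \<and> (\<forall>k. h k \<in> L2_on D) \<and>
     (\<lambda>n. LINT x|leb D. (f x - (\<Sum>k<n. h k x))\<^sup>2) \<longlonglongrightarrow> 0"

definition orthonormal_basis_L2 :: "'a::euclidean_space set \<Rightarrow> (nat \<Rightarrow> 'a \<Rightarrow> real) \<Rightarrow> bool" where
  "orthonormal_basis_L2 D e \<longleftrightarrow>
     (\<forall>k. e k \<in> L2_on D) \<and>
     (\<forall>j k. L2_inner D (e j) (e k) = (if j = k then 1 else 0)) \<and>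
     (\<forall>f\<in>L2_on D. L2_sums D (\<lambda>k x. L2_inner D f (e k) * e k x) f)"

definition laplacian :: "('a::euclidean_space \<Rightarrow> real) \<Rightarrow> 'a \<Rightarrow> real" where
  "laplacian f x =
     (\<Sum>b\<in>Basis. frechet_derivative (\<lambda>y. frechet_derivative f (at y) b) (at x) b)"

definition dirichlet_eigenfunction ::
    "'a::euclidean_space set \<Rightarrow> real \<Rightarrow> ('a \<Rightarrow> real) \<Rightarrow> bool" where
  "dirichlet_eigenfunction D l f \<longleftrightarrow>
     Ck_on 2 f D \<and> continuous_on (closure D) f \<and>
     (\<forall>x\<in>D. - laplacian f x = l * f x) \<and> (\<forall>x\<in>frontier D. f x = 0)"

text \<open>Here and below the spectral data are enumerated from \<open>0\<close>.\<close>

definition dirichlet_spectral_basis ::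
    "'a::euclidean_space set \<Rightarrow> (nat \<Rightarrow> real) \<Rightarrow> (nat \<Rightarrow> 'a \<Rightarrow> real) \<Rightarrow> bool" where
  "dirichlet_spectral_basis D lam e \<longleftrightarrow>
     orthonormal_basis_L2 D e \<and>
     (\<forall>k. dirichlet_eigenfunction D (lam k) (e k)) \<and>
     (\<forall>k. 0 < lam k) \<and> filterlim lam at_top sequentially"

text \<open>\<open>g\<close> is a representative of the section \<open>G\<^sub>\<gamma>(x, \<cdot>)\<close> of the Green function of the spectral
  power \<open>\<gamma>\<close>; the series is summed in \<open>L\<^sup>2(D)\<close> as a function of the second variable.\<close>

definition green_section ::
    "'a::euclidean_space set \<Rightarrow> (nat \<Rightarrow> real) \<Rightarrow> (nat \<Rightarrow> 'a \<Rightarrow> real) \<Rightarrow> real \<Rightarrow> 'a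
      \<Rightarrow> ('a \<Rightarrow> real) \<Rightarrow> bool" where
  "green_section D lam e \<gamma> x g \<longleftrightarrow>
     L2_sums D (\<lambda>k y. lam k powr (- \<gamma>) * e k x * e k y) g"

text \<open>The space \<open>H\<^sub>r(D)\<close> as a space of coefficient sequences.\<close>

definition H_space :: "(nat \<Rightarrow> real) \<Rightarrow> real \<Rightarrow> (nat \<Rightarrow> real) set" where
  "H_space lam r = {a. summable (\<lambda>k. lam k powr r * (a k)\<^sup>2)}"

text \<open>A function belongs to \<open>H\<^sub>r(D)\<close> through its coefficients. Their existence is
  required explicitly, because the integral of a non-integrable function is \<open>0\<close>.\<close>

definition in_H_space ::
    "'a::euclidean_space set \<Rightarrow> (nat \<Rightarrow> real) \<Rightarrow> (nat \<Rightarrow> 'a \<Rightarrow> real) \<Rightarrow> real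
      \<Rightarrow> ('a \<Rightarrow> real) \<Rightarrow> bool" where
  "in_H_space D lam e r f \<longleftrightarrow>
     (\<forall>k. integrable (leb D) (\<lambda>x. f x * e k x)) \<and>
     (\<lambda>k. L2_inner D f (e k)) \<in> H_space lam r"


section \<open>Symmetric Levy white noise\<close>

definition symmetric_levy_measure :: "real measure \<Rightarrow> bool" where
  "symmetric_levy_measure \<nu> \<longleftrightarrow>
     sets \<nu> = sets (restrict_space borel (UNIV - {0})) \<and>
     (\<integral>\<^sup>+z. ennreal (min (z\<^sup>2) 1) \<partial>\<nu>) < \<infinity> \<and>
     (\<forall>A\<in>sets \<nu>. emeasure \<nu> A = emeasure \<nu> (uminus ` A))"

definition independently_scattered ::
    "'w measure \<Rightarrow> 'a::euclidean_space set \<Rightarrow> ('a set \<Rightarrow> 'w \<Rightarrow> real) \<Rightarrow> bool" where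
  "independently_scattered M D \<xi> \<longleftrightarrow>
     (\<forall>A\<in>sets (leb D). \<xi> A \<in> borel_measurable M) \<and>
     (\<forall>A::nat \<Rightarrow> 'a set. range A \<subseteq> sets (leb D) \<longrightarrow> disjoint_family A \<longrightarrow>
        prob_space.indep_vars M (\<lambda>_. borel) (\<lambda>n. \<xi> (A n)) UNIV \<and>
        (AE \<omega> in M. (\<lambda>n. \<xi> (A n) \<omega>) sums \<xi> (\<Union>n. A n) \<omega>))"

definition symmetric_levy_noise ::
    "'w measure \<Rightarrow> 'a::euclidean_space set \<Rightarrow> real measure \<Rightarrow> ('a set \<Rightarrow> 'w \<Rightarrow> real) \<Rightarrow> bool" where
  "symmetric_levy_noise M D \<nu> \<xi> \<longleftrightarrow>
     symmetric_levy_measure \<nu> \<and> independently_scattered M D \<xi> \<and>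
     (\<forall>A\<in>sets (leb D). \<forall>t::real.
        (LINT \<omega>|M. iexp (t * \<xi> A \<omega>)) =
        exp (complex_of_real (measure lborel A) *
             (LINT z|\<nu>. iexp (t * z) - 1 - \<i> * complex_of_real (t * z * indicator {-1..1} z))))"


section \<open>Stochastic integral and mild solution\<close>

definition conv_in_prob :: "'w measure \<Rightarrow> (nat \<Rightarrow> 'w \<Rightarrow> real) \<Rightarrow> ('w \<Rightarrow> real) \<Rightarrow> bool" where
  "conv_in_prob M X Y \<longleftrightarrow>
     (\<forall>n. X n \<in> borel_measurable M) \<and> Y \<in> borel_measurable M \<and>
     (\<forall>\<epsilon>>0. (\<lambda>n. measure M {\<omega> \<in> space M. \<epsilon> < \<bar>X n \<omega> - Y \<omega>\<bar>}) \<longlonglongrightarrow> 0)"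

text \<open>The random variable \<open>\<langle>\<xi>, f 1\<^sub>A\<rangle>\<close> for a simple function \<open>f\<close>, computed from the canonical
  representation of \<open>f\<close> by its level sets. Other representations with disjoint sets give the
  same value almost surely.\<close>

definition noise_simple ::
    "'a::euclidean_space set \<Rightarrow> ('a set \<Rightarrow> 'w \<Rightarrow> real) \<Rightarrow> ('a \<Rightarrow> real) \<Rightarrow> 'a set \<Rightarrow> 'w \<Rightarrow> real" where
  "noise_simple D \<xi> f A \<omega> = (\<Sum>c\<in>f ` D. c * \<xi> (A \<inter> {x \<in> D. f x = c}) \<omega>)"

text \<open>\<open>f\<close> is integrable with respect to \<open>\<xi>\<close> and \<open>X\<close> is (a version of) its integral over \<open>D\<close>;
  limits in probability are determined only up to almost sure equality.\<close>

definition has_noise_integral ::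
    "'w measure \<Rightarrow> 'a::euclidean_space set \<Rightarrow> ('a set \<Rightarrow> 'w \<Rightarrow> real) \<Rightarrow> ('a \<Rightarrow> real)
      \<Rightarrow> ('w \<Rightarrow> real) \<Rightarrow> bool" where
  "has_noise_integral M D \<xi> f X \<longleftrightarrow>
     f \<in> borel_measurable (leb D) \<and>
     (\<exists>F::nat \<Rightarrow> 'a \<Rightarrow> real.
        (\<forall>n. simple_function (leb D) (F n)) \<and>
        (AE x in leb D. (\<lambda>n. F n x) \<longlonglongrightarrow> f x) \<and>
        (\<forall>A\<in>sets (leb D). \<exists>Y. conv_in_prob M (\<lambda>n. noise_simple D \<xi> (F n) A) Y) \<and>
        conv_in_prob M (\<lambda>n. noise_simple D \<xi> (F n) D) X)"

definition mild_solution ::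
    "'w measure \<Rightarrow> 'a::euclidean_space set \<Rightarrow> (nat \<Rightarrow> real) \<Rightarrow> (nat \<Rightarrow> 'a \<Rightarrow> real) \<Rightarrow> real
      \<Rightarrow> ('a set \<Rightarrow> 'w \<Rightarrow> real) \<Rightarrow> ('a \<Rightarrow> 'w \<Rightarrow> real) \<Rightarrow> bool" where
  "mild_solution M D lam e \<gamma> \<xi> u \<longleftrightarrow>
     (\<lambda>(\<omega>, x). u x \<omega>) \<in> borel_measurable (M \<Otimes>\<^sub>M leb D) \<and>
     (\<forall>x\<in>D. \<exists>g. green_section D lam e \<gamma> x g \<and> has_noise_integral M D \<xi> g (u x))"

text \<open>A modification of a process indexed by \<open>D\<close> whose paths are continuous up to the boundary.\<close>

definition continuous_modification_on_closure ::
    "'w measure \<Rightarrow> 'a::euclidean_space set \<Rightarrow> ('a \<Rightarrow> 'w \<Rightarrow> real) \<Rightarrow> ('a \<Rightarrow> 'w \<Rightarrow> real) \<Rightarrow> bool" where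
  "continuous_modification_on_closure M D u v \<longleftrightarrow>
     (\<forall>x\<in>closure D. v x \<in> borel_measurable M) \<and>
     (\<forall>\<omega>\<in>space M. continuous_on (closure D) (\<lambda>x. v x \<omega>)) \<and>
     (\<forall>x\<in>D. AE \<omega> in M. v x \<omega> = u x \<omega>)"

end

theory Submission
  imports Defs
begin

text \<open>
  The analytic input is the local Weyl bound \<open>\<Sum>\<^bsub>\<lambda>\<^sub>k \<le> \<Lambda>\<^esub> e\<^sub>k(x)\<^sup>2 \<le> C \<Lambda>\<^bsup>d/2\<^esup>\<close>. For a finite
  eigenfunction sum \<open>F(t,x) = \<Sum>\<^sub>k c\<^sub>k exp(-\<lambda>\<^sub>k t) e\<^sub>k(x)\<close>, the function \<open>U = max(0, F - \<epsilon>)\<^sup>3\<close>, extended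
  by zero, is a \<open>C\<^sup>2\<close> subsolution of the heat equation on the whole space, hence
  \<open>U(T,x)\<close> is at most a constant times \<open>T\<^bsup>-d/2\<^esup> \<integral> U(0,y) dy\<close>. Taking
  \<open>T = 1/\<Lambda>\<close>, \<open>c\<^sub>k = exp(\<lambda>\<^sub>k T) e\<^sub>k(x)\<close> and \<open>x\<close> a maximum point of \<open>\<Sum>e\<^sub>k\<^sup>2\<close> gives the bound, and dyadic
  summation gives \<open>sup\<^sub>x \<Sum>\<^sub>k \<lambda>\<^sub>k\<^bsup>-s\<^esup> e\<^sub>k(x)\<^sup>2 < \<infinity>\<close> for \<open>s > d/2\<close>.

  The Levy-Ito decomposition is bypassed as follows. Let \<open>X\<^sub>k\<close> be the noise integral of
  \<open>e\<^sub>k\<close> and \<open>\<psi>(t) = \<integral>(1 - cos(t z)) \<nu>(dz)\<close>, so that \<open>E cos(X(f)) = exp(-\<integral>\<psi>(f))\<close> and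
  \<open>\<psi>(t) \<le> a + b t\<^sup>2\<close> with \<open>a\<close> as small as we like. Evaluating the joint characteristic function of
  the \<open>X\<^sub>k\<close> at independent Gaussian arguments bounds \<open>E exp(-1/2 \<Sum> q\<^sub>k\<^sup>2 X\<^sub>k\<^sup>2)\<close> from below by
  \<open>1 - (a |D| + 2 b \<Sum> q\<^sub>k\<^sup>2)\<close>, whence \<open>\<Sum>\<^sub>k \<lambda>\<^sub>k\<^bsup>-s\<^esup> X\<^sub>k\<^sup>2 < \<infinity>\<close> almost surely for \<open>s > d/2\<close>.
  The partial sums of \<open>\<Sum>\<^sub>k \<lambda>\<^sub>k\<^bsup>-\<gamma>\<^esup> X\<^sub>k e\<^sub>k(x)\<close> converge to \<open>u(x)\<close> in probability for every \<open>x\<close>, so by Fatou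
  the coefficients of \<open>u\<close> are \<open>\<lambda>\<^sub>k\<^bsup>-\<gamma>\<^esup> X\<^sub>k\<close>; for \<open>\<gamma> > d/2\<close> the series converges uniformly on the closure
  of \<open>D\<close> by the Cauchy-Schwarz inequality.
\<close>

section \<open>Gaussian averages of heat subsolutions\<close>

text \<open>Three obstacles shape the proof. Near the frontier only continuity and the boundary
  value 0 of the \<open>e k\<close> are at hand, and nothing about their derivatives. Subtracting
  \<epsilon> therefore pushes the support of the positive part into a compact subset of
  \<open>D\<close>; the cube is the least integer power of the positive part that is twice
  continuously differentiable, and being convex and increasing it makes a subsolution out of a heat
  solution. Next, the noise may have infinite variance, so there is no L2 isometry: in
  \<open>a + b t^2\<close> the constant \<open>a\<close> absorbs the rare large jumps, and all
  estimates are in probability. Moreover, the integral defining \<open>u x\<close> comes with an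
  arbitrary approximating sequence, convergent almost everywhere and setwise in probability, which
  need not be related to the L2 approximation behind the expansion in the \<open>X k\<close>. That
  both limits agree needs a gliding hump argument in the spirit of Vitali-Hahn-Saks. Finally,
  convergence at each fixed \<open>x\<close> says nothing about a single path; joint measurability
  and Fubini yield one subsequence that works for almost every path and almost every point.\<close>

lemma has_real_derivative_lebesgue_integral:
  fixes f f' :: "real \<Rightarrow> 'a \<Rightarrow> real"
  assumes r: "a < r" "r < b"
    and f: "\<And>s. a < s \<Longrightarrow> s < b \<Longrightarrow> integrable M (f s)"
    and f': "\<And>s y. a < s \<Longrightarrow> s < b \<Longrightarrow> y \<in> space M \<Longrightarrow>
          ((\<lambda>s. f s y) has_real_derivative f' s y) (at s)"
    and bound: "\<And>s y. a < s \<Longrightarrow> s < b \<Longrightarrow> y \<in> space M \<Longrightarrow> \<bar>f' s y\<bar> \<le> g y"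
    and g: "integrable M g"
  shows "((\<lambda>s. \<integral>y. f s y \<partial>M) has_real_derivative (\<integral>y. f' r y \<partial>M)) (at r)"
proof -
  have "(\<lambda>i. ((\<integral>y. f (X i) y \<partial>M) - (\<integral>y. f r y \<partial>M)) / (X i - r)) \<longlonglongrightarrow> (\<integral>y. f' r y \<partial>M)"
    if X: "\<forall>i. X i \<in> {a<..<b} - {r}" and lim: "X \<longlonglongrightarrow> r" for X
  proof -
    have Xi: "a < X i" "X i < b" "X i \<noteq> r" for i
      using X by auto
    have lim_q: "(\<lambda>i. (f (X i) y - f r y) / (X i - r)) \<longlonglongrightarrow> f' r y" if "y \<in> space M" for y
    proof -
      have "((\<lambda>s. (f s y - f r y) / (s - r)) \<longlongrightarrow> f' r y) (at r)"
        using f'[OF r that] by (simp add: has_field_derivative_iff)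
      moreover have "filterlim X (at r) sequentially"
        using lim Xi by (simp add: filterlim_at)
      ultimately show ?thesis
        by (rule filterlim_compose)
    qed
    have meas_q: "(\<lambda>y. (f (X i) y - f r y) / (X i - r)) \<in> borel_measurable M" for i
      using f[OF r] f[OF Xi(1,2)] by measurable
    have dom: "norm ((f (X i) y - f r y) / (X i - r)) \<le> g y" if "y \<in> space M" for i y
    proof -
      have "norm (f (X i) y - f r y) \<le> g y * norm (X i - r)"
        by (rule field_differentiable_bound[where S = "{a<..<b}" and f' = "\<lambda>s. f' s y"])
          (use f' bound that Xi r in \<open>auto intro: has_field_derivative_at_within\<close>)
      then show ?thesis
        using Xi by (simp add: field_simps)
    qed
    have "(\<lambda>i. \<integral>y. (f (X i) y - f r y) / (X i - r) \<partial>M) \<longlonglongrightarrow> (\<integral>y. f' r y \<partial>M)"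
    proof (rule integral_dominated_convergence[where w = g])
      \<comment> \<open>The hypotheses give no measurability of the derivative; it is inherited from
        the difference quotients, whose pointwise limit it is.\<close>
      show "f' r \<in> borel_measurable M"
        by (rule borel_measurable_LIMSEQ_real[OF lim_q meas_q])
    qed (use g meas_q lim_q dom in auto)
    moreover have "(\<integral>y. (f (X i) y - f r y) / (X i - r) \<partial>M)
        = ((\<integral>y. f (X i) y \<partial>M) - (\<integral>y. f r y \<partial>M)) / (X i - r)" for i
      using f[OF r] f[OF Xi(1,2)] by simp
    ultimately show ?thesis
      by (simp only:)
  qed
  then have "((\<lambda>s. ((\<integral>y. f s y \<partial>M) - (\<integral>y. f r y \<partial>M)) / (s - r)) \<longlongrightarrow> (\<integral>y. f' r y \<partial>M))
      (at r within {a<..<b})"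
    by (auto simp: tendsto_at_iff_sequentially comp_def)
  then show ?thesis
    using r by (simp add: has_field_derivative_iff at_within_open[of r "{a<..<b}"])
qed

lemma integrable_gaussian:
  fixes c :: real
  assumes "0 < c"
  shows "integrable lborel (\<lambda>y::'a::euclidean_space. exp (- (c * (norm y)\<^sup>2)))"
proof (rule integrableI_bounded)
  \<comment> \<open>The standard deviation for which the normal exponent
    \<open>x^2 / (2 s^2)\<close> becomes \<open>c x^2\<close>; the integral over the space then
    factors over \<open>Basis\<close>.\<close>
  define s where "s = sqrt (1 / (2 * c))"
  have s: "0 < s" "2 * s\<^sup>2 = 1 / c"
    using assms by (auto simp: s_def)
  have "integrable lborel (\<lambda>x. sqrt (2 * pi * s\<^sup>2) * normal_density 0 s x)"
    using s by simp
  also have "(\<lambda>x. sqrt (2 * pi * s\<^sup>2) * normal_density 0 s x) = (\<lambda>x::real. exp (- (c * x\<^sup>2)))"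
    using s by (auto simp: normal_density_def fun_eq_iff)
  finally have 1: "(\<integral>\<^sup>+x. ennreal (exp (- (c * x\<^sup>2))) \<partial>lborel) < \<infinity>" (is "?I < _")
    by (auto simp: integrable_iff_bounded)
  have "exp (- (c * (norm y)\<^sup>2)) = (\<Prod>b\<in>Basis. exp (- (c * (y \<bullet> b)\<^sup>2)))" for y :: 'a
    by (simp add: exp_sum[symmetric] sum_negf sum_distrib_left[symmetric] power2_norm_eq_inner
        euclidean_inner[of y y] flip: power2_eq_square)
  then have "(\<integral>\<^sup>+y. ennreal (norm (exp (- (c * (norm y)\<^sup>2)))) \<partial>(lborel :: 'a measure))
      = (\<integral>\<^sup>+y. (\<Prod>b\<in>Basis. ennreal (exp (- (c * (y \<bullet> b)\<^sup>2)))) \<partial>(lborel :: 'a measure))"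
    by (simp add: prod_ennreal abs_prod)
  also have "\<dots> = (\<Prod>b\<in>(Basis::'a set). ?I)"
    by (rule nn_integral_lborel_prod) auto
  also have "\<dots> < \<infinity>"
    using 1 by (simp add: power_less_top_ennreal)
  finally show "(\<integral>\<^sup>+y. ennreal (norm (exp (- (c * (norm y)\<^sup>2)))) \<partial>(lborel :: 'a measure)) < \<infinity>" .
qed simp

lemma lborel_integral_translation:
  fixes f :: "'a::euclidean_space \<Rightarrow> real"
  assumes [measurable]: "f \<in> borel_measurable borel"
  shows "(\<integral>y. f (y + a) \<partial>lborel) = (\<integral>y. f y \<partial>lborel)"
proof -
  have "(\<integral>y. f y \<partial>lborel) = (\<integral>y. f y \<partial>distr lborel borel ((+) a))"
    by (simp add: lborel_distr_plus)
  also have "\<dots> = (\<integral>y. f (a + y) \<partial>lborel)"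
    by (rule integral_distr) auto
  finally show ?thesis
    by (simp add: add.commute)
qed

text \<open>Differentiating the translation-invariant integral \<open>\<integral> G (y + s b) dy\<close> in \<open>s\<close>.\<close>

lemma integral_directional_derivative_eq_0:
  fixes G G' :: "'a::euclidean_space \<Rightarrow> real"
  assumes meas [measurable]: "G \<in> borel_measurable borel"
    and G: "\<And>y. \<bar>G y\<bar> \<le> C * exp (- ((norm y)\<^sup>2 / 8))"
    and G': "\<And>y. \<bar>G' y\<bar> \<le> C * exp (- ((norm y)\<^sup>2 / 8))"
    and deriv: "\<And>y. ((\<lambda>s. G (y + s *\<^sub>R b)) has_real_derivative G' y) (at 0)"
    and b: "norm b = 1"
  shows "(\<integral>y. G' y \<partial>lborel) = 0"
proof -
  have int8: "integrable lborel (\<lambda>y::'a. C * exp (- ((norm y)\<^sup>2 / 8)))"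
    using integrable_gaussian[of "1/8", where 'a = 'a] by simp
  \<comment> \<open>One dominating function must serve all shifts with \<open>|s| < 1\<close>: by
    \<open>|y|^2 <= 2 |y + s b|^2 + 2 s^2\<close> the decay rate 1/8 drops to 1/16 at the price of
    the factor \<open>exp (1/8)\<close>.\<close>
  have int16: "integrable lborel (\<lambda>y::'a. C * (exp (1/8) * exp (- ((norm y)\<^sup>2 / 16))))"
    using integrable_gaussian[of "1/16", where 'a = 'a] by simp
  have C: "0 \<le> C"
    using G[of 0] by simp
  have intG: "integrable lborel (\<lambda>y. G (y + s *\<^sub>R b))" for s
  proof -
    have "integrable lborel G"
      by (rule Bochner_Integration.integrable_bound[OF int8]) (use G C in auto)
    then have "integrable (distr lborel borel ((+) (s *\<^sub>R b))) G"
      by (simp add: lborel_distr_plus)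
    then show ?thesis
      by (subst (asm) integrable_distr_eq) (auto simp: add.commute)
  qed
  have "((\<lambda>s. \<integral>y. G (y + s *\<^sub>R b) \<partial>lborel) has_real_derivative (\<integral>y. G' (y + 0 *\<^sub>R b) \<partial>lborel)) (at 0)"
  proof (rule has_real_derivative_lebesgue_integral[OF _ _ intG _ _ int16, of "-1" _ 1])
    fix s :: real and y :: 'a
    assume s: "-1 < s" "s < 1"
    have "((\<lambda>h. G ((y + s *\<^sub>R b) + h *\<^sub>R b)) has_real_derivative G' (y + s *\<^sub>R b)) (at 0)"
      by (rule deriv)
    then show "((\<lambda>s. G (y + s *\<^sub>R b)) has_real_derivative G' (y + s *\<^sub>R b)) (at s)"
      using DERIV_shift[of "\<lambda>s. G (y + s *\<^sub>R b)" "G' (y + s *\<^sub>R b)" 0 s] by (simp add: algebra_simps)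
    have "norm y \<le> norm (y + s *\<^sub>R b) + \<bar>s\<bar>"
      using norm_triangle_ineq4[of "y + s *\<^sub>R b" "s *\<^sub>R b"] b by simp
    then have "(norm y)\<^sup>2 \<le> (norm (y + s *\<^sub>R b) + \<bar>s\<bar>)\<^sup>2"
      by (intro power_mono) auto
    also have "\<dots> \<le> 2 * (norm (y + s *\<^sub>R b))\<^sup>2 + 2 * s\<^sup>2"
      using sum_squares_ge_zero[of "norm (y + s *\<^sub>R b) - \<bar>s\<bar>" 0]
      by (simp add: power2_eq_square algebra_simps)
    also have "s\<^sup>2 \<le> 1"
      using s by (simp add: abs_square_le_1)
    finally have "- ((norm (y + s *\<^sub>R b))\<^sup>2 / 8) \<le> 1/8 + - ((norm y)\<^sup>2 / 16)"
      by simp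
    then have "exp (- ((norm (y + s *\<^sub>R b))\<^sup>2 / 8)) \<le> exp (1/8) * exp (- ((norm y)\<^sup>2 / 16))"
      by (subst exp_add[symmetric]) simp
    then show "\<bar>G' (y + s *\<^sub>R b)\<bar> \<le> C * (exp (1/8) * exp (- ((norm y)\<^sup>2 / 16)))"
      using G'[of "y + s *\<^sub>R b"] mult_left_mono[OF _ C] by fastforce
  qed auto
  moreover have "(\<lambda>s. \<integral>y. G (y + s *\<^sub>R b) \<partial>lborel) = (\<lambda>s. \<integral>y. G y \<partial>lborel)"
    using lborel_integral_translation[OF meas] by simp
  ultimately show ?thesis
    using DERIV_unique[OF _ DERIV_const] by fastforce
qed

text \<open>Absorbs the linear factors \<open>y . b\<close>, which arise from the chain rule and
  from differentiating the Gaussian weight, into a Gaussian of slower decay.\<close>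

lemma linear_times_gaussian_le:
  shows "(1 + norm y) * exp (- ((norm y)\<^sup>2 / 4)) \<le> 4 * exp (- ((norm (y::'a::euclidean_space))\<^sup>2 / 8))"
proof -
  have "1 + norm y \<le> 4 * (1 + (norm y)\<^sup>2 / 8)"
    using sum_squares_ge_zero[of "norm y - 1" 0] by (simp add: power2_eq_square algebra_simps)
  also have "\<dots> \<le> 4 * exp ((norm y)\<^sup>2 / 8)"
    by (intro mult_left_mono exp_ge_add_one_self) auto
  finally have "(1 + norm y) * exp (- ((norm y)\<^sup>2 / 4))
      \<le> 4 * exp ((norm y)\<^sup>2 / 8) * exp (- ((norm y)\<^sup>2 / 4))"
    by (intro mult_right_mono) auto
  also have "\<dots> = 4 * exp (- ((norm y)\<^sup>2 / 8))"
    by (simp flip: exp_add)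
  finally show ?thesis .
qed

text \<open>With \<open>A(r) = \<integral> U(T - r\<^sup>2, x\<^sub>0 + r y) exp(-|y|\<^sup>2/4) dy\<close>, integration by parts against the
  Gaussian weight gives \<open>A'(r) = 2 r \<integral> (\<Delta>U - \<partial>\<^sub>tU) exp(-|y|\<^sup>2/4) dy \<ge> 0\<close>.\<close>

lemma heat_subsolution_le_gaussian_mean:
  fixes U Ut :: "real \<Rightarrow> 'a::euclidean_space \<Rightarrow> real" and Ub Ubb :: "'a \<Rightarrow> real \<Rightarrow> 'a \<Rightarrow> real"
  assumes T: "0 < T"
    and meas [measurable]: "\<And>t. U t \<in> borel_measurable borel" "\<And>t. Ut t \<in> borel_measurable borel"
      "\<And>b t. Ub b t \<in> borel_measurable borel" "\<And>b t. Ubb b t \<in> borel_measurable borel"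
    and path: "\<And>r y. r\<^sup>2 \<le> T + 1 \<Longrightarrow> ((\<lambda>r. U (T - r\<^sup>2) (x0 + r *\<^sub>R y)) has_real_derivative
        (\<Sum>b\<in>Basis. (y \<bullet> b) * Ub b (T - r\<^sup>2) (x0 + r *\<^sub>R y)) - 2 * r * Ut (T - r\<^sup>2) (x0 + r *\<^sub>R y)) (at r)"
    and dir: "\<And>t x b. t \<in> {-1..T} \<Longrightarrow> b \<in> Basis \<Longrightarrow>
        ((\<lambda>s. Ub b t (x + s *\<^sub>R b)) has_real_derivative Ubb b t x) (at 0)"
    and bound: "\<And>t x. t \<in> {-1..T} \<Longrightarrow> \<bar>U t x\<bar> \<le> C" "\<And>t x. t \<in> {-1..T} \<Longrightarrow> \<bar>Ut t x\<bar> \<le> C"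
      "\<And>t x b. t \<in> {-1..T} \<Longrightarrow> b \<in> Basis \<Longrightarrow> \<bar>Ub b t x\<bar> \<le> C"
      "\<And>t x b. t \<in> {-1..T} \<Longrightarrow> b \<in> Basis \<Longrightarrow> \<bar>Ubb b t x\<bar> \<le> C"
    and sub: "\<And>t x. t \<in> {-1..T} \<Longrightarrow> Ut t x \<le> (\<Sum>b\<in>Basis. Ubb b t x)"
  shows "U T x0 * (\<integral>y. exp (- ((norm y)\<^sup>2 / 4)) \<partial>(lborel :: 'a measure))
      \<le> (\<integral>y. U 0 (x0 + sqrt T *\<^sub>R y) * exp (- ((norm y)\<^sup>2 / 4)) \<partial>lborel)"
proof -
  define \<rho> :: "'a \<Rightarrow> real" where "\<rho> y = exp (- ((norm y)\<^sup>2 / 4))" for y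
  define d where "d = real DIM('a)"
  \<comment> \<open>The interval from \<open>-R\<close> to \<open>R\<close> contains
    \<open>[0, sqrt T]\<close> in its interior, so that the endpoints have two-sided derivatives;
    \<open>T - r^2\<close> then goes down to -1, whence the time range \<open>{-1..T}\<close> of the
    hypotheses.\<close>
  define R where "R = sqrt (T + 1)"
  define A where "A r = (\<integral>y. U (T - r\<^sup>2) (x0 + r *\<^sub>R y) * \<rho> y \<partial>lborel)" for r
  define W where "W r y = (\<Sum>b\<in>Basis. (y \<bullet> b) * Ub b (T - r\<^sup>2) (x0 + r *\<^sub>R y))
      - 2 * r * Ut (T - r\<^sup>2) (x0 + r *\<^sub>R y)" for r y
  have [measurable]: "\<rho> \<in> borel_measurable borel"
    unfolding \<rho>_def by measurable
  have \<rho>0: "0 \<le> \<rho> y" for y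
    by (simp add: \<rho>_def)
  have \<rho>4: "(1 + norm y) * \<rho> y \<le> 4 * exp (- ((norm y)\<^sup>2 / 8))" for y
    unfolding \<rho>_def by (rule linear_times_gaussian_le)
  have int\<rho>: "integrable lborel \<rho>"
    using integrable_gaussian[of "1/4", where 'a = 'a] by (simp add: \<rho>_def[abs_def])
  have int8: "integrable lborel (\<lambda>y::'a. K * exp (- ((norm y)\<^sup>2 / 8)))" for K
    using integrable_gaussian[of "1/8", where 'a = 'a] by simp
  have C: "0 \<le> C"
    using bound(1)[of 0 undefined] T by simp
  have R: "sqrt T < R" "0 < R"
    using T by (auto simp: R_def)
  have times: "T - r\<^sup>2 \<in> {-1..T}" if "r\<^sup>2 \<le> T + 1" for r
    using that by auto
  have rR: "r\<^sup>2 \<le> T + 1" "\<bar>r\<bar> \<le> R" if "-R < r" "r < R" for r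
  proof -
    show "\<bar>r\<bar> \<le> R"
      using that by auto
    then show "r\<^sup>2 \<le> T + 1"
      using T power_mono[of "\<bar>r\<bar>" R 2] by (simp add: R_def)
  qed
  have intU: "integrable lborel (\<lambda>y. U (T - r\<^sup>2) (x0 + r *\<^sub>R y) * \<rho> y)" if "r\<^sup>2 \<le> T + 1" for r
  proof (rule Bochner_Integration.integrable_bound)
    show "integrable lborel (\<lambda>y. C * \<rho> y)"
      using int\<rho> by simp
    show "AE y in lborel. norm (U (T - r\<^sup>2) (x0 + r *\<^sub>R y) * \<rho> y) \<le> norm (C * \<rho> y)"
      using bound(1)[OF times[OF that]] C \<rho>0 by (auto simp: abs_mult intro!: mult_mono)
  qed measurable
  have boundW: "\<bar>W r y * \<rho> y\<bar> \<le> (d + 2 * R) * C * (4 * exp (- ((norm y)\<^sup>2 / 8)))"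
    if "-R < r" "r < R" for r y
  proof -
    have b1: "\<bar>(y \<bullet> b) * Ub b (T - r\<^sup>2) (x0 + r *\<^sub>R y)\<bar> \<le> (1 + norm y) * C" if "b \<in> Basis" for b
      using bound(3)[OF times[OF rR(1)[OF \<open>-R < r\<close> \<open>r < R\<close>]] that, of "x0 + r *\<^sub>R y"] C
        Basis_le_norm[OF that, of y]
      by (auto simp: abs_mult intro!: mult_mono)
    have "\<bar>\<Sum>b\<in>Basis. (y \<bullet> b) * Ub b (T - r\<^sup>2) (x0 + r *\<^sub>R y)\<bar> \<le> (\<Sum>b\<in>(Basis::'a set). (1 + norm y) * C)"
      by (rule order_trans[OF sum_abs sum_mono]) (use b1 in auto)
    moreover have "\<bar>2 * r * Ut (T - r\<^sup>2) (x0 + r *\<^sub>R y)\<bar> \<le> 2 * R * ((1 + norm y) * C)"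
    proof -
      have "\<bar>2 * r\<bar> * \<bar>Ut (T - r\<^sup>2) (x0 + r *\<^sub>R y)\<bar> \<le> (2 * R) * C"
        using bound(2)[OF times[OF rR(1)[OF that]], of "x0 + r *\<^sub>R y"] rR(2)[OF that] C R
        by (intro mult_mono) auto
      also have "\<dots> \<le> 2 * R * ((1 + norm y) * C)"
        using R C by (intro mult_left_mono) (auto simp: algebra_simps)
      finally show ?thesis
        by (simp add: abs_mult)
    qed
    ultimately have "\<bar>W r y\<bar> \<le> d * ((1 + norm y) * C) + 2 * R * ((1 + norm y) * C)"
      unfolding W_def d_def by (simp add: algebra_simps)
    then have "\<bar>W r y * \<rho> y\<bar> \<le> (d * ((1 + norm y) * C) + 2 * R * ((1 + norm y) * C)) * \<rho> y"
      using \<rho>0 by (simp add: abs_mult mult_right_mono)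
    also have "\<dots> = (d + 2 * R) * C * ((1 + norm y) * \<rho> y)"
      by (simp add: algebra_simps)
    also have "\<dots> \<le> (d + 2 * R) * C * (4 * exp (- ((norm y)\<^sup>2 / 8)))"
      by (rule mult_left_mono[OF \<rho>4]) (use R C in \<open>auto simp: d_def\<close>)
    finally show ?thesis .
  qed
  have deriv: "(A has_real_derivative (\<integral>y. W r y * \<rho> y \<partial>lborel)) (at r)" if "-R < r" "r < R" for r
    unfolding A_def[abs_def]
  proof (rule has_real_derivative_lebesgue_integral[OF that])
    show "integrable lborel (\<lambda>y. (d + 2 * R) * C * (4 * exp (- ((norm (y::'a))\<^sup>2 / 8))))"
      using int8[of "(d + 2 * R) * C * 4"] by (simp add: mult.assoc)
    show "((\<lambda>s. U (T - s\<^sup>2) (x0 + s *\<^sub>R y) * \<rho> y) has_real_derivative W s y * \<rho> y) (at s)"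
      if "-R < s" "s < R" for s y
      unfolding W_def using DERIV_cmult_right[OF path[OF rR(1)[OF that]]] by simp
  qed (use boundW intU rR in auto)
  have nonneg: "0 \<le> (\<integral>y. W r y * \<rho> y \<partial>lborel)" if "0 \<le> r" "r < R" for r
  proof -
    define t where "t = T - r\<^sup>2"
    have r2: "r\<^sup>2 \<le> T + 1" and t: "t \<in> {-1..T}"
      using rR[of r] times[of r] that R by (auto simp: t_def)
    define V where "V b y = (y \<bullet> b) * Ub b t (x0 + r *\<^sub>R y) * \<rho> y" for b y
    define L where "L b y = Ubb b t (x0 + r *\<^sub>R y) * \<rho> y" for b y
    define S where "S y = Ut t (x0 + r *\<^sub>R y) * \<rho> y" for y
    have intL: "integrable lborel (L b)" if "b \<in> Basis" for b
      unfolding L_def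
    proof (rule Bochner_Integration.integrable_bound)
      show "integrable lborel (\<lambda>y. C * \<rho> y)"
        using int\<rho> by simp
      show "AE y in lborel. norm (Ubb b t (x0 + r *\<^sub>R y) * \<rho> y) \<le> norm (C * \<rho> y)"
        using bound(4)[OF t that] C \<rho>0 by (auto simp: abs_mult intro!: mult_mono)
    qed measurable
    have intS: "integrable lborel S"
      unfolding S_def
    proof (rule Bochner_Integration.integrable_bound)
      show "integrable lborel (\<lambda>y. C * \<rho> y)"
        using int\<rho> by simp
      show "AE y in lborel. norm (Ut t (x0 + r *\<^sub>R y) * \<rho> y) \<le> norm (C * \<rho> y)"
        using bound(2)[OF t] C \<rho>0 by (auto simp: abs_mult intro!: mult_mono)
    qed measurable
    have V4: "\<bar>V b y\<bar> \<le> 4 * C * exp (- ((norm y)\<^sup>2 / 8))" if "b \<in> Basis" for b y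
    proof -
      have "\<bar>V b y\<bar> = \<bar>y \<bullet> b\<bar> * \<bar>Ub b t (x0 + r *\<^sub>R y)\<bar> * \<rho> y"
        using \<rho>0[of y] by (simp add: V_def abs_mult)
      also have "\<dots> \<le> (1 + norm y) * C * \<rho> y"
        using bound(3)[OF t that, of "x0 + r *\<^sub>R y"] Basis_le_norm[OF that, of y] C \<rho>0[of y]
        by (intro mult_mono) auto
      also have "\<dots> = C * ((1 + norm y) * \<rho> y)"
        by simp
      also have "\<dots> \<le> C * (4 * exp (- ((norm y)\<^sup>2 / 8)))"
        by (rule mult_left_mono[OF \<rho>4 C])
      finally show ?thesis
        by simp
    qed
    have intV: "integrable lborel (V b)" if "b \<in> Basis" for b
      by (rule Bochner_Integration.integrable_bound[OF int8[of "4 * C"]])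
        (use V4[OF that] C in \<open>auto simp: V_def[abs_def]\<close>)
    have ibp: "(\<integral>y. V b y \<partial>lborel) = 2 * r * (\<integral>y. L b y \<partial>lborel)" if b: "b \<in> Basis" for b
    proof -
      define K where "K = (r + 1) * (4 * C)"
      have \<rho>b: "\<rho> y \<le> 4 * exp (- ((norm y)\<^sup>2 / 8))" for y
        using order_trans[OF mult_right_mono[of 1 "1 + norm y" "\<rho> y"] \<rho>4] \<rho>0 by simp
      \<comment> \<open>The integrand is the derivative along \<open>b\<close> of
        \<open>Ub b t (x0 + r y) * \<rho> y\<close>: the inner map contributes \<open>r\<close>, the
        Gaussian contributes \<open>- (y . b) / 2\<close>. The constant \<open>K\<close> dominates
        both the product and its derivative.\<close>
      have "(\<integral>y. r * L b y - V b y / 2 \<partial>lborel) = 0"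
      proof (rule integral_directional_derivative_eq_0
          [where G = "\<lambda>y. Ub b t (x0 + r *\<^sub>R y) * \<rho> y" and b = b and C = K])
        show "\<bar>Ub b t (x0 + r *\<^sub>R y) * \<rho> y\<bar> \<le> K * exp (- ((norm y)\<^sup>2 / 8))" for y
        proof -
          have "\<bar>Ub b t (x0 + r *\<^sub>R y) * \<rho> y\<bar> \<le> C * (4 * exp (- ((norm y)\<^sup>2 / 8)))"
            using bound(3)[OF t b] C \<rho>0 \<rho>b unfolding abs_mult by (intro mult_mono) auto
          also have "\<dots> \<le> K * exp (- ((norm y)\<^sup>2 / 8))"
            using C that \<open>0 \<le> r\<close> by (simp add: K_def algebra_simps)
          finally show ?thesis .
        qed
        show "\<bar>r * L b y - V b y / 2\<bar> \<le> K * exp (- ((norm y)\<^sup>2 / 8))" for y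
        proof -
          have "\<bar>L b y\<bar> \<le> C * (4 * exp (- ((norm y)\<^sup>2 / 8)))"
            unfolding L_def abs_mult
            using bound(4)[OF t b] C \<rho>0 \<rho>b by (intro mult_mono) auto
          then have "\<bar>r * L b y\<bar> \<le> r * (C * (4 * exp (- ((norm y)\<^sup>2 / 8))))"
            using \<open>0 \<le> r\<close> by (simp add: abs_mult mult_left_mono)
          moreover have "\<bar>V b y / 2\<bar> \<le> 4 * C * exp (- ((norm y)\<^sup>2 / 8))"
            using V4[OF b, of y] by simp
          ultimately show ?thesis
            unfolding K_def by (simp add: algebra_simps)
        qed
        show "((\<lambda>s. Ub b t (x0 + r *\<^sub>R (y + s *\<^sub>R b)) * \<rho> (y + s *\<^sub>R b))
            has_real_derivative r * L b y - V b y / 2) (at 0)" for y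
        proof -
          have sq: "(norm (y + s *\<^sub>R b))\<^sup>2 = (norm y)\<^sup>2 + 2 * s * (y \<bullet> b) + s\<^sup>2" for s
            using b unfolding power2_norm_eq_inner
            by (simp add: inner_add_left inner_add_right inner_commute power2_eq_square inner_Basis)
          have 1: "((\<lambda>s. \<rho> (y + s *\<^sub>R b)) has_real_derivative - (y \<bullet> b) / 2 * \<rho> y) (at 0)"
            unfolding \<rho>_def sq by (auto intro!: derivative_eq_intros)
          have "((\<lambda>s. Ub b t ((x0 + r *\<^sub>R y) + s *\<^sub>R b)) has_real_derivative Ubb b t (x0 + r *\<^sub>R y)) (at (r * 0))"
            using dir[OF t b] by simp
          from DERIV_chain2[OF this DERIV_cmult_Id]
          have 2: "((\<lambda>s. Ub b t ((x0 + r *\<^sub>R y) + (r * s) *\<^sub>R b)) has_real_derivative Ubb b t (x0 + r *\<^sub>R y) * r) (at 0)" .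
          show ?thesis
            using DERIV_mult[OF 2 1] by (simp add: L_def V_def algebra_simps)
        qed
      qed (use b in auto)
      then show ?thesis
        using intL[OF b] intV[OF b] by simp
    qed
    have "W r y * \<rho> y = (\<Sum>b\<in>Basis. V b y) - 2 * r * S y" for y
      by (simp add: W_def V_def S_def t_def algebra_simps sum_distrib_right sum_distrib_left)
    then have "(\<integral>y. W r y * \<rho> y \<partial>lborel) = (\<Sum>b\<in>Basis. 2 * r * (\<integral>y. L b y \<partial>lborel)) - 2 * r * (\<integral>y. S y \<partial>lborel)"
      using intV intS by (simp add: ibp)
    also have "\<dots> = 2 * r * (\<integral>y. (\<Sum>b\<in>Basis. L b y) - S y \<partial>lborel)"
      using intL intS by (simp add: sum_distrib_left right_diff_distrib)
    also have "\<dots> \<ge> 0"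
    proof (intro mult_nonneg_nonneg integral_nonneg_AE AE_I2)
      show "0 \<le> (\<Sum>b\<in>Basis. L b y) - S y" for y
        using mult_right_mono[OF sub[OF t, of "x0 + r *\<^sub>R y"] \<rho>0[of y]]
        by (simp add: L_def S_def sum_distrib_right)
    qed (use \<open>0 \<le> r\<close> in auto)
    finally show ?thesis .
  qed
  have "A 0 \<le> A (sqrt T)"
  proof (rule DERIV_nonneg_imp_nondecreasing[where f = A and a = 0 and b = "sqrt T"])
    fix r assume "0 \<le> r" "r \<le> sqrt T"
    then show "\<exists>l. (A has_real_derivative l) (at r) \<and> 0 \<le> l"
      using deriv[of r] nonneg[of r] R by (intro exI[of _ "\<integral>y. W r y * \<rho> y \<partial>lborel"]) auto
  qed (use T in auto)
  then show ?thesis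
    using T by (simp add: A_def \<rho>_def)
qed

section \<open>Eigenfunction bounds\<close>

text \<open>Used with exponents 3 and 2, for the two derivatives of the cube of the positive part.
  Only the point 0 needs an argument: the difference quotient there is at most
  \<open>|y|^(n-1)\<close>.\<close>

lemma has_real_derivative_pos_part_power:
  fixes x :: real
  assumes "2 \<le> n"
  shows "((\<lambda>x. (max 0 x) ^ n) has_real_derivative real n * (max 0 x) ^ (n - 1)) (at x)"
proof -
  consider "x < 0" | "x = 0" | "0 < x"
    by linarith
  then show ?thesis
  proof cases
    case 1
    have "((\<lambda>x. 0) has_real_derivative 0) (at x)"
      by simp
    then have "((\<lambda>x. (max 0 x) ^ n) has_real_derivative 0) (at x)"
      by (rule has_field_derivative_transform_within_open[of _ _ _ "{..<0}"]) (use 1 assms in auto)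
    then show ?thesis
      using 1 assms by (simp add: power_0_left)
  next
    case 2
    have "((\<lambda>y::real. max 0 y ^ n / y) \<longlongrightarrow> 0) (at 0)"
    proof (rule Lim_null_comparison)
      show "\<forall>\<^sub>F y in at 0. norm (max 0 y ^ n / y) \<le> (\<bar>y\<bar>::real) ^ (n - 1)"
      proof (rule eventuallyI)
        fix y :: real
        have "max 0 y ^ n = max 0 y ^ (n - 1) * max 0 y"
          using assms by (metis Suc_diff_1 le_trans one_le_numeral power_Suc2 less_le_trans pos2)
        then show "norm (max 0 y ^ n / y) \<le> \<bar>y\<bar> ^ (n - 1)"
          by (auto simp: max_def)
      qed
      show "((\<lambda>y::real. \<bar>y\<bar> ^ (n - 1)) \<longlongrightarrow> 0) (at 0)"
        using assms by (auto intro!: tendsto_eq_intros)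
    qed
    then show ?thesis
      using assms by (simp add: has_field_derivative_iff 2 power_0_left)
  next
    case 3
    have "((\<lambda>x. x ^ n) has_real_derivative real n * x ^ (n - 1)) (at x)"
      by (auto intro!: derivative_eq_intros)
    then have "((\<lambda>x. (max 0 x) ^ n) has_real_derivative real n * x ^ (n - 1)) (at x)"
      by (rule has_field_derivative_transform_within_open[of _ _ _ "{0<..}"]) (use 3 in auto)
    then show ?thesis
      using 3 by simp
  qed
qed

lemma differentiable_imp_line_derivative:
  fixes f :: "'a::euclidean_space \<Rightarrow> real"
  assumes "f differentiable (at (x + r *\<^sub>R y))"
  shows "((\<lambda>r. f (x + r *\<^sub>R y)) has_real_derivative
      (\<Sum>b\<in>Basis. (y \<bullet> b) * frechet_derivative f (at (x + r *\<^sub>R y)) b)) (at r)"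
proof -
  let ?f' = "frechet_derivative f (at (x + r *\<^sub>R y))"
  have f: "(f has_derivative ?f') (at (x + r *\<^sub>R y))"
    using assms by (simp add: frechet_derivative_works)
  then interpret linear ?f'
    by (rule has_derivative_linear)
  have "((\<lambda>r. x + r *\<^sub>R y) has_derivative (\<lambda>h. h *\<^sub>R y)) (at r)"
    by (auto intro!: derivative_eq_intros)
  from has_derivative_compose[OF this f]
  have "((\<lambda>r. f (x + r *\<^sub>R y)) has_derivative (\<lambda>h. ?f' (h *\<^sub>R y))) (at r)" .
  moreover have "?f' y = (\<Sum>b\<in>Basis. (y \<bullet> b) * ?f' b)"
    by (subst euclidean_representation[of y, symmetric]) (simp add: sum scale del: euclidean_representation)
  ultimately show ?thesis
    by (simp add: has_field_derivative_def scale mult_commute_abs)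
qed

lemma compact_continuous_abs_bounded:
  fixes h :: "'a::topological_space \<Rightarrow> real"
  assumes "compact S" "continuous_on S h"
  shows "\<exists>C\<ge>0. \<forall>x\<in>S. \<bar>h x\<bar> \<le> C"
proof -
  have "bounded (h ` S)"
    using assms by (intro compact_imp_bounded compact_continuous_image)
  then obtain C where "\<forall>x\<in>S. \<bar>h x\<bar> \<le> C"
    by (auto simp: bounded_iff)
  then show ?thesis
    by (intro exI[of _ "max 0 C"]) auto
qed

lemma lborel_integral_dilation:
  fixes f :: "'a::euclidean_space \<Rightarrow> real"
  assumes [measurable]: "f \<in> borel_measurable borel" and s: "0 < s"
  shows "(\<integral>y. f (x + s *\<^sub>R y) \<partial>lborel) * s ^ DIM('a) = (\<integral>y. f y \<partial>lborel)"
proof -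
  have "(\<integral>y. f y \<partial>lborel) = (\<integral>y. f y \<partial>density (distr lborel borel (\<lambda>y. x + s *\<^sub>R y)) (\<lambda>_. ennreal (s ^ DIM('a))))"
    using lborel_affine[of s x] s by simp
  also have "\<dots> = (\<integral>y. s ^ DIM('a) * f y \<partial>distr lborel borel (\<lambda>y. x + s *\<^sub>R y))"
    using s by (subst integral_density) auto
  also have "\<dots> = (\<integral>y. s ^ DIM('a) * f (x + s *\<^sub>R y) \<partial>lborel)"
    by (rule integral_distr) auto
  finally show ?thesis
    by (simp add: mult.commute)
qed

text \<open>The closed sets \<open>closure D\<close> and \<open>- D\<close> cover the space and meet
  in the frontier, where both branches vanish.\<close>

lemma continuous_on_zero_extension:
  fixes f :: "'a::metric_space \<Rightarrow> real"
  assumes "open D" "continuous_on (closure D) f" "\<forall>x\<in>frontier D. f x = 0"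
  shows "continuous_on UNIV (\<lambda>x. if x \<in> D then f x else 0)"
proof -
  have "continuous_on (closure D \<union> - D) (\<lambda>x. if x \<in> D then f x else 0)"
    using assms by (intro continuous_on_cases) (auto simp: frontier_def interior_open closed_Compl)
  moreover have "closure D \<union> - D = UNIV"
    using closure_subset by auto
  ultimately show ?thesis
    by simp
qed

text \<open>Equals \<open>(4 pi)^(d/2)\<close>, the normalising constant of the heat kernel at time
  1; the type argument carries the dimension.\<close>

definition gauss_mass :: "'a::euclidean_space itself \<Rightarrow> real" where
  "gauss_mass _ = (\<integral>y. exp (- ((norm y)\<^sup>2 / 4)) \<partial>(lborel :: 'a measure))"

lemma gauss_mass_pos: "0 < gauss_mass TYPE('a::euclidean_space)"
proof -
  have int: "integrable lborel (\<lambda>y::'a. exp (- ((norm y)\<^sup>2 / 4)))"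
    using integrable_gaussian[of "1/4", where 'a = 'a] by simp
  have "(\<integral>y. exp (- ((norm y)\<^sup>2 / 4)) \<partial>(lborel :: 'a measure)) \<noteq> 0"
  proof
    assume "(\<integral>y. exp (- ((norm y)\<^sup>2 / 4)) \<partial>(lborel :: 'a measure)) = 0"
    then have "AE y in (lborel :: 'a measure). False"
      using integral_nonneg_eq_0_iff_AE[OF int] by simp
    then show False
      using AE_iff_measurable[of UNIV "lborel :: 'a measure" "\<lambda>_. False"] by simp
  qed
  moreover have "0 \<le> (\<integral>y. exp (- ((norm y)\<^sup>2 / 4)) \<partial>(lborel :: 'a measure))"
    by simp
  ultimately show ?thesis
    unfolding gauss_mass_def by linarith
qed

text \<open>In the Gaussian mean of \<open>U 0\<close> the weight is at most 1, and the substitution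
  by \<open>x0 + sqrt T y\<close> produces the power of \<open>sqrt T\<close>. Of the three factors
  of \<open>U 0\<close> one is spent on the sup bound \<open>N\<close> and two form a square, so
  that orthonormality can evaluate the remaining integral.\<close>

lemma dirichlet_heat_sum_bound:
  fixes D :: "'a::euclidean_space set" and e :: "'i \<Rightarrow> 'a \<Rightarrow> real" and c lam :: "'i \<Rightarrow> real"
  assumes D: "open D" "bounded D"
    and I: "finite I"
    and eig: "\<And>k. k \<in> I \<Longrightarrow> dirichlet_eigenfunction D (lam k) (e k)"
    and T: "0 < T" and x0: "x0 \<in> D" and \<epsilon>: "0 < \<epsilon>"
    and N: "\<And>x. x \<in> D \<Longrightarrow> \<bar>\<Sum>k\<in>I. c k * e k x\<bar> \<le> N"
    and int: "integrable (leb D) (\<lambda>x. (\<Sum>k\<in>I. c k * e k x)\<^sup>2)"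
  shows "(max 0 ((\<Sum>k\<in>I. c k * exp (- lam k * T) * e k x0) - \<epsilon>)) ^ 3 * gauss_mass TYPE('a) * sqrt T ^ DIM('a)
      \<le> N * (LINT x|leb D. (\<Sum>k\<in>I. c k * e k x)\<^sup>2)"
proof -
  define eb where "eb k b x = frechet_derivative (e k) (at x) b" for k b x
  define ebb where "ebb k b x = frechet_derivative (eb k b) (at x) b" for k b x
  define E where "E k x = (if x \<in> D then e k x else 0)" for k x
  have Ck: "Ck_on 2 (e k) D" and ec: "continuous_on (closure D) (e k)" and
    lap: "\<And>x. x \<in> D \<Longrightarrow> - laplacian (e k) x = lam k * e k x" and
    e0: "\<forall>x\<in>frontier D. e k x = 0" if "k \<in> I" for k
    using eig[OF that] by (auto simp: dirichlet_eigenfunction_def)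
  have diff1: "e k differentiable (at x)" and diff2: "b \<in> Basis \<Longrightarrow> eb k b differentiable (at x)"
    and cont2': "b \<in> Basis \<Longrightarrow> continuous_on D (ebb k b)" if "k \<in> I" "x \<in> D" for k x b
    using Ck[OF that(1)] that(2) by (auto simp: numeral_2_eq_2 eb_def[abs_def] ebb_def[abs_def])
  have cont2: "continuous_on D (ebb k b)" if "k \<in> I" "b \<in> Basis" for k b
    using cont2'[OF that(1) x0 that(2)] .
  have cont0: "continuous_on D (e k)" if "k \<in> I" for k
    using ec[OF that] by (rule continuous_on_subset) (rule closure_subset)
  have cont1: "continuous_on D (eb k b)" if "k \<in> I" "b \<in> Basis" for k b
    using diff2 that D by (auto simp: continuous_on_eq_continuous_at differentiable_imp_continuous_within)
  define F where "F t x = (\<Sum>k\<in>I. c k * exp (- lam k * t) * e k x)" for t x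
  define Ft where "Ft t x = (\<Sum>k\<in>I. c k * (exp (- lam k * t) * (- lam k)) * e k x)" for t x
  define Fb where "Fb b t x = (\<Sum>k\<in>I. c k * exp (- lam k * t) * eb k b x)" for b t x
  define Fbb where "Fbb b t x = (\<Sum>k\<in>I. c k * exp (- lam k * t) * ebb k b x)" for b t x
  define P where "P t x = max 0 (F t x - \<epsilon>)" for t x
  define U where "U t x = indicator D x *\<^sub>R (P t x ^ 3)" for t x
  define Ut where "Ut t x = indicator D x *\<^sub>R (3 * P t x ^ 2 * Ft t x)" for t x
  define Ub where "Ub b t x = indicator D x *\<^sub>R (3 * P t x ^ 2 * Fb b t x)" for b t x
  define Ubb where "Ubb b t x = indicator D x *\<^sub>R
      (3 * P t x ^ 2 * Fbb b t x + 6 * P t x * (Fb b t x)\<^sup>2)" for b t x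
  \<comment> \<open>A majorant of \<open>F t\<close> on \<open>D\<close> for all
    \<open>|t| <= T + 1\<close> at once, continuous on the whole space because the
    \<open>E k\<close> are. It vanishes off \<open>D\<close>, so \<open>K\<close> is a compact
    subset of \<open>D\<close> independent of time, and every \<open>P t\<close> in this range is 0
    on \<open>D - K\<close>.\<close>
  define W where "W x = (\<Sum>k\<in>I. \<bar>c k\<bar> * exp (\<bar>lam k\<bar> * (T + 1)) * \<bar>E k x\<bar>)" for x
  define K where "K = {x. \<epsilon> \<le> W x}"
  have contE: "continuous_on UNIV (E k)" if "k \<in> I" for k
    unfolding E_def[abs_def] using that D ec e0 by (intro continuous_on_zero_extension) auto
  have "continuous_on UNIV W"
    unfolding W_def[abs_def] using contE by (auto intro!: continuous_intros)
  then have "closed K"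
    unfolding K_def by (intro closed_Collect_le continuous_intros) auto
  have KD: "K \<subseteq> D"
  proof
    fix x
    assume "x \<in> K"
    then show "x \<in> D"
      using \<epsilon> by (cases "x \<in> D") (auto simp: K_def W_def E_def)
  qed
  then have "compact K"
    using D \<open>closed K\<close> bounded_subset compact_eq_bounded_closed by blast
  have FW: "F t x \<le> W x" if "\<bar>t\<bar> \<le> T + 1" "x \<in> D" for t x
    unfolding F_def W_def
  proof (rule sum_mono)
    fix k
    have "- lam k * t \<le> \<bar>lam k\<bar> * (T + 1)"
      using mult_mono[of "\<bar>lam k\<bar>" "\<bar>lam k\<bar>" "\<bar>t\<bar>" "T + 1"] that abs_le_D2[of "lam k * t"]
      by (auto simp: abs_mult)
    have "c k * exp (- lam k * t) * e k x \<le> \<bar>c k\<bar> * exp (- lam k * t) * \<bar>E k x\<bar>"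
      using that abs_ge_self[of "c k * exp (- lam k * t) * e k x"] by (simp add: E_def abs_mult)
    also have "\<dots> \<le> \<bar>c k\<bar> * exp (\<bar>lam k\<bar> * (T + 1)) * \<bar>E k x\<bar>"
      using \<open>- lam k * t \<le> _\<close> by (intro mult_right_mono mult_left_mono) auto
    finally show "c k * exp (- lam k * t) * e k x \<le> \<bar>c k\<bar> * exp (\<bar>lam k\<bar> * (T + 1)) * \<bar>E k x\<bar>" .
  qed
  have P0: "P t x = 0" if "\<bar>t\<bar> \<le> T + 1" "x \<in> D" "x \<notin> K" for t x
    using FW[OF that(1,2)] that(3) by (simp add: P_def K_def)
  have cF: "continuous_on D (F t)" "continuous_on D (Ft t)" "continuous_on D (P t)" for t
    unfolding P_def[abs_def] F_def[abs_def] Ft_def[abs_def] by (intro continuous_intros cont0; assumption)+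
  have cFb: "continuous_on D (Fb b t)" "continuous_on D (Fbb b t)" if "b \<in> Basis" for b t
    unfolding Fb_def[abs_def] Fbb_def[abs_def] by (intro continuous_intros cont1 cont2 that; assumption)+
  have contK: "continuous_on ({-1..T} \<times> K) (\<lambda>p. h (snd p))" if "continuous_on D h" for h :: "'a \<Rightarrow> real"
    by (rule continuous_on_compose2[OF that continuous_on_snd[OF continuous_on_id]]) (use KD in auto)
  have cK: "continuous_on ({-1..T} \<times> K) (\<lambda>p. F (fst p) (snd p))"
     "continuous_on ({-1..T} \<times> K) (\<lambda>p. P (fst p) (snd p))"
     "continuous_on ({-1..T} \<times> K) (\<lambda>p. Ft (fst p) (snd p))"
    unfolding P_def[abs_def] F_def[abs_def] Ft_def[abs_def] by (intro continuous_intros contK cont0; assumption)+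
  have cKb: "continuous_on ({-1..T} \<times> K) (\<lambda>p. Fb b (fst p) (snd p))"
     "continuous_on ({-1..T} \<times> K) (\<lambda>p. Fbb b (fst p) (snd p))" if "b \<in> Basis" for b
    unfolding Fb_def[abs_def] Fbb_def[abs_def] by (intro continuous_intros contK cont1 cont2 that; assumption)+
  have bdd: "\<exists>C\<ge>0. \<forall>t\<in>{-1..T}. \<forall>x. \<bar>indicator D x *\<^sub>R h t x\<bar> \<le> C"
    if h: "continuous_on ({-1..T} \<times> K) (\<lambda>p. h (fst p) (snd p))"
      "\<And>t x. t \<in> {-1..T} \<Longrightarrow> x \<in> D \<Longrightarrow> x \<notin> K \<Longrightarrow> h t x = 0" for h :: "real \<Rightarrow> 'a \<Rightarrow> real"
  proof -
    obtain C where C: "C \<ge> 0" "\<forall>p\<in>{-1..T} \<times> K. \<bar>h (fst p) (snd p)\<bar> \<le> C"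
      using compact_continuous_abs_bounded[OF compact_Times[OF compact_Icc \<open>compact K\<close>] h(1)] by blast
    show ?thesis
    proof (intro exI[of _ C] conjI ballI allI)
      fix t x
      assume t: "t \<in> {-1..T}"
      consider "x \<in> K" | "x \<in> D" "x \<notin> K" | "x \<notin> D"
        by blast
      then show "\<bar>indicator D x *\<^sub>R h t x\<bar> \<le> C"
      proof cases
        case 1
        then show ?thesis
          using C(2)[rule_format, of "(t, x)"] t KD by auto
      qed (use h(2)[OF t] C(1) in auto)
    qed (rule C(1))
  qed
  have P0': "P t x = 0" if "t \<in> {-1..T}" "x \<in> D" "x \<notin> K" for t x
    using that T by (intro P0) auto
  have "\<exists>C\<ge>0. \<forall>t\<in>{-1..T}. \<forall>x. \<bar>U t x\<bar> \<le> C"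
    unfolding U_def using cK P0' by (intro bdd continuous_intros) auto
  then obtain C1 where C1: "C1 \<ge> 0" "\<forall>t\<in>{-1..T}. \<forall>x. \<bar>U t x\<bar> \<le> C1"
    by blast
  have "\<exists>C\<ge>0. \<forall>t\<in>{-1..T}. \<forall>x. \<bar>Ut t x\<bar> \<le> C"
    unfolding Ut_def using cK P0' by (intro bdd continuous_intros) auto
  then obtain C2 where C2: "C2 \<ge> 0" "\<forall>t\<in>{-1..T}. \<forall>x. \<bar>Ut t x\<bar> \<le> C2"
    by blast
  have "\<forall>b\<in>Basis. \<exists>C\<ge>0. \<forall>t\<in>{-1..T}. \<forall>x. \<bar>Ub b t x\<bar> \<le> C"
    unfolding Ub_def using cK cKb P0' by (intro ballI bdd continuous_intros) auto
  then obtain C3 where C3: "\<And>b. b \<in> Basis \<Longrightarrow> C3 b \<ge> 0" "\<And>b t x. b \<in> Basis \<Longrightarrow> t\<in>{-1..T} \<Longrightarrow> \<bar>Ub b t x\<bar> \<le> C3 b"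
    by metis
  have "\<forall>b\<in>Basis. \<exists>C\<ge>0. \<forall>t\<in>{-1..T}. \<forall>x. \<bar>Ubb b t x\<bar> \<le> C"
    unfolding Ubb_def using cK cKb P0' by (intro ballI bdd continuous_intros) auto
  then obtain C4 where C4: "\<And>b. b \<in> Basis \<Longrightarrow> C4 b \<ge> 0" "\<And>b t x. b \<in> Basis \<Longrightarrow> t\<in>{-1..T} \<Longrightarrow> \<bar>Ubb b t x\<bar> \<le> C4 b"
    by metis
  define C where "C = C1 + C2 + sum C3 Basis + sum C4 Basis"
  have C3s: "C3 b \<le> sum C3 Basis" "C4 b \<le> sum C4 Basis" if "b \<in> Basis" for b
    using C3(1) C4(1) that by (auto intro: member_le_sum)
  have Cs: "sum C3 Basis \<ge> 0" "sum C4 Basis \<ge> 0"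
    using C3(1) C4(1) by (auto intro: sum_nonneg)
  have [measurable]: "D \<in> sets borel"
    using D by simp
  have measD: "(\<lambda>x. indicator D x *\<^sub>R h x) \<in> borel_measurable borel" if "continuous_on D h" for h :: "'a \<Rightarrow> real"
    using that by (intro borel_measurable_continuous_on_indicator) auto
  have mU: "U t \<in> borel_measurable borel" for t
    unfolding U_def[abs_def] using cF by (intro measD continuous_intros) auto
  have zero_outside: "x \<notin> K" if "x \<notin> D" for x
    using that KD by auto
  have "U T x0 * gauss_mass TYPE('a) \<le> (\<integral>y. U 0 (x0 + sqrt T *\<^sub>R y) * exp (- ((norm y)\<^sup>2 / 4)) \<partial>lborel)"
    unfolding gauss_mass_def
  \<comment> \<open>The measurability hypotheses run over all vectors \<open>b\<close>, while
    continuity of \<open>Fb\<close> and \<open>Fbb\<close> is available for basis vectors only;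
    hence the value 0 off \<open>Basis\<close>.\<close>
  proof (rule heat_subsolution_le_gaussian_mean[where Ut = Ut and Ub = "\<lambda>b. if b \<in> Basis then Ub b else (\<lambda>_ _. 0)"
        and Ubb = "\<lambda>b. if b \<in> Basis then Ubb b else (\<lambda>_ _. 0)" and C = C, OF T mU])
    show "Ut t \<in> borel_measurable borel" for t
      unfolding Ut_def[abs_def] using cF by (intro measD continuous_intros) auto
    show "(if b \<in> Basis then Ub b else (\<lambda>_ _. 0)) t \<in> borel_measurable borel" for b t
    proof (cases "b \<in> Basis")
      case True
      then have "Ub b t \<in> borel_measurable borel"
        unfolding Ub_def[abs_def] using cF cFb by (intro measD continuous_intros) auto
      then show ?thesis
        using True by simp
    qed simp
    show "(if b \<in> Basis then Ubb b else (\<lambda>_ _. 0)) t \<in> borel_measurable borel" for b t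
    proof (cases "b \<in> Basis")
      case True
      then have "Ubb b t \<in> borel_measurable borel"
        unfolding Ubb_def[abs_def] using cF cFb by (intro measD continuous_intros) auto
      then show ?thesis
        using True by simp
    qed simp
    show "((\<lambda>r. U (T - r\<^sup>2) (x0 + r *\<^sub>R y)) has_real_derivative
        (\<Sum>b\<in>Basis. (y \<bullet> b) * (if b \<in> Basis then Ub b else (\<lambda>_ _. 0)) (T - r\<^sup>2) (x0 + r *\<^sub>R y))
          - 2 * r * Ut (T - r\<^sup>2) (x0 + r *\<^sub>R y)) (at r)" if r: "r\<^sup>2 \<le> T + 1" for r y
    proof (cases "x0 + r *\<^sub>R y \<in> D")
      case True
      have "((\<lambda>r. F (T - r\<^sup>2) (x0 + r *\<^sub>R y)) has_real_derivative
          (\<Sum>b\<in>Basis. (y \<bullet> b) * Fb b (T - r\<^sup>2) (x0 + r *\<^sub>R y)) - 2 * r * Ft (T - r\<^sup>2) (x0 + r *\<^sub>R y)) (at r)"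
      proof -
        have "((\<lambda>r. c k * exp (- lam k * (T - r\<^sup>2)) * e k (x0 + r *\<^sub>R y)) has_real_derivative
           (\<Sum>b\<in>Basis. (y \<bullet> b) * (c k * exp (- lam k * (T - r\<^sup>2)) * eb k b (x0 + r *\<^sub>R y)))
           - 2 * r * (c k * (exp (- lam k * (T - r\<^sup>2)) * (- lam k)) * e k (x0 + r *\<^sub>R y))) (at r)"
          if k: "k \<in> I" for k
        proof -
          have 1: "((\<lambda>r. c k * exp (- lam k * (T - r\<^sup>2))) has_real_derivative
              c k * exp (- lam k * (T - r\<^sup>2)) * (lam k * (2 * r))) (at r)"
            by (auto intro!: derivative_eq_intros)
          from DERIV_mult[OF 1 differentiable_imp_line_derivative[OF diff1[OF k True]]]
          show ?thesis
            by (simp add: eb_def[symmetric] algebra_simps sum_distrib_left sum_distrib_right)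
        qed
        then have "((\<lambda>r. F (T - r\<^sup>2) (x0 + r *\<^sub>R y)) has_real_derivative
           (\<Sum>k\<in>I. (\<Sum>b\<in>Basis. (y \<bullet> b) * (c k * exp (- lam k * (T - r\<^sup>2)) * eb k b (x0 + r *\<^sub>R y)))
           - 2 * r * (c k * (exp (- lam k * (T - r\<^sup>2)) * (- lam k)) * e k (x0 + r *\<^sub>R y)))) (at r)"
          unfolding F_def by (intro DERIV_sum)
        then show ?thesis
          unfolding Fb_def Ft_def sum_subtractf sum_distrib_left by (subst (asm) sum.swap)
      qed
      then have "((\<lambda>r. P (T - r\<^sup>2) (x0 + r *\<^sub>R y) ^ 3) has_real_derivative
          real 3 * P (T - r\<^sup>2) (x0 + r *\<^sub>R y) ^ (3 - 1) *
          ((\<Sum>b\<in>Basis. (y \<bullet> b) * Fb b (T - r\<^sup>2) (x0 + r *\<^sub>R y)) - 2 * r * Ft (T - r\<^sup>2) (x0 + r *\<^sub>R y))) (at r)"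
        unfolding P_def
        by (intro DERIV_chain2[OF has_real_derivative_pos_part_power]) (auto intro!: derivative_eq_intros)
      then have "((\<lambda>r. U (T - r\<^sup>2) (x0 + r *\<^sub>R y)) has_real_derivative
          real 3 * P (T - r\<^sup>2) (x0 + r *\<^sub>R y) ^ (3 - 1) *
          ((\<Sum>b\<in>Basis. (y \<bullet> b) * Fb b (T - r\<^sup>2) (x0 + r *\<^sub>R y)) - 2 * r * Ft (T - r\<^sup>2) (x0 + r *\<^sub>R y))) (at r)"
        by (rule has_field_derivative_transform_within_open[of _ _ _ "(\<lambda>r. x0 + r *\<^sub>R y) -` D"])
          (use True D in \<open>auto simp: U_def intro!: open_vimage continuous_intros\<close>)
      then show ?thesis
        using True by (simp add: Ub_def Ut_def algebra_simps sum_distrib_left)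
    next
      case False
      have "-1 < r\<^sup>2"
        using zero_le_power2[of r] by linarith
      \<comment> \<open>Points outside \<open>D\<close>, those of the frontier included, lie in the
        open set \<open>- K\<close>, where \<open>U\<close> vanishes at all times between
        \<open>-(T + 1)\<close> and \<open>T + 1\<close>; along the path \<open>U\<close> is thus
        locally 0.\<close>
      have "((\<lambda>r. U (T - r\<^sup>2) (x0 + r *\<^sub>R y)) has_real_derivative 0) (at r)"
      proof (rule has_field_derivative_transform_within_open[of "\<lambda>_. 0"])
        show "open ((\<lambda>r. x0 + r *\<^sub>R y) -` (- K) \<inter> (\<lambda>r. T - r\<^sup>2) -` {- (T + 1)<..<T + 1})"
          using \<open>closed K\<close> by (intro open_Int open_vimage continuous_intros) auto
        show "0 = U (T - s\<^sup>2) (x0 + s *\<^sub>R y)"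
          if "s \<in> (\<lambda>r. x0 + r *\<^sub>R y) -` (- K) \<inter> (\<lambda>r. T - r\<^sup>2) -` {- (T + 1)<..<T + 1}" for s
          using that P0[of "T - s\<^sup>2" "x0 + s *\<^sub>R y"] by (auto simp: U_def split: split_indicator)
      qed (use False zero_outside r T \<open>-1 < r\<^sup>2\<close> in auto)
      then show ?thesis
        using False by (simp add: Ub_def Ut_def)
    qed
    show "((\<lambda>s. (if b \<in> Basis then Ub b else (\<lambda>_ _. 0)) t (x + s *\<^sub>R b)) has_real_derivative
        (if b \<in> Basis then Ubb b else (\<lambda>_ _. 0)) t x) (at 0)" if t: "t \<in> {-1..T}" and b: "b \<in> Basis" for t x b
    proof (cases "x \<in> D")
      case True
      have line: "((\<lambda>s. f (x + s *\<^sub>R b)) has_real_derivative frechet_derivative f (at x) b) (at 0)"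
        if "f differentiable (at x)" for f :: "'a \<Rightarrow> real"
      proof -
        have "(\<Sum>b'\<in>Basis. (b \<bullet> b') * frechet_derivative f (at x) b') = (\<Sum>b'\<in>Basis. if b' = b then frechet_derivative f (at x) b' else 0)"
          using b by (intro sum.cong) (auto simp: inner_Basis)
        then show ?thesis
          using differentiable_imp_line_derivative[of f x 0 b] that b by simp
      qed
      have dF: "((\<lambda>s. F t (x + s *\<^sub>R b)) has_real_derivative Fb b t x) (at 0)"
        unfolding F_def Fb_def eb_def
        by (intro DERIV_sum DERIV_cmult line diff1 True)
      have dFb: "((\<lambda>s. Fb b t (x + s *\<^sub>R b)) has_real_derivative Fbb b t x) (at 0)"
        unfolding Fb_def Fbb_def ebb_def
        by (intro DERIV_sum DERIV_cmult line diff2 True b)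
      have dP: "((\<lambda>s. P t (x + s *\<^sub>R b) ^ 2) has_real_derivative real 2 * P t (x + 0 *\<^sub>R b) ^ (2 - 1) * Fb b t x) (at 0)"
        unfolding P_def using dF
        by (intro DERIV_chain2[OF has_real_derivative_pos_part_power]) (auto intro!: derivative_eq_intros)
      have "((\<lambda>s. 3 * (P t (x + s *\<^sub>R b) ^ 2 * Fb b t (x + s *\<^sub>R b))) has_real_derivative
           3 * P t x ^ 2 * Fbb b t x + 6 * P t x * (Fb b t x)\<^sup>2) (at 0)"
        using DERIV_cmult[OF DERIV_mult[OF dP dFb], of 3] by (simp add: algebra_simps power2_eq_square)
      then have "((\<lambda>s. Ub b t (x + s *\<^sub>R b)) has_real_derivative
           3 * P t x ^ 2 * Fbb b t x + 6 * P t x * (Fb b t x)\<^sup>2) (at 0)"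
        by (rule has_field_derivative_transform_within_open[of _ _ _ "(\<lambda>r. x + r *\<^sub>R b) -` D"])
          (use True D in \<open>auto simp: Ub_def intro!: open_vimage continuous_intros\<close>)
      then show ?thesis
        using True b by (simp add: Ubb_def)
    next
      case False
      have "((\<lambda>s. Ub b t (x + s *\<^sub>R b)) has_real_derivative 0) (at 0)"
      proof (rule has_field_derivative_transform_within_open[of "\<lambda>_. 0"])
        show "open ((\<lambda>r. x + r *\<^sub>R b) -` (- K))"
          using \<open>closed K\<close> by (intro open_vimage continuous_intros) auto
        show "0 = Ub b t (x + s *\<^sub>R b)" if "s \<in> (\<lambda>r. x + r *\<^sub>R b) -` (- K)" for s
          using that P0'[OF t, of "x + s *\<^sub>R b"] by (auto simp: Ub_def split: split_indicator)
      qed (use False zero_outside in auto)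
      then show ?thesis
        using False b by (simp add: Ubb_def)
    qed
    show "Ut t x \<le> (\<Sum>b\<in>Basis. (if b \<in> Basis then Ubb b else (\<lambda>_ _. 0)) t x)" for t x
    proof (cases "x \<in> D")
      case True
      have "- lam k * e k x = (\<Sum>b\<in>Basis. ebb k b x)" if "k \<in> I" for k
        using lap[OF that True] by (simp add: laplacian_def ebb_def eb_def[abs_def])
      then have "c k * exp (- lam k * t) * (- lam k * e k x) = (\<Sum>b\<in>Basis. c k * exp (- lam k * t) * ebb k b x)"
        if "k \<in> I" for k
        unfolding sum_distrib_left[symmetric] using that by (simp only:)
      then have "c k * (exp (- lam k * t) * (- lam k)) * e k x = (\<Sum>b\<in>Basis. c k * exp (- lam k * t) * ebb k b x)"
        if "k \<in> I" for k
        using that by (simp only: mult.assoc)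
      then have "Ft t x = (\<Sum>b\<in>Basis. Fbb b t x)"
        unfolding Ft_def Fbb_def by (subst sum.swap) (intro sum.cong refl)
      \<comment> \<open>This surplus of the Laplacian over the time derivative is where convexity
        enters: the second derivative of the cube times the squared gradient.\<close>
      moreover have "0 \<le> (\<Sum>b\<in>Basis. 6 * P t x * (Fb b t x)\<^sup>2)"
        by (intro sum_nonneg) (auto simp: P_def)
      ultimately show ?thesis
        using True by (simp add: Ut_def Ubb_def sum.distrib sum_distrib_left)
    qed (auto simp: Ut_def Ubb_def)
    show "\<bar>U t x\<bar> \<le> C" "\<bar>Ut t x\<bar> \<le> C" if "t \<in> {-1..T}" for t x
      using C1(2)[rule_format, OF that, of x] C2(2)[rule_format, OF that, of x] C1(1) C2(1) Cs
      unfolding C_def by linarith+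
    show "\<bar>(if b \<in> Basis then Ub b else (\<lambda>_ _. 0)) t x\<bar> \<le> C" if "t \<in> {-1..T}" "b \<in> Basis" for t x b
    proof -
      have "\<bar>Ub b t x\<bar> \<le> C"
        using order_trans[OF C3(2)[OF that(2,1)] C3s(1)[OF that(2)], of x] C1(1) C2(1) Cs
        unfolding C_def by linarith
      then show ?thesis
        using that(2) by simp
    qed
    show "\<bar>(if b \<in> Basis then Ubb b else (\<lambda>_ _. 0)) t x\<bar> \<le> C" if "t \<in> {-1..T}" "b \<in> Basis" for t x b
    proof -
      have "\<bar>Ubb b t x\<bar> \<le> C"
        using order_trans[OF C4(2)[OF that(2,1)] C3s(2)[OF that(2)], of x] C1(1) C2(1) Cs
        unfolding C_def by linarith
      then show ?thesis
        using that(2) by simp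
    qed
  qed
  define f0 where "f0 x = (\<Sum>k\<in>I. c k * e k x)" for x
  have N0: "0 \<le> N"
    using N[OF x0] by linarith
  have U0: "0 \<le> U 0 x \<and> U 0 x \<le> indicator D x * (N * (f0 x)\<^sup>2)" for x
  proof (cases "x \<in> D")
    case True
    have F0: "F 0 x = f0 x"
      by (simp add: F_def f0_def)
    have "P 0 x \<le> N" "P 0 x \<le> \<bar>f0 x\<bar>" "0 \<le> P 0 x"
      using N[OF True] \<epsilon> N0 unfolding P_def F0 unfolding f0_def by auto
    then have "P 0 x * (P 0 x)\<^sup>2 \<le> N * \<bar>f0 x\<bar>\<^sup>2"
      by (intro mult_mono power_mono) auto
    then show ?thesis
      using True by (simp add: U_def power3_eq_cube power2_eq_square mult.assoc P_def)
  qed (simp add: U_def)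
  have intD: "integrable lborel (\<lambda>x. indicator D x * (N * (f0 x)\<^sup>2))"
    using int integrable_restrict_space[of D lborel "\<lambda>x. N * (f0 x)\<^sup>2"] by (simp add: f0_def set_integrable_def)
  have intU: "integrable lborel (U 0)"
    by (rule Bochner_Integration.integrable_bound[OF intD]) (use U0 mU N0 in \<open>auto intro!: AE_I2 simp: abs_mult\<close>)
  have intU': "integrable lborel (\<lambda>y. U 0 (x0 + sqrt T *\<^sub>R y))"
  proof -
    have "integrable (density (distr lborel borel (\<lambda>y. x0 + sqrt T *\<^sub>R y)) (\<lambda>_. ennreal (sqrt T ^ DIM('a)))) (U 0)"
      using intU lborel_affine[of "sqrt T" x0] T by simp
    then have "integrable (distr lborel borel (\<lambda>y. x0 + sqrt T *\<^sub>R y)) (\<lambda>y. sqrt T ^ DIM('a) * U 0 y)"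
      using mU T by (subst (asm) integrable_density) auto
    then have "integrable lborel (\<lambda>y. sqrt T ^ DIM('a) * U 0 (x0 + sqrt T *\<^sub>R y))"
      using mU by (subst (asm) integrable_distr_eq) auto
    then show ?thesis
      using T by simp
  qed
  have "(\<integral>y. U 0 (x0 + sqrt T *\<^sub>R y) * exp (- ((norm y)\<^sup>2 / 4)) \<partial>lborel) \<le> (\<integral>y. U 0 (x0 + sqrt T *\<^sub>R y) \<partial>lborel)"
  proof (rule integral_mono)
    show "integrable lborel (\<lambda>y. U 0 (x0 + sqrt T *\<^sub>R y) * exp (- ((norm y)\<^sup>2 / 4)))"
      by (rule Bochner_Integration.integrable_bound[OF intU'])
        (use U0 mU in \<open>auto intro!: AE_I2 mult_left_le simp: abs_mult\<close>)
  qed (use intU' U0 in \<open>auto intro!: mult_left_le\<close>)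
  with \<open>U T x0 * gauss_mass TYPE('a) \<le> _\<close>
  have "U T x0 * gauss_mass TYPE('a) \<le> (\<integral>y. U 0 (x0 + sqrt T *\<^sub>R y) \<partial>lborel)"
    by linarith
  then have "U T x0 * gauss_mass TYPE('a) * sqrt T ^ DIM('a) \<le> (\<integral>y. U 0 y \<partial>lborel)"
    using lborel_integral_dilation[OF mU, of "sqrt T" 0 x0] T
    by (metis mult_right_mono real_sqrt_gt_0_iff zero_le_power less_imp_le)
  also have "\<dots> \<le> (\<integral>x. indicator D x * (N * (f0 x)\<^sup>2) \<partial>lborel)"
    using U0 by (intro integral_mono intU intD) auto
  also have "\<dots> = N * (LINT x|leb D. (f0 x)\<^sup>2)"
    by (subst integral_restrict_space) (auto simp: set_lebesgue_integral_def mult.left_commute)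
  finally show ?thesis
    using x0 by (simp add: U_def P_def F_def f0_def)
qed

section \<open>Square-integrable functions and finite orthonormal sums\<close>

lemma L2_on_mult_integrable:
  assumes "f \<in> L2_on D" "g \<in> L2_on D"
  shows "integrable (leb D) (\<lambda>x. f x * g x)"
proof (rule Bochner_Integration.integrable_bound)
  show "integrable (leb D) (\<lambda>x. (f x)\<^sup>2 + (g x)\<^sup>2)"
    using assms by (auto simp: L2_on_def)
  have "\<bar>f x * g x\<bar> \<le> (f x)\<^sup>2 + (g x)\<^sup>2" for x
  proof -
    have "2 * \<bar>f x * g x\<bar> \<le> (f x)\<^sup>2 + (g x)\<^sup>2"
      using sum_squares_ge_zero[of "\<bar>f x\<bar> - \<bar>g x\<bar>" 0]
      by (simp add: power2_eq_square algebra_simps abs_mult)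
    then show ?thesis
      using abs_ge_zero[of "f x * g x"] by linarith
  qed
  then show "AE x in leb D. norm (f x * g x) \<le> norm ((f x)\<^sup>2 + (g x)\<^sup>2)"
    by simp
qed (use assms in \<open>auto simp: L2_on_def\<close>)

lemma L2_on_cmult: "f \<in> L2_on D \<Longrightarrow> (\<lambda>x. c * f x) \<in> L2_on D"
  by (auto simp: L2_on_def power_mult_distrib)

lemma L2_on_add:
  assumes "f \<in> L2_on D" "g \<in> L2_on D"
  shows "(\<lambda>x. f x + g x) \<in> L2_on D"
  using assms L2_on_mult_integrable[OF assms] by (auto simp: L2_on_def power2_sum mult.assoc)

lemma L2_on_diff:
  assumes "f \<in> L2_on D" "g \<in> L2_on D"
  shows "(\<lambda>x. f x - g x) \<in> L2_on D"
  using L2_on_add[OF assms(1) L2_on_cmult[OF assms(2), of "-1"]] by simp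

lemma L2_on_sum:
  assumes "\<And>k. k \<in> I \<Longrightarrow> f k \<in> L2_on D"
  shows "(\<lambda>x. \<Sum>k\<in>I. f k x) \<in> L2_on D"
  using assms
proof (induction I rule: infinite_finite_induct)
  case (insert k I)
  then show ?case
    using L2_on_add[of "f k" D "\<lambda>x. \<Sum>k\<in>I. f k x"] by simp
qed (auto simp: L2_on_def)

lemma orthonormal_sum_square:
  assumes e: "orthonormal_basis_L2 D e" and I: "finite I"
  shows "(LINT x|leb D. (\<Sum>k\<in>I. c k * e k x)\<^sup>2) = (\<Sum>k\<in>I. (c k)\<^sup>2)"
proof -
  have eL: "e k \<in> L2_on D" and on: "(LINT x|leb D. e j x * e k x) = (if j = k then 1 else 0)" for j k
    using e by (auto simp: orthonormal_basis_L2_def L2_inner_def)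
  have "(LINT x|leb D. (\<Sum>k\<in>I. c k * e k x)\<^sup>2)
      = (LINT x|leb D. (\<Sum>j\<in>I. \<Sum>k\<in>I. (c j * c k) * (e j x * e k x)))"
    by (simp add: power2_eq_square sum_product mult_ac)
  also have "\<dots> = (\<Sum>j\<in>I. \<Sum>k\<in>I. (c j * c k) * (LINT x|leb D. e j x * e k x))"
    using L2_on_mult_integrable[OF eL eL] by (simp add: Bochner_Integration.integral_sum)
  also have "\<dots> = (\<Sum>k\<in>I. (c k)\<^sup>2)"
    using I by (simp add: on power2_eq_square if_distrib cong: if_cong)
  finally show ?thesis .
qed

text \<open>At a maximum point \<open>x0\<close> of \<open>S\<close> the estimate closes on itself.
  With \<open>K = S x0\<close>, the inequality between geometric and arithmetic mean gives the sup
  bound \<open>exp 1 * K\<close>, orthonormality bounds the squared norm by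
  \<open>exp 2 * K\<close>, and at time \<open>T\<close> the heat sum takes the value
  \<open>K\<close> at \<open>x0\<close>. For the shift \<open>K / 2\<close> this reads
  \<open>K^3 / 8 * gauss_mass * T^(d/2) <= exp 3 * K^2\<close>, whence the constant
  \<open>8 * exp 3\<close>.\<close>

lemma dirichlet_spectral_function_bound:
  fixes D :: "'a::euclidean_space set"
  assumes D: "open D" "bounded D" "D \<noteq> {}" and basis: "dirichlet_spectral_basis D lam e"
    and I: "finite I" and \<Lambda>: "0 < \<Lambda>" "\<And>k. k \<in> I \<Longrightarrow> lam k \<le> \<Lambda>" and x: "x \<in> closure D"
  shows "(\<Sum>k\<in>I. (e k x)\<^sup>2) \<le> 8 * exp 3 / gauss_mass TYPE('a) * \<Lambda> powr (real DIM('a) / 2)"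
proof -
  have on: "orthonormal_basis_L2 D e" and eig: "dirichlet_eigenfunction D (lam k) (e k)" for k
    using basis by (auto simp: dirichlet_spectral_basis_def)
  have ec: "continuous_on (closure D) (e k)" and e0: "y \<in> frontier D \<Longrightarrow> e k y = 0" for k y
    using eig[of k] by (auto simp: dirichlet_eigenfunction_def)
  have eL: "e k \<in> L2_on D" for k
    using on by (auto simp: orthonormal_basis_L2_def)
  define S where "S y = (\<Sum>k\<in>I. (e k y)\<^sup>2)" for y
  have "continuous_on (closure D) S"
    unfolding S_def[abs_def] by (intro continuous_intros ec)
  then obtain x0 where x0: "x0 \<in> closure D" and max: "\<And>y. y \<in> closure D \<Longrightarrow> S y \<le> S x0"
    using continuous_attains_sup[of "closure D" S] D by auto
  define K where "K = S x0"
  define T where "T = 1 / \<Lambda>"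
  have T: "0 < T"
    using \<Lambda> by (simp add: T_def)
  have "K \<le> 8 * exp 3 / gauss_mass TYPE('a) * \<Lambda> powr (real DIM('a) / 2)"
  proof (cases "K = 0")
    case True
    then show ?thesis
      using gauss_mass_pos[where 'a = 'a] \<Lambda> by simp
  next
    case False
    moreover have "0 \<le> K"
      by (auto simp: K_def S_def intro: sum_nonneg)
    ultimately have K: "0 < K"
      by simp
    have x0D: "x0 \<in> D"
    proof (rule ccontr)
      assume "x0 \<notin> D"
      then have "x0 \<in> frontier D"
        using x0 D by (simp add: frontier_def interior_open)
      then show False
        using K e0 by (simp add: K_def S_def)
    qed
    define c where "c k = exp (lam k * T) * e k x0" for k
    have exp1: "exp (lam k * T) \<le> exp 1" if "k \<in> I" for k
      using \<Lambda>(2)[OF that] \<Lambda>(1) by (simp add: T_def)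
    have N: "\<bar>\<Sum>k\<in>I. c k * e k y\<bar> \<le> exp 1 * K" if "y \<in> D" for y
    proof -
      have "\<bar>\<Sum>k\<in>I. c k * e k y\<bar> \<le> (\<Sum>k\<in>I. exp 1 * (((e k x0)\<^sup>2 + (e k y)\<^sup>2) / 2))"
      proof (rule order_trans[OF sum_abs sum_mono])
        fix k assume k: "k \<in> I"
        have "\<bar>e k x0 * e k y\<bar> \<le> ((e k x0)\<^sup>2 + (e k y)\<^sup>2) / 2"
          using sum_squares_ge_zero[of "\<bar>e k x0\<bar> - \<bar>e k y\<bar>" 0]
          by (simp add: power2_eq_square algebra_simps abs_mult)
        then have "exp (lam k * T) * \<bar>e k x0 * e k y\<bar> \<le> exp 1 * (((e k x0)\<^sup>2 + (e k y)\<^sup>2) / 2)"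
          using exp1[OF k] by (intro mult_mono) auto
        then show "\<bar>c k * e k y\<bar> \<le> exp 1 * (((e k x0)\<^sup>2 + (e k y)\<^sup>2) / 2)"
          by (simp add: c_def abs_mult mult.assoc)
      qed
      also have "\<dots> = exp 1 * ((S x0 + S y) / 2)"
        by (simp add: S_def sum_distrib_left[symmetric] sum_divide_distrib[symmetric] sum.distrib)
      also have "\<dots> \<le> exp 1 * K"
        using max[of y] that closure_subset by (intro mult_left_mono) (auto simp: K_def)
      finally show ?thesis .
    qed
    have sq: "(LINT y|leb D. (\<Sum>k\<in>I. c k * e k y)\<^sup>2) \<le> (exp 1)\<^sup>2 * K"
    proof -
      have "(\<Sum>k\<in>I. (c k)\<^sup>2) \<le> (\<Sum>k\<in>I. (exp 1)\<^sup>2 * (e k x0)\<^sup>2)"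
        unfolding c_def power_mult_distrib using exp1
        by (intro sum_mono mult_right_mono power_mono) auto
      then show ?thesis
        by (simp add: orthonormal_sum_square[OF on I] K_def S_def sum_distrib_left)
    qed
    have int: "integrable (leb D) (\<lambda>x. (\<Sum>k\<in>I. c k * e k x)\<^sup>2)"
      using L2_on_sum[of I "\<lambda>k x. c k * e k x" D] L2_on_cmult[OF eL] by (auto simp: L2_on_def)
    have val: "(\<Sum>k\<in>I. c k * exp (- lam k * T) * e k x0) = K"
    proof -
      have "c k * exp (- lam k * T) * e k x0 = (exp (lam k * T) * exp (- (lam k * T))) * (e k x0)\<^sup>2" for k
        by (simp add: c_def power2_eq_square mult_ac)
      also have "\<dots> k = (e k x0)\<^sup>2" for k
        by (simp flip: exp_add)
      finally show ?thesis
        by (simp add: K_def S_def)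
    qed
    have "(max 0 (K - K / 2)) ^ 3 * gauss_mass TYPE('a) * sqrt T ^ DIM('a)
        \<le> exp 1 * K * (LINT y|leb D. (\<Sum>k\<in>I. c k * e k y)\<^sup>2)"
      using dirichlet_heat_sum_bound[where c = c and N = "exp 1 * K" and e = e and lam = lam,
          OF D(1,2) I eig T x0D half_gt_zero[OF K] N int]
      by (simp only: val)
    also have "\<dots> \<le> exp 1 * K * ((exp 1)\<^sup>2 * K)"
      using K sq by (intro mult_left_mono) auto
    also have "\<dots> = exp 3 * K\<^sup>2"
      by (simp add: power2_eq_square mult_ac flip: exp_add)
    finally have "K ^ 3 * (gauss_mass TYPE('a) * sqrt T ^ DIM('a)) \<le> 8 * exp 3 * K\<^sup>2"
      using K by (simp add: power_divide max_def field_simps)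
    then have "K\<^sup>2 * (K * (gauss_mass TYPE('a) * sqrt T ^ DIM('a))) \<le> K\<^sup>2 * (8 * exp 3)"
      by (simp add: power2_eq_square power3_eq_cube mult_ac)
    then have "K * (gauss_mass TYPE('a) * sqrt T ^ DIM('a)) \<le> 8 * exp 3"
      using K by simp
    moreover have "sqrt T ^ DIM('a) * \<Lambda> powr (real DIM('a) / 2) = 1"
    proof -
      have "sqrt T ^ DIM('a) = T powr (real DIM('a) / 2)"
        using T by (simp add: powr_half_sqrt[symmetric] powr_realpow[symmetric] powr_powr)
      then show ?thesis
        using \<Lambda> by (simp add: T_def powr_mult[symmetric])
    qed
    ultimately show ?thesis
      using gauss_mass_pos[where 'a = 'a] mult_right_mono[of "K * (gauss_mass TYPE('a) * sqrt T ^ DIM('a))" "8 * exp 3" "\<Lambda> powr (real DIM('a) / 2)"]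
      by (simp add: field_simps)
  qed
  then show ?thesis
    using max[OF x] by (simp add: K_def S_def)
qed

text \<open>The eigenvalues in the shell from \<open>m * 2^i\<close> to \<open>m * 2^(i+1)\<close>
  contribute at most a constant times \<open>(m * 2^i)^(-s) * (m * 2^(i+1))^d\<close>, with
  \<open>d\<close> half the dimension; this is geometric in \<open>i\<close> with ratio
  \<open>q = 2^(d - s) < 1\<close>.\<close>

lemma dirichlet_spectral_zeta_bound:
  fixes D :: "'a::euclidean_space set"
  assumes D: "open D" "bounded D" "D \<noteq> {}" and basis: "dirichlet_spectral_basis D lam e"
    and s: "real DIM('a) / 2 < s"
  shows "\<exists>B\<ge>0. \<forall>n. \<forall>x\<in>closure D. (\<Sum>k<n. lam k powr (- s) * (e k x)\<^sup>2) \<le> B"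
proof -
  define d where "d = real DIM('a) / 2"
  define C where "C = 8 * exp 3 / gauss_mass TYPE('a)"
  have C: "0 \<le> C"
    using gauss_mass_pos[where 'a = 'a] by (simp add: C_def)
  have lam: "\<And>k. 0 < lam k" and lim: "filterlim lam at_top sequentially"
    using basis by (auto simp: dirichlet_spectral_basis_def)
  \<comment> \<open>Only finitely many eigenvalues lie below 1, so their minimum with 1 is a
    positive lower bound; it makes every shell index a natural number.\<close>
  obtain m where m: "0 < m" "\<And>k. m \<le> lam k"
  proof -
    obtain k0 where k0: "\<And>k. k \<ge> k0 \<Longrightarrow> 1 \<le> lam k"
      using lim by (auto simp: filterlim_at_top eventually_sequentially)
    define m where "m = Min (insert 1 (lam ` {..<k0}))"
    have "0 < m"
      unfolding m_def using lam by (subst Min_gr_iff) auto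
    moreover have "m \<le> lam k" for k
    proof (cases "k < k0")
      case True
      then show ?thesis
        unfolding m_def by (intro Min_le) auto
    next
      case False
      have "m \<le> 1"
        unfolding m_def by (intro Min_le) auto
      also have "1 \<le> lam k"
        using k0 False by simp
      finally show ?thesis .
    qed
    ultimately show ?thesis
      by (rule that)
  qed
  define j where "j k = nat \<lfloor>log 2 (lam k / m)\<rfloor>" for k
  have j: "m * 2 ^ j k \<le> lam k" "lam k \<le> m * 2 ^ Suc (j k)" for k
  proof -
    define l where "l = log 2 (lam k / m)"
    have l: "0 \<le> l"
      using m(1) m(2)[of k] by (simp add: l_def)
    have lk: "lam k = m * 2 powr l"
      using m(1) lam[of k] by (simp add: l_def)
    have "real (j k) \<le> l" "l \<le> real (Suc (j k))"
      using l unfolding j_def l_def[symmetric] by linarith+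
    then have "2 powr real (j k) \<le> 2 powr l" "2 powr l \<le> 2 powr real (Suc (j k))"
      by (auto intro: powr_mono)
    then show "m * 2 ^ j k \<le> lam k" "lam k \<le> m * 2 ^ Suc (j k)"
      using m(1) unfolding lk by (simp_all only: powr_realpow zero_less_numeral mult_le_cancel_left_pos)
  qed
  define q :: real where "q = 2 powr (d - s)"
  have q: "0 < q" "q < 1"
    using s powr_less_mono[of "d - s" 0 2] by (auto simp: q_def d_def)
  define A where "A = C * m powr (d - s) * 2 powr d"
  have A: "0 \<le> A"
    using C by (simp add: A_def)
  have "(\<Sum>k<n. lam k powr (- s) * (e k x)\<^sup>2) \<le> A * (1 / (1 - q))" if x: "x \<in> closure D" for n x
  proof -
    \<comment> \<open>The entry 0 keeps the maximum meaningful for \<open>n = 0\<close>.\<close>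
    define J where "J = Max (insert 0 (j ` {..<n}))"
    have "(\<Sum>k<n. lam k powr (- s) * (e k x)\<^sup>2)
        = (\<Sum>i\<le>J. \<Sum>k | k \<in> {..<n} \<and> j k = i. lam k powr (- s) * (e k x)\<^sup>2)"
      by (rule sum.group[symmetric]) (auto simp: J_def)
    also have "\<dots> \<le> (\<Sum>i\<le>J. A * q ^ i)"
    proof (rule sum_mono)
      fix i
      let ?I = "{k \<in> {..<n}. j k = i}"
      have "(\<Sum>k\<in>?I. lam k powr (- s) * (e k x)\<^sup>2) \<le> (\<Sum>k\<in>?I. (m * 2 ^ i) powr (- s) * (e k x)\<^sup>2)"
      proof (intro sum_mono mult_right_mono)
        fix k assume "k \<in> ?I"
        then show "lam k powr (- s) \<le> (m * 2 ^ i) powr (- s)"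
          using j(1)[of k] m(1) s by (intro powr_mono2') auto
      qed simp
      also have "\<dots> = (m * 2 ^ i) powr (- s) * (\<Sum>k\<in>?I. (e k x)\<^sup>2)"
        by (simp add: sum_distrib_left)
      also have "\<dots> \<le> (m * 2 ^ i) powr (- s) * (C * (m * 2 ^ Suc i) powr d)"
        unfolding C_def d_def
        by (rule mult_left_mono[OF dirichlet_spectral_function_bound[OF D basis _ _ _ x]])
          (use j(2) m(1) in auto)
      also have "\<dots> = A * q ^ i"
      proof -
        have p: "(2::real) ^ i = 2 powr i" "(2::real) ^ Suc i = 2 powr (1 + real i)" "q ^ i = 2 powr ((d - s) * i)"
          by (simp_all add: q_def powr_powr[symmetric] powr_realpow[symmetric] powr_add)
        have "m powr (- s) * m powr d = m powr (d - s)"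
          by (simp flip: powr_add)
        moreover have "2 powr (real i * - s) * 2 powr ((1 + real i) * d) = 2 powr d * 2 powr ((d - s) * real i)"
          unfolding powr_add[symmetric] by (simp add: algebra_simps)
        moreover have "(m * 2 powr real i) powr (- s) * (C * (m * 2 powr (1 + real i)) powr d)
            = C * (m powr (- s) * m powr d) * (2 powr (real i * - s) * 2 powr ((1 + real i) * d))"
          using m(1) by (simp only: powr_mult powr_powr mult_ac)
        ultimately show ?thesis
          unfolding p A_def by (simp only: mult_ac)
      qed
      finally show "(\<Sum>k\<in>?I. lam k powr (- s) * (e k x)\<^sup>2) \<le> A * q ^ i" .
    qed
    also have "\<dots> = A * (\<Sum>i\<le>J. q ^ i)"
      by (simp add: sum_distrib_left)
    also have "\<dots> \<le> A * (\<Sum>i. q ^ i)"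
      using q A by (intro mult_left_mono sum_le_suminf summable_geometric) auto
    also have "\<dots> = A * (1 / (1 - q))"
      using q by (simp add: suminf_geometric)
    finally show ?thesis .
  qed
  then show ?thesis
    using A q by (intro exI[of _ "A * (1 / (1 - q))"]) auto
qed

text \<open>Integration of the pointwise zeta bound over \<open>D\<close>: each
  \<open>(e k)^2\<close> has integral 1, and \<open>D\<close> has finite measure.\<close>

lemma summable_dirichlet_eigenvalues_powr:
  fixes D :: "'a::euclidean_space set"
  assumes D: "open D" "bounded D" "D \<noteq> {}" and basis: "dirichlet_spectral_basis D lam e"
    and s: "real DIM('a) / 2 < s"
  shows "summable (\<lambda>k. lam k powr (- s))"
proof -
  obtain B where B: "0 \<le> B" "\<And>n x. x \<in> closure D \<Longrightarrow> (\<Sum>k<n. lam k powr (- s) * (e k x)\<^sup>2) \<le> B"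
    using dirichlet_spectral_zeta_bound[OF assms] by blast
  have on: "orthonormal_basis_L2 D e"
    using basis by (auto simp: dirichlet_spectral_basis_def)
  have int: "integrable (leb D) (\<lambda>x. e k x * e k x)" and one: "(LINT x|leb D. e k x * e k x) = 1" for k
    using on by (auto simp: orthonormal_basis_L2_def L2_inner_def L2_on_mult_integrable)
  have fin: "finite_measure (leb D)"
    using emeasure_bounded_finite[OF D(2)] D(1)
    by (intro finite_measureI) (simp add: emeasure_restrict_space space_restrict_space)
  show ?thesis
  proof (rule summableI_nonneg_bounded)
    fix n
    have "(\<Sum>k<n. lam k powr (- s)) = (LINT x|leb D. (\<Sum>k<n. lam k powr (- s) * (e k x * e k x)))"
      using int by (simp add: one)
    also have "\<dots> \<le> (LINT x|leb D. B)"
    proof (rule integral_mono)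
      show "integrable (leb D) (\<lambda>x. B)"
        using fin by (simp add: finite_measure.integrable_const)
      show "(\<Sum>k<n. lam k powr (- s) * (e k x * e k x)) \<le> B" if "x \<in> space (leb D)" for x
        using B(2)[of x n] that closure_subset
        by (auto simp: space_restrict_space power2_eq_square)
    qed (use int in auto)
    finally show "(\<Sum>k<n. lam k powr (- s)) \<le> (LINT x|leb D. B)" .
  qed simp
qed

section \<open>Convergence in probability\<close>

text \<open>Applied to differences this is a metric for convergence in probability; the truncation
  at 1 makes it finite for variables without moments.\<close>

definition l0 :: "'w measure \<Rightarrow> ('w \<Rightarrow> real) \<Rightarrow> real" where
  "l0 M X = (LINT \<omega>|M. min 1 \<bar>X \<omega>\<bar>)"

lemma min_1_abs_eq_0: "min 1 \<bar>x\<bar> = 0 \<longleftrightarrow> x = (0::real)"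
  by auto

context prob_space
begin

lemma integrable_min1:
  fixes X :: "'a \<Rightarrow> real"
  assumes "X \<in> borel_measurable M"
  shows "integrable M (\<lambda>\<omega>. min 1 \<bar>X \<omega>\<bar>)"
  by (rule integrable_const_bound[where B = 1]) (use assms in auto)

lemma l0_nonneg: "0 \<le> l0 M X"
  unfolding l0_def by (rule Bochner_Integration.integral_nonneg) auto

lemma l0_cong_AE:
  assumes "X \<in> borel_measurable M" "Y \<in> borel_measurable M" "AE \<omega> in M. X \<omega> = Y \<omega>"
  shows "l0 M X = l0 M Y"
  unfolding l0_def by (rule integral_cong_AE) (use assms in auto)

text \<open>The truncation destroys homogeneity: a scalar \<open>a\<close> costs the factor
  \<open>max 1 |a|\<close>. For scalars 1 and -1 this is the triangle inequality.\<close>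

lemma l0_lincomb:
  assumes [measurable]: "X \<in> borel_measurable M" "Y \<in> borel_measurable M"
  shows "l0 M (\<lambda>\<omega>. a * X \<omega> + b * Y \<omega>) \<le> max 1 \<bar>a\<bar> * l0 M X + max 1 \<bar>b\<bar> * l0 M Y"
proof -
  have 1: "min 1 \<bar>a * x\<bar> \<le> max 1 \<bar>a\<bar> * min 1 \<bar>x\<bar>" for a x :: real
  proof (cases "\<bar>x\<bar> \<le> 1")
    case True
    have "min 1 \<bar>a * x\<bar> \<le> \<bar>a\<bar> * \<bar>x\<bar>"
      by (simp add: abs_mult)
    also have "\<dots> \<le> max 1 \<bar>a\<bar> * \<bar>x\<bar>"
      by (intro mult_right_mono) auto
    finally show ?thesis
      using True by (simp add: min_def)
  qed auto
  have 2: "min 1 \<bar>x + y\<bar> \<le> min 1 \<bar>x\<bar> + min 1 \<bar>y\<bar>" for x y :: real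
    by auto
  have "min 1 \<bar>a * X \<omega> + b * Y \<omega>\<bar> \<le> max 1 \<bar>a\<bar> * min 1 \<bar>X \<omega>\<bar> + max 1 \<bar>b\<bar> * min 1 \<bar>Y \<omega>\<bar>" for \<omega>
    using 1[of a "X \<omega>"] 1[of b "Y \<omega>"] 2[of "a * X \<omega>" "b * Y \<omega>"] by linarith
  then have "l0 M (\<lambda>\<omega>. a * X \<omega> + b * Y \<omega>)
      \<le> (LINT \<omega>|M. max 1 \<bar>a\<bar> * min 1 \<bar>X \<omega>\<bar> + max 1 \<bar>b\<bar> * min 1 \<bar>Y \<omega>\<bar>)"
    unfolding l0_def by (intro integral_mono Bochner_Integration.integrable_add integrable_mult_right integrable_min1) auto
  also have "\<dots> = max 1 \<bar>a\<bar> * l0 M X + max 1 \<bar>b\<bar> * l0 M Y"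
    unfolding l0_def by (subst Bochner_Integration.integral_add) (auto intro!: integrable_min1)
  finally show ?thesis .
qed

lemma l0_eq_0_iff:
  assumes "X \<in> borel_measurable M"
  shows "l0 M X = 0 \<longleftrightarrow> (AE \<omega> in M. X \<omega> = 0)"
proof -
  have "l0 M X = 0 \<longleftrightarrow> (AE \<omega> in M. min 1 \<bar>X \<omega>\<bar> = 0)"
    unfolding l0_def by (rule integral_nonneg_eq_0_iff_AE) (use integrable_min1[OF assms] in auto)
  then show ?thesis
    by (simp add: min_1_abs_eq_0)
qed

lemma l0_le_prob:
  assumes [measurable]: "X \<in> borel_measurable M" and "0 \<le> \<epsilon>"
  shows "l0 M X \<le> \<epsilon> + prob {\<omega> \<in> space M. \<epsilon> < \<bar>X \<omega>\<bar>}"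
proof -
  have "l0 M X \<le> (LINT \<omega>|M. \<epsilon> + indicator {\<omega> \<in> space M. \<epsilon> < \<bar>X \<omega>\<bar>} \<omega>)"
    unfolding l0_def
  proof (rule integral_mono)
    show "integrable M (\<lambda>\<omega>. \<epsilon> + indicator {\<omega> \<in> space M. \<epsilon> < \<bar>X \<omega>\<bar>} \<omega>)"
      by (intro Bochner_Integration.integrable_add) (auto simp: less_top[symmetric])
  qed (use assms integrable_min1 in \<open>auto split: split_indicator\<close>)
  also have "\<dots> = \<epsilon> + prob {\<omega> \<in> space M. \<epsilon> < \<bar>X \<omega>\<bar>}"
    by (subst Bochner_Integration.integral_add) (auto simp: less_top[symmetric] prob_space)
  finally show ?thesis .
qed

lemma prob_le_l0:
  assumes [measurable]: "X \<in> borel_measurable M" and \<epsilon>: "0 < \<epsilon>"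
  shows "prob {\<omega> \<in> space M. \<epsilon> < \<bar>X \<omega>\<bar>} \<le> l0 M X / min 1 \<epsilon>"
proof -
  have "min 1 \<epsilon> * prob {\<omega> \<in> space M. \<epsilon> < \<bar>X \<omega>\<bar>}
      = (LINT \<omega>|M. min 1 \<epsilon> * indicator {\<omega> \<in> space M. \<epsilon> < \<bar>X \<omega>\<bar>} \<omega>)"
    by simp
  also have "\<dots> \<le> l0 M X"
    unfolding l0_def
    by (rule integral_mono) (use assms integrable_min1 in \<open>auto simp: less_top[symmetric] split: split_indicator\<close>)
  finally show ?thesis
    using \<epsilon> by (simp add: field_simps)
qed

lemma conv_in_prob_iff_l0:
  "conv_in_prob M X Y \<longleftrightarrow> (\<forall>n. X n \<in> borel_measurable M) \<and> Y \<in> borel_measurable M \<and>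
     (\<lambda>n. l0 M (\<lambda>\<omega>. X n \<omega> - Y \<omega>)) \<longlonglongrightarrow> 0"
proof (intro iffI conjI)
  assume conv: "conv_in_prob M X Y"
  then have [measurable]: "\<And>n. X n \<in> borel_measurable M" "Y \<in> borel_measurable M"
    by (auto simp: conv_in_prob_def)
  show "(\<lambda>n. l0 M (\<lambda>\<omega>. X n \<omega> - Y \<omega>)) \<longlonglongrightarrow> 0"
  proof (rule LIMSEQ_I)
    fix r :: real assume r: "0 < r"
    have "(\<lambda>n. prob {\<omega> \<in> space M. r / 2 < \<bar>X n \<omega> - Y \<omega>\<bar>}) \<longlonglongrightarrow> 0"
      using conv half_gt_zero[OF r] unfolding conv_in_prob_def by blast
    from LIMSEQ_D[OF this half_gt_zero[OF r]] obtain n0 where "\<And>n. n \<ge> n0 \<Longrightarrow> norm (prob {\<omega> \<in> space M. r / 2 < \<bar>X n \<omega> - Y \<omega>\<bar>} - 0) < r / 2"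
      by blast
    then have "norm (l0 M (\<lambda>\<omega>. X n \<omega> - Y \<omega>) - 0) < r" if "n \<ge> n0" for n
      using l0_le_prob[of "\<lambda>\<omega>. X n \<omega> - Y \<omega>" "r / 2"] l0_nonneg[of "\<lambda>\<omega>. X n \<omega> - Y \<omega>"] r that by fastforce
    then show "\<exists>n0. \<forall>n\<ge>n0. norm (l0 M (\<lambda>\<omega>. X n \<omega> - Y \<omega>) - 0) < r"
      by blast
  qed
next
  assume a: "(\<forall>n. X n \<in> borel_measurable M) \<and> Y \<in> borel_measurable M \<and>
     (\<lambda>n. l0 M (\<lambda>\<omega>. X n \<omega> - Y \<omega>)) \<longlonglongrightarrow> 0"
  have "(\<lambda>n. prob {\<omega> \<in> space M. \<epsilon> < \<bar>X n \<omega> - Y \<omega>\<bar>}) \<longlonglongrightarrow> 0" if "0 < \<epsilon>" for \<epsilon>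
  proof (rule tendsto_sandwich[OF _ _ tendsto_const])
    show "(\<lambda>n. l0 M (\<lambda>\<omega>. X n \<omega> - Y \<omega>) / min 1 \<epsilon>) \<longlonglongrightarrow> 0"
      using tendsto_divide[OF conjunct2[OF conjunct2[OF a]] tendsto_const[of "min 1 \<epsilon>"]] that by simp
    show "\<forall>\<^sub>F n in sequentially. prob {\<omega> \<in> space M. \<epsilon> < \<bar>X n \<omega> - Y \<omega>\<bar>} \<le> l0 M (\<lambda>\<omega>. X n \<omega> - Y \<omega>) / min 1 \<epsilon>"
      using a by (intro always_eventually allI prob_le_l0 that borel_measurable_diff) auto
  qed simp
  with a show "conv_in_prob M X Y"
    by (auto simp: conv_in_prob_def)
qed (auto simp: conv_in_prob_def)

lemma conv_in_prob_lincomb: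
  assumes "conv_in_prob M X Y" "conv_in_prob M X' Y'"
  shows "conv_in_prob M (\<lambda>n \<omega>. a * X n \<omega> + b * X' n \<omega>) (\<lambda>\<omega>. a * Y \<omega> + b * Y' \<omega>)"
proof -
  have [measurable]: "\<And>n. X n \<in> borel_measurable M" "Y \<in> borel_measurable M"
    "\<And>n. X' n \<in> borel_measurable M" "Y' \<in> borel_measurable M"
    and lim: "(\<lambda>n. l0 M (\<lambda>\<omega>. X n \<omega> - Y \<omega>)) \<longlonglongrightarrow> 0" "(\<lambda>n. l0 M (\<lambda>\<omega>. X' n \<omega> - Y' \<omega>)) \<longlonglongrightarrow> 0"
    using assms by (auto simp: conv_in_prob_iff_l0)
  have "(\<lambda>n. l0 M (\<lambda>\<omega>. a * X n \<omega> + b * X' n \<omega> - (a * Y \<omega> + b * Y' \<omega>))) \<longlonglongrightarrow> 0"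
  proof (rule tendsto_sandwich[OF _ _ tendsto_const])
    show "(\<lambda>n. max 1 \<bar>a\<bar> * l0 M (\<lambda>\<omega>. X n \<omega> - Y \<omega>) + max 1 \<bar>b\<bar> * l0 M (\<lambda>\<omega>. X' n \<omega> - Y' \<omega>)) \<longlonglongrightarrow> 0"
      using lim by (auto intro!: tendsto_eq_intros)
    show "\<forall>\<^sub>F n in sequentially. l0 M (\<lambda>\<omega>. a * X n \<omega> + b * X' n \<omega> - (a * Y \<omega> + b * Y' \<omega>))
        \<le> max 1 \<bar>a\<bar> * l0 M (\<lambda>\<omega>. X n \<omega> - Y \<omega>) + max 1 \<bar>b\<bar> * l0 M (\<lambda>\<omega>. X' n \<omega> - Y' \<omega>)"
      using l0_lincomb[of "\<lambda>\<omega>. X _ \<omega> - Y \<omega>" "\<lambda>\<omega>. X' _ \<omega> - Y' \<omega>" a b]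
      by (intro always_eventually allI) (simp add: algebra_simps)
  qed (simp add: l0_nonneg)
  then show ?thesis
    by (simp add: conv_in_prob_iff_l0)
qed

lemma conv_in_prob_unique:
  assumes "conv_in_prob M X Y" "conv_in_prob M X Z"
  shows "AE \<omega> in M. Y \<omega> = Z \<omega>"
proof -
  have "conv_in_prob M (\<lambda>n \<omega>. 1 * X n \<omega> + (-1) * X n \<omega>) (\<lambda>\<omega>. 1 * Y \<omega> + (-1) * Z \<omega>)"
    by (intro conv_in_prob_lincomb assms)
  then have m: "(\<lambda>\<omega>. Y \<omega> - Z \<omega>) \<in> borel_measurable M" and "(\<lambda>n::nat. l0 M (\<lambda>\<omega>. Z \<omega> - Y \<omega>)) \<longlonglongrightarrow> 0"
    by (auto simp: conv_in_prob_iff_l0)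
  then have "l0 M (\<lambda>\<omega>. Z \<omega> - Y \<omega>) = 0"
    by (simp add: LIMSEQ_const_iff)
  moreover have "l0 M (\<lambda>\<omega>. Z \<omega> - Y \<omega>) = l0 M (\<lambda>\<omega>. Y \<omega> - Z \<omega>)"
    by (simp add: l0_def abs_minus_commute)
  ultimately show ?thesis
    using l0_eq_0_iff[OF m] by simp
qed

lemma conv_in_prob_cong_AE:
  assumes "conv_in_prob M X Y" "\<And>n. X' n \<in> borel_measurable M" "\<And>n. AE \<omega> in M. X n \<omega> = X' n \<omega>"
    "Y' \<in> borel_measurable M" "AE \<omega> in M. Y \<omega> = Y' \<omega>"
  shows "conv_in_prob M X' Y'"
proof -
  have [measurable]: "\<And>n. X n \<in> borel_measurable M" "Y \<in> borel_measurable M"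
    using assms(1) by (auto simp: conv_in_prob_iff_l0)
  note [measurable] = assms(2,4)
  have "l0 M (\<lambda>\<omega>. X n \<omega> - Y \<omega>) = l0 M (\<lambda>\<omega>. X' n \<omega> - Y' \<omega>)" for n
    using assms(3)[of n] assms(5) by (intro l0_cong_AE) auto
  then show ?thesis
    using assms(1) by (auto simp: conv_in_prob_iff_l0)
qed

text \<open>Cosine is bounded and Lipschitz, so the difference is controlled by the truncated
  distance. Cosine expectations suffice to carry the distributional information, because the noise
  of a simple function has a real characteristic function.\<close>

lemma conv_in_prob_cos:
  assumes "conv_in_prob M X Y"
  shows "(\<lambda>n. LINT \<omega>|M. cos (t * X n \<omega>)) \<longlonglongrightarrow> (LINT \<omega>|M. cos (t * Y \<omega>))"
proof -
  have [measurable]: "\<And>n. X n \<in> borel_measurable M" "Y \<in> borel_measurable M"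
    and lim: "(\<lambda>n. l0 M (\<lambda>\<omega>. X n \<omega> - Y \<omega>)) \<longlonglongrightarrow> 0"
    using assms by (auto simp: conv_in_prob_iff_l0)
  have 1: "\<bar>cos (t * x) - cos (t * y)\<bar> \<le> (2 + \<bar>t\<bar>) * min 1 \<bar>x - y\<bar>" for x y
  proof -
    have "(t * y - t * x) / 2 = - ((t * x - t * y) / 2)"
      by (simp add: field_simps)
    then have "sin ((t * y - t * x) / 2) = - sin ((t * x - t * y) / 2)"
      by (simp only: sin_minus)
    then have "\<bar>cos (t * x) - cos (t * y)\<bar> \<le> 2 * \<bar>sin ((t * x - t * y) / 2)\<bar>"
      unfolding cos_diff_cos using abs_sin_le_one[of "(t * x + t * y) / 2"]
      by (simp add: abs_mult mult_left_le_one_le)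
    moreover have "\<bar>sin ((t * x - t * y) / 2)\<bar> \<le> \<bar>t\<bar> * \<bar>x - y\<bar> / 2"
      using abs_sin_x_le_abs_x[of "(t * x - t * y) / 2"] by (simp add: right_diff_distrib[symmetric] abs_mult)
    moreover have "\<bar>cos (t * x) - cos (t * y)\<bar> \<le> 2"
      using abs_cos_le_one[of "t * x"] abs_cos_le_one[of "t * y"] by linarith
    ultimately show ?thesis
    proof (cases "\<bar>x - y\<bar> < 1")
      case True
      then have "(2 + \<bar>t\<bar>) * min 1 \<bar>x - y\<bar> = 2 * \<bar>x - y\<bar> + \<bar>t\<bar> * \<bar>x - y\<bar>"
        by (simp add: algebra_simps)
      with \<open>\<bar>cos (t * x) - cos (t * y)\<bar> \<le> 2 * \<bar>sin ((t * x - t * y) / 2)\<bar>\<close>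
        \<open>\<bar>sin ((t * x - t * y) / 2)\<bar> \<le> \<bar>t\<bar> * \<bar>x - y\<bar> / 2\<close>
      show ?thesis
        using abs_ge_zero[of "x - y"] by linarith
    qed auto
  qed
  have int: "integrable M (\<lambda>\<omega>. cos (t * Z \<omega>))" if [measurable]: "Z \<in> borel_measurable M" for Z
    by (rule integrable_const_bound[where B = 1]) auto
  have "norm ((LINT \<omega>|M. cos (t * X n \<omega>)) - (LINT \<omega>|M. cos (t * Y \<omega>))) \<le> (2 + \<bar>t\<bar>) * l0 M (\<lambda>\<omega>. X n \<omega> - Y \<omega>)" for n
  proof -
    have "norm ((LINT \<omega>|M. cos (t * X n \<omega>)) - (LINT \<omega>|M. cos (t * Y \<omega>)))
       = norm (LINT \<omega>|M. cos (t * X n \<omega>) - cos (t * Y \<omega>))"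
      by (subst Bochner_Integration.integral_diff) (auto intro: int)
    also have "\<dots> \<le> (LINT \<omega>|M. norm (cos (t * X n \<omega>) - cos (t * Y \<omega>)))"
      by (rule integral_norm_bound)
    also have "\<dots> \<le> (LINT \<omega>|M. (2 + \<bar>t\<bar>) * min 1 \<bar>X n \<omega> - Y \<omega>\<bar>)"
      by (rule integral_mono) (use 1 in \<open>auto intro!: integrable_norm Bochner_Integration.integrable_diff int integrable_mult_right integrable_min1\<close>)
    finally show ?thesis
      by (simp add: l0_def)
  qed
  moreover have "(\<lambda>n. (2 + \<bar>t\<bar>) * l0 M (\<lambda>\<omega>. X n \<omega> - Y \<omega>)) \<longlonglongrightarrow> 0"
    using lim by (auto intro!: tendsto_eq_intros)
  ultimately show ?thesis
    by (rule LIM_zero_cancel[OF Lim_null_comparison[OF always_eventually[OF allI]]])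
qed

lemma l0_tendsto_AE:
  assumes [measurable]: "\<And>n. X n \<in> borel_measurable M" "Y \<in> borel_measurable M"
    and "AE \<omega> in M. (\<lambda>n. X n \<omega>) \<longlonglongrightarrow> Y \<omega>"
  shows "(\<lambda>n. l0 M (\<lambda>\<omega>. X n \<omega> - Y \<omega>)) \<longlonglongrightarrow> 0"
proof -
  have "(\<lambda>n. LINT \<omega>|M. min 1 \<bar>X n \<omega> - Y \<omega>\<bar>) \<longlonglongrightarrow> (LINT \<omega>|M. 0)"
  proof (rule integral_dominated_convergence[where w = "\<lambda>_. 1"])
    show "AE \<omega> in M. (\<lambda>n. min 1 \<bar>X n \<omega> - Y \<omega>\<bar>) \<longlonglongrightarrow> 0"
      using assms(3)
    proof eventually_elim
      case (elim \<omega>)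
      have "(\<lambda>n. min 1 \<bar>X n \<omega> - Y \<omega>\<bar>) \<longlonglongrightarrow> min 1 \<bar>Y \<omega> - Y \<omega>\<bar>"
        by (intro tendsto_intros elim)
      then show ?case
        by simp
    qed
  qed auto
  then show ?thesis
    by (simp add: l0_def)
qed

text \<open>The truncated increments have summable expectations, hence are almost surely summable;
  from some index on they are below 1 and thus equal to the untruncated ones, and the sequence
  telescopes.\<close>

lemma l0_summable_imp_AE_convergent:
  assumes [measurable]: "\<And>n. Z n \<in> borel_measurable M"
    and small: "\<And>n. l0 M (\<lambda>\<omega>. Z (Suc n) \<omega> - Z n \<omega>) \<le> (1/2) ^ n"
  shows "AE \<omega> in M. convergent (\<lambda>n. Z n \<omega>)"
proof -
  define d where "d n \<omega> = min 1 \<bar>Z (Suc n) \<omega> - Z n \<omega>\<bar>" for n \<omega>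
  have [measurable]: "d n \<in> borel_measurable M" for n
    unfolding d_def by measurable
  have d: "integrable M (d n)" "0 \<le> d n \<omega>" for n \<omega>
    unfolding d_def by (auto intro: integrable_min1)
  have "(\<integral>\<^sup>+\<omega>. (\<Sum>n. ennreal (d n \<omega>)) \<partial>M) = (\<Sum>n. \<integral>\<^sup>+\<omega>. ennreal (d n \<omega>) \<partial>M)"
    by (rule nn_integral_suminf) auto
  also have "\<dots> = (\<Sum>n. ennreal (LINT \<omega>|M. d n \<omega>))"
    using d by (simp add: nn_integral_eq_integral)
  also have "\<dots> \<le> (\<Sum>n. ennreal ((1/2) ^ n))"
    using small by (intro suminf_le ennreal_leI) (auto simp: l0_def d_def)
  also have "\<dots> < \<infinity>"
    by (subst suminf_ennreal2) (auto simp: summable_geometric)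
  finally have "AE \<omega> in M. (\<Sum>n. ennreal (d n \<omega>)) \<noteq> \<infinity>"
    by (intro nn_integral_PInf_AE) auto
  then show ?thesis
  proof eventually_elim
    case (elim \<omega>)
    then have sum: "summable (\<lambda>n. d n \<omega>)"
      using d by (intro summable_suminf_not_top) auto
    then have "\<forall>\<^sub>F n in sequentially. d n \<omega> < 1"
      using order_tendstoD(2)[OF summable_LIMSEQ_zero] by fastforce
    then have "\<forall>\<^sub>F n in sequentially. norm (Z (Suc n) \<omega> - Z n \<omega>) \<le> d n \<omega>"
      by eventually_elim (auto simp: d_def min_def split: if_splits)
    then have "summable (\<lambda>n. Z (Suc n) \<omega> - Z n \<omega>)"
      using sum by (rule summable_comparison_test_ev)
    then have "convergent (\<lambda>n. Z n \<omega> - Z 0 \<omega>)"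
      by (simp only: summable_iff_convergent sum_lessThan_telescope[of "\<lambda>i. Z i \<omega>"])
    then show ?case
      by (simp only: convergent_diff_const_right_iff)
  qed
qed

lemma l0_Cauchy_imp_conv_in_prob:
  assumes [measurable]: "\<And>n. Z n \<in> borel_measurable M"
    and Cauchy: "\<And>\<epsilon>. 0 < \<epsilon> \<Longrightarrow> \<exists>n0. \<forall>m\<ge>n0. \<forall>n\<ge>n0. l0 M (\<lambda>\<omega>. Z m \<omega> - Z n \<omega>) \<le> \<epsilon>"
  shows "\<exists>Y. conv_in_prob M Z Y"
proof -
  have "\<forall>j. \<exists>n0. \<forall>m\<ge>n0. \<forall>n\<ge>n0. l0 M (\<lambda>\<omega>. Z m \<omega> - Z n \<omega>) \<le> (1/2) ^ j"
    by (intro allI Cauchy) auto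
  then obtain r0 where r0: "\<And>j m n. m \<ge> r0 j \<Longrightarrow> n \<ge> r0 j \<Longrightarrow> l0 M (\<lambda>\<omega>. Z m \<omega> - Z n \<omega>) \<le> (1/2) ^ j"
    by metis
  \<comment> \<open>Adding up the thresholds yields an index that exceeds \<open>r0 j\<close> at
    stage \<open>j\<close> and still at stage \<open>Suc j\<close>, so consecutive terms of the
    subsequence are within \<open>(1/2)^j\<close>.\<close>
  define r where "r j = (\<Sum>i\<le>j. r0 i)" for j
  have r: "r0 j \<le> r j" "r0 j \<le> r (Suc j)" for j
    unfolding r_def by (auto intro!: member_le_sum trans_le_add1)
  define Y where "Y \<omega> = lim (\<lambda>j. Z (r j) \<omega>)" for \<omega>
  have [measurable]: "Y \<in> borel_measurable M"
    unfolding Y_def by measurable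
  have "AE \<omega> in M. convergent (\<lambda>j. Z (r j) \<omega>)"
    by (rule l0_summable_imp_AE_convergent) (use r0 r in auto)
  then have "AE \<omega> in M. (\<lambda>j. Z (r j) \<omega>) \<longlonglongrightarrow> Y \<omega>"
    by eventually_elim (simp add: Y_def convergent_LIMSEQ_iff)
  then have lim: "(\<lambda>j. l0 M (\<lambda>\<omega>. Z (r j) \<omega> - Y \<omega>)) \<longlonglongrightarrow> 0"
    by (intro l0_tendsto_AE) auto
  have "(\<lambda>n. l0 M (\<lambda>\<omega>. Z n \<omega> - Y \<omega>)) \<longlonglongrightarrow> 0"
  proof (rule LIMSEQ_I)
    fix \<epsilon> :: real assume \<epsilon>: "0 < \<epsilon>"
    obtain j1 where j1: "\<And>j. j \<ge> j1 \<Longrightarrow> l0 M (\<lambda>\<omega>. Z (r j) \<omega> - Y \<omega>) < \<epsilon> / 2"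
      using LIMSEQ_D[OF lim half_gt_zero[OF \<epsilon>]] by (auto simp: l0_nonneg)
    obtain j2 where j2: "(1/2) ^ j2 < \<epsilon> / 2"
      using real_arch_pow_inv[of "\<epsilon> / 2" "1/2"] \<epsilon> by auto
    define j where "j = max j1 j2"
    have "(1/2::real) ^ j \<le> (1/2) ^ j2"
      by (rule power_decreasing) (auto simp: j_def)
    with j2 have j: "(1/2) ^ j < \<epsilon> / 2"
      by (rule le_less_trans[rotated])
    have "j \<ge> j1"
      by (simp add: j_def)
    have "norm (l0 M (\<lambda>\<omega>. Z n \<omega> - Y \<omega>) - 0) < \<epsilon>" if "n \<ge> r0 j" for n
      using l0_lincomb[of "\<lambda>\<omega>. Z n \<omega> - Z (r j) \<omega>" "\<lambda>\<omega>. Z (r j) \<omega> - Y \<omega>" 1 1]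
        r0[of j n "r j"] that r[of j] j1[OF \<open>j \<ge> j1\<close>] j l0_nonneg[of "\<lambda>\<omega>. Z n \<omega> - Y \<omega>"] by simp
    then show "\<exists>n0. \<forall>n\<ge>n0. norm (l0 M (\<lambda>\<omega>. Z n \<omega> - Y \<omega>) - 0) < \<epsilon>"
      by blast
  qed
  then show ?thesis
    by (intro exI[of _ Y]) (simp add: conv_in_prob_iff_l0)
qed

section \<open>Gaussian randomisation and tails of sums of squares\<close>

text \<open>Averaging over an independent standard Gaussian \<open>g\<close> turns \<open>cos (g q\<^sub>m X\<^sub>m + Y)\<close> into
  \<open>cos Y exp (- q\<^sub>m\<^sup>2 X\<^sub>m\<^sup>2 / 2)\<close>, while \<open>E g\<^sup>2 = 1\<close>: the variables are replaced one at a time.\<close>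

lemma expectation_cos_gaussian_weight_ge:
  fixes X :: "nat \<Rightarrow> 'a \<Rightarrow> real"
  assumes [measurable]: "\<And>k. X k \<in> borel_measurable M"
    and cos_ge: "\<And>c. (LINT \<omega>|M. cos (\<Sum>k<n. c k * X k \<omega>)) \<ge> 1 - (a + b * (\<Sum>k<n. w k * (c k)\<^sup>2))"
    and "m \<le> n"
  shows "(LINT \<omega>|M. cos (\<Sum>k=m..<n. c k * X k \<omega>) * exp (- (\<Sum>k<m. (q k * X k \<omega>)\<^sup>2) / 2))
    \<ge> 1 - (a + b * ((\<Sum>k=m..<n. w k * (c k)\<^sup>2) + (\<Sum>k<m. w k * (q k)\<^sup>2)))"
  using \<open>m \<le> n\<close>
proof (induction m arbitrary: c)
  case 0
  then show ?case
    using cos_ge[of c] by (simp add: atLeast0LessThan)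
next
  case (Suc m)
  let ?N = std_normal_distribution
  interpret N: real_distribution ?N
    by (rule real_dist_normal_dist)
  interpret P: pair_sigma_finite ?N M ..
  define Y where "Y \<omega> = (\<Sum>k=Suc m..<n. c k * X k \<omega>)" for \<omega>
  define W where "W \<omega> = exp (- (\<Sum>k<m. (q k * X k \<omega>)\<^sup>2) / 2)" for \<omega>
  define A where "A = (\<Sum>k=Suc m..<n. w k * (c k)\<^sup>2) + (\<Sum>k<m. w k * (q k)\<^sup>2)"
  have [measurable]: "Y \<in> borel_measurable M" "W \<in> borel_measurable M"
    unfolding Y_def W_def by measurable
  have W1: "0 \<le> W \<omega>" "W \<omega> \<le> 1" for \<omega>
    by (auto simp: W_def intro: sum_nonneg)
  have split: "(\<Sum>k=m..<n. f k) = f m + (\<Sum>k=Suc m..<n. f k)" for f :: "nat \<Rightarrow> real"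
    using Suc.prems by (simp add: sum.atLeast_Suc_lessThan)
  define G where "G g \<omega> = cos (g * (q m * X m \<omega>) + Y \<omega>) * W \<omega>" for g \<omega>
  have [measurable]: "(\<lambda>(g, \<omega>). G g \<omega>) \<in> borel_measurable (?N \<Otimes>\<^sub>M M)"
    unfolding G_def by measurable
  have G1: "\<bar>G g \<omega>\<bar> \<le> 1" for g \<omega>
    unfolding G_def abs_mult using W1[of \<omega>] by (intro mult_le_one) auto
  have g: "(LINT \<omega>|M. G g \<omega>) \<ge> 1 - (a + b * (w m * (g * q m)\<^sup>2 + A))" for g
  proof -
    \<comment> \<open>For fixed \<open>g\<close> the induction hypothesis is used with
      \<open>g * q m\<close> as coefficient of \<open>X m\<close>; this is why the induction runs
      over arbitrary \<open>c\<close>.\<close>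
    let ?c = "c(m := g * q m)"
    have 1: "(\<Sum>k=m..<n. ?c k * X k \<omega>) = g * (q m * X m \<omega>) + Y \<omega>" for \<omega>
      unfolding split Y_def by simp
    have 2: "(\<Sum>k=m..<n. w k * (?c k)\<^sup>2) + (\<Sum>k<m. w k * (q k)\<^sup>2) = w m * (g * q m)\<^sup>2 + A"
      unfolding split A_def by simp
    show ?thesis
      using Suc.IH[of ?c] Suc.prems unfolding 1 2 by (simp add: G_def W_def)
  qed
  have moments: "(LINT g|?N. g\<^sup>2) = 1" "integrable ?N (\<lambda>g. g\<^sup>2)"
    using std_normal_distribution_even_moments[of 1] by auto
  have intG: "integrable (?N \<Otimes>\<^sub>M M) (\<lambda>(g, \<omega>). G g \<omega>)"
  proof -
    interpret PP: pair_prob_space ?N M ..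
    show ?thesis
      by (rule PP.integrable_const_bound[where B = 1]) (use G1 in auto)
  qed
  have "1 - (a + b * (w m * (q m)\<^sup>2 + A)) = (LINT g|?N. 1 - (a + b * (w m * (g * q m)\<^sup>2 + A)))"
    using moments N.prob_space by (simp add: power_mult_distrib)
  also have "\<dots> \<le> (LINT g|?N. (LINT \<omega>|M. G g \<omega>))"
  proof (rule integral_mono)
    show "integrable ?N (\<lambda>g. 1 - (a + b * (w m * (g * q m)\<^sup>2 + A)))"
      using moments by (simp add: power_mult_distrib)
    show "integrable ?N (\<lambda>g. LINT \<omega>|M. G g \<omega>)"
      using P.integrable_fst'[OF intG] by simp
  qed (rule g)
  also have "\<dots> = (LINT \<omega>|M. (LINT g|?N. G g \<omega>))"
    by (rule P.Fubini_integral[symmetric]) (rule intG)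
  also have "\<dots> = (LINT \<omega>|M. cos (Y \<omega>) * exp (- (\<Sum>k<Suc m. (q k * X k \<omega>)\<^sup>2) / 2))"
  proof (rule Bochner_Integration.integral_cong[OF refl])
    fix \<omega>
    have iexp: "(LINT g|?N. iexp (g * s)) = complex_of_real (exp (- (s\<^sup>2) / 2))" for s
      using fun_cong[OF char_std_normal_distribution, of s] by (simp add: char_def mult.commute)
    have int_iexp: "integrable ?N (\<lambda>g. iexp (g * s))" for s
      by (rule N.integrable_const_bound[where B = 1]) auto
    have "(LINT g|?N. cos (g * s + y)) = cos y * exp (- (s\<^sup>2) / 2)" for s y
    proof -
      have "(LINT g|?N. cos (g * s + y)) = (LINT g|?N. Re (iexp y * iexp (g * s)))"
        by (simp add: cos_add mult.commute add.commute Re_exp Im_exp)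
      also have "\<dots> = Re (LINT g|?N. iexp y * iexp (g * s))"
        by (rule integral_Re) (intro integrable_mult_right int_iexp)
      also have "\<dots> = Re (iexp y * complex_of_real (exp (- (s\<^sup>2) / 2)))"
        by (simp only: integral_mult_right_zero iexp)
      also have "\<dots> = cos y * exp (- (s\<^sup>2) / 2)"
        by (simp add: Re_exp)
      finally show ?thesis .
    qed
    then have "(LINT g|?N. G g \<omega>) = cos (Y \<omega>) * exp (- ((q m * X m \<omega>)\<^sup>2) / 2) * W \<omega>"
      unfolding G_def by simp
    moreover have "exp (- ((q m * X m \<omega>)\<^sup>2) / 2) * W \<omega> = exp (- (\<Sum>k<Suc m. (q k * X k \<omega>)\<^sup>2) / 2)"
      unfolding W_def exp_add[symmetric] by (simp add: field_simps)
    ultimately show "(LINT g|?N. G g \<omega>) = cos (Y \<omega>) * exp (- (\<Sum>k<Suc m. (q k * X k \<omega>)\<^sup>2) / 2)"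
      by (simp only: mult.assoc)
  qed
  finally show ?case
    by (simp add: A_def Y_def algebra_simps)
qed

text \<open>A Markov inequality for the bounded quantity \<open>1 - exp (- S / B)\<close> in place
  of \<open>S\<close>, whose expectation may be infinite. Scaling by \<open>sqrt (2 / B)\<close>
  makes the Gaussian weight \<open>exp (- S / B)\<close>, and on \<open>B < S\<close> this is at
  most \<open>exp (-1) <= 1/2\<close>, which accounts for the leading 2.\<close>

lemma prob_sum_squares_le:
  fixes X :: "nat \<Rightarrow> 'a \<Rightarrow> real"
  assumes [measurable]: "\<And>k. X k \<in> borel_measurable M"
    and cos_ge: "\<And>c. (LINT \<omega>|M. cos (\<Sum>k<n. c k * X k \<omega>)) \<ge> 1 - (a + b * (\<Sum>k<n. w k * (c k)\<^sup>2))"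
    and B: "0 < B"
  shows "prob {\<omega> \<in> space M. B < (\<Sum>k<n. (q k * X k \<omega>)\<^sup>2)} \<le> 2 * (a + 2 * b * (\<Sum>k<n. w k * (q k)\<^sup>2) / B)"
proof -
  define r where "r k = sqrt (2 / B) * q k" for k
  define S where "S \<omega> = (\<Sum>k<n. (q k * X k \<omega>)\<^sup>2)" for \<omega>
  have [measurable]: "S \<in> borel_measurable M"
    unfolding S_def by measurable
  have S: "(\<Sum>k<n. (r k * X k \<omega>)\<^sup>2) = 2 / B * S \<omega>" for \<omega>
    using B by (simp add: r_def S_def power_mult_distrib sum_distrib_left mult.assoc)
  have "1 - (a + b * (\<Sum>k<n. w k * (r k)\<^sup>2)) \<le> (LINT \<omega>|M. exp (- S \<omega> / B))"
    using expectation_cos_gaussian_weight_ge[OF assms(1) cos_ge, of n "\<lambda>_. 0" r] by (simp add: S)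
  also have "\<dots> \<le> (LINT \<omega>|M. 1 - indicator {\<omega> \<in> space M. B < S \<omega>} \<omega> / 2)"
  proof (rule integral_mono)
    have S0: "0 \<le> S \<omega>" for \<omega>
      by (auto simp: S_def intro: sum_nonneg)
    show "integrable M (\<lambda>\<omega>. exp (- S \<omega> / B))"
      by (rule integrable_const_bound[where B = 1]) (use S0 B in auto)
    have e: "exp (-1) \<le> (1/2 :: real)"
      using exp_ge_add_one_self[of 1] by (simp add: exp_minus field_simps)
    show "exp (- S \<omega> / B) \<le> 1 - indicator {\<omega> \<in> space M. B < S \<omega>} \<omega> / 2" for \<omega>
    proof (cases "B < S \<omega>")
      case True
      then have "exp (- S \<omega> / B) \<le> exp (-1)"
        using B by (simp add: field_simps)
      also note e
      finally show ?thesis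
        using divide_nonneg_pos[OF S0[of \<omega>] B] by (auto split: split_indicator)
    qed (use divide_nonneg_pos[OF S0[of \<omega>] B] in \<open>auto split: split_indicator\<close>)
  qed (auto simp: less_top[symmetric])
  also have "\<dots> = 1 - prob {\<omega> \<in> space M. B < S \<omega>} / 2"
    by (subst Bochner_Integration.integral_diff) (auto simp: less_top[symmetric] prob_space)
  finally have "prob {\<omega> \<in> space M. B < S \<omega>} \<le> 2 * (a + b * (\<Sum>k<n. w k * (r k)\<^sup>2))"
    by (simp add: field_simps)
  also have "(\<Sum>k<n. w k * (r k)\<^sup>2) = 2 * (\<Sum>k<n. w k * (q k)\<^sup>2) / B"
    using B by (simp add: r_def power_mult_distrib sum_distrib_left sum_divide_distrib mult_ac)
  finally show ?thesis
    by (simp add: S_def mult_ac)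
qed

end

section \<open>Setwise convergence and vanishing of integrals\<close>

text \<open>Gliding hump: where \<open>\<psi>\<^sub>n > 1\<close> is eventually of small measure, so along a subsequence the
  non-vanishing mass sits on disjoint sets; the union of every other one has no limiting mass.\<close>

lemma (in finite_measure) setwise_convergent_imp_integral_tendsto_0:
  fixes \<psi> :: "nat \<Rightarrow> 'a \<Rightarrow> real"
  assumes [measurable]: "\<And>n. \<psi> n \<in> borel_measurable M"
    and bounds: "\<And>n x. 0 \<le> \<psi> n x" "\<And>n x. x \<in> space M \<Longrightarrow> \<psi> n x \<le> c n"
    and lim0: "AE x in M. (\<lambda>n. \<psi> n x) \<longlonglongrightarrow> 0"
    and conv: "\<And>A. A \<in> sets M \<Longrightarrow> convergent (\<lambda>n. LINT x|M. indicator A x * \<psi> n x)"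
  shows "(\<lambda>n. LINT x|M. \<psi> n x) \<longlonglongrightarrow> 0"
proof -
  have int: "integrable M (\<lambda>x. indicator A x * \<psi> n x)" if [measurable]: "A \<in> sets M" for A n
  proof (rule integrable_const_bound[where B = "\<bar>c n\<bar>"])
    have "norm (indicator A x * \<psi> n x) \<le> \<bar>c n\<bar>" if "x \<in> space M" for x
      using bounds(1)[of n x] bounds(2)[OF that, of n] by (auto split: split_indicator)
    then show "AE x in M. norm (indicator A x * \<psi> n x) \<le> \<bar>c n\<bar>"
      by simp
  qed measurable
  define I where "I n A = (LINT x|M. indicator A x * \<psi> n x)" for n A
  have I_space: "I n (space M) = (LINT x|M. \<psi> n x)" for n
    unfolding I_def by (rule Bochner_Integration.integral_cong) auto
  obtain L where L: "(\<lambda>n. I n (space M)) \<longlonglongrightarrow> L"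
    using conv[OF sets.top] by (auto simp: I_def convergent_def)
  have I_nonneg: "0 \<le> I n A" for n A
    unfolding I_def using bounds by (intro Bochner_Integration.integral_nonneg) auto
  have "0 \<le> L"
    by (rule LIMSEQ_le_const[OF L]) (auto simp: I_nonneg)
  have "L = 0"
  proof (rule ccontr)
    assume "L \<noteq> 0"
    with \<open>0 \<le> L\<close> have "0 < L"
      by simp
    \<comment> \<open>The reason for 8: at even stages \<open>A\<close> keeps mass at least
      \<open>L - 3 * \<epsilon> = 5 * \<epsilon>\<close>, at odd stages it gets at most
      \<open>2 * \<epsilon>\<close>, so the mass of \<open>A\<close> cannot converge.\<close>
    define \<epsilon> where "\<epsilon> = L / 8"
    have \<epsilon>: "0 < \<epsilon>"
      using \<open>0 < L\<close> by (simp add: \<epsilon>_def)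
    define C where "C n = {x \<in> space M. 1 < \<psi> n x}" for n
    have [measurable]: "C n \<in> sets M" for n
      unfolding C_def by measurable
    define \<mu> where "\<mu> n = (LINT x|M. min 1 (\<psi> n x))" for n
    have int_min: "integrable M (\<lambda>x. min 1 (\<psi> n x))" for n
      by (rule integrable_const_bound[where B = 1]) (use bounds in auto)
    have \<mu>: "\<mu> \<longlonglongrightarrow> 0"
    proof -
      have "(\<lambda>n. LINT x|M. min 1 (\<psi> n x)) \<longlonglongrightarrow> (LINT x|M. 0)"
      proof (rule integral_dominated_convergence[where w = "\<lambda>_. 1"])
        show "AE x in M. (\<lambda>n. min 1 (\<psi> n x)) \<longlonglongrightarrow> 0"
          using lim0
        proof eventually_elim
          case (elim x)
          have "(\<lambda>n. min 1 (\<psi> n x)) \<longlonglongrightarrow> min 1 0"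
            by (intro tendsto_intros elim)
          then show ?case
            by simp
        qed
      qed (use bounds in auto)
      then show ?thesis
        by (simp add: \<mu>_def[abs_def])
    qed
    have measC: "measure M (C n) \<le> \<mu> n" for n
    proof -
      have "measure M (C n) = (LINT x|M. indicator (C n) x)"
        by simp
      also have "\<dots> \<le> \<mu> n"
        unfolding \<mu>_def by (rule integral_mono)
          (use int_min bounds in \<open>auto simp: C_def less_top[symmetric] split: split_indicator\<close>)
      finally show ?thesis .
    qed
    have off: "I n (space M - C n) \<le> \<mu> n" for n
      unfolding I_def \<mu>_def
      by (rule integral_mono) (use int int_min bounds in \<open>auto simp: C_def split: split_indicator\<close>)
    \<comment> \<open>A common upper bound of the functions up to index \<open>m\<close>; it
      converts small measure of a later set \<open>C\<close> into small mass of all earlier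
      functions on it.\<close>
    define K where "K m = (\<Sum>i\<le>m. \<bar>c i\<bar>)" for m
    have K: "c i \<le> K m" "0 \<le> K m" if "i \<le> m" for i m
    proof -
      have "\<bar>c i\<bar> \<le> K m"
        unfolding K_def by (rule member_le_sum) (use that in auto)
      then show "c i \<le> K m" "0 \<le> K m"
        by auto
    qed
    obtain n0 where n0: "\<And>n. n \<ge> n0 \<Longrightarrow> \<mu> n \<le> \<epsilon>" "\<And>n. n \<ge> n0 \<Longrightarrow> L - \<epsilon> \<le> I n (space M)"
    proof -
      have "\<forall>\<^sub>F n in sequentially. \<mu> n < \<epsilon>" "\<forall>\<^sub>F n in sequentially. L - \<epsilon> < I n (space M)"
        using order_tendstoD(2)[OF \<mu> \<epsilon>] order_tendstoD(1)[OF L, of "L - \<epsilon>"] \<epsilon> by auto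
      then have "\<forall>\<^sub>F n in sequentially. \<mu> n \<le> \<epsilon> \<and> L - \<epsilon> \<le> I n (space M)"
        by eventually_elim auto
      then show ?thesis
        using that by (auto simp: eventually_sequentially)
    qed
    \<comment> \<open>Each hump is chosen so thin, relative to the size of the functions up to the
      previous stage, that all later humps together carry at most \<epsilon> of the mass of an
      earlier function.\<close>
    have "\<exists>s. \<forall>n. (s n \<ge> n0) \<and> (s n < s (Suc n) \<and> measure M (C (s (Suc n))) * K (s n) \<le> \<epsilon> * (1/2) ^ Suc n)"
    proof (rule dependent_nat_choice)
      show "\<exists>x. n0 \<le> x"
        by blast
      fix m n assume "n0 \<le> m"
      have "(\<lambda>i. \<mu> i * K m) \<longlonglongrightarrow> 0"
        using tendsto_mult[OF \<mu> tendsto_const[of "K m"]] by simp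
      then have "\<forall>\<^sub>F i in sequentially. \<mu> i * K m < \<epsilon> * (1/2) ^ Suc n"
        using \<epsilon> by (intro order_tendstoD(2)) auto
      then have "\<forall>\<^sub>F i in sequentially. \<mu> i * K m < \<epsilon> * (1/2) ^ Suc n \<and> i > max m n0"
        using eventually_gt_at_top[of "max m n0"] by eventually_elim auto
      then obtain i where i: "\<mu> i * K m < \<epsilon> * (1/2) ^ Suc n" "i > max m n0"
        by (auto simp: eventually_sequentially)
      have "measure M (C i) * K m \<le> \<mu> i * K m"
        using measC K(2)[of m m] by (intro mult_right_mono) auto
      then show "\<exists>i. n0 \<le> i \<and> m < i \<and> measure M (C i) * K m \<le> \<epsilon> * (1/2) ^ Suc n"
        using i by (intro exI[of _ i]) auto
    qed
    then obtain s where s: "\<And>n. n0 \<le> s n" "\<And>n. s n < s (Suc n)"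
      "\<And>n. measure M (C (s (Suc n))) * K (s n) \<le> \<epsilon> * (1/2) ^ Suc n"
      by blast
    have "strict_mono s"
      using s(2) by (simp add: strict_mono_Suc_iff)
    define Tl where "Tl j = (\<Union>l. C (s (Suc (j + l))))" for j
    have [measurable]: "Tl j \<in> sets M" for j
      unfolding Tl_def by measurable
    have tail: "I (s j) (Tl j) \<le> \<epsilon>" for j
    proof -
      have hump: "measure M (C (s (Suc (j + l)))) * K (s j) \<le> \<epsilon> * (1/2) ^ Suc l" for l
      proof -
        have "K (s j) \<le> K (s (j + l))"
          unfolding K_def using \<open>strict_mono s\<close> by (intro sum_mono2) (auto simp: strict_mono_less_eq)
        then have "measure M (C (s (Suc (j + l)))) * K (s j) \<le> measure M (C (s (Suc (j + l)))) * K (s (j + l))"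
          by (intro mult_left_mono) auto
        also have "\<dots> \<le> \<epsilon> * (1/2) ^ Suc (j + l)"
          by (rule s(3))
        also have "\<dots> \<le> \<epsilon> * (1/2) ^ Suc l"
          using \<epsilon> by (intro mult_left_mono power_decreasing) auto
        finally show ?thesis .
      qed
      have geo: "summable (\<lambda>l. \<epsilon> * (1/2::real) ^ Suc l)" "(\<Sum>l. \<epsilon> * (1/2::real) ^ Suc l) = \<epsilon>"
        using sums_mult[OF power_half_series, of \<epsilon>] by (auto simp: sums_iff)
      show ?thesis
      proof (cases "K (s j) = 0")
        case True
        then have "\<psi> (s j) x = 0" if "x \<in> space M" for x
          using bounds(1)[of "s j" x] bounds(2)[OF that, of "s j"] K(1)[of "s j" "s j"] by simp
        then have "I (s j) (Tl j) = (LINT x|M. 0)"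
          unfolding I_def by (intro Bochner_Integration.integral_cong) auto
        then show ?thesis
          using \<epsilon> by simp
      next
        case False
        then have Kpos: "0 < K (s j)"
          using K(2)[of "s j" "s j"] by simp
        have sumC: "summable (\<lambda>l. measure M (C (s (Suc (j + l)))) * K (s j))"
          by (rule summable_comparison_test'[OF geo(1)]) (use hump K(2)[of "s j" "s j"] in auto)
        then have sumC': "summable (\<lambda>l. measure M (C (s (Suc (j + l)))))"
          using Kpos summable_mult_D[of "K (s j)" "\<lambda>l. measure M (C (s (Suc (j + l))))"] by (simp add: mult.commute)
        have "I (s j) (Tl j) \<le> (LINT x|M. K (s j) * indicator (Tl j) x)"
          unfolding I_def
          by (rule integral_mono)
            (use int K(1)[of "s j" "s j"] bounds(2)[of _ "s j"] in \<open>auto simp: less_top[symmetric] split: split_indicator intro: order_trans\<close>)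
        also have "\<dots> = K (s j) * measure M (Tl j)"
          by simp
        also have "\<dots> \<le> K (s j) * (\<Sum>l. measure M (C (s (Suc (j + l)))))"
          unfolding Tl_def using K(2)[of "s j" "s j"] sumC'
          by (intro mult_left_mono finite_measure_subadditive_countably) auto
        also have "\<dots> = (\<Sum>l. measure M (C (s (Suc (j + l)))) * K (s j))"
          using suminf_mult[OF sumC', of "K (s j)"] by (simp add: mult.commute)
        also have "\<dots> \<le> (\<Sum>l. \<epsilon> * (1/2) ^ Suc l)"
          by (rule suminf_le[OF hump sumC geo(1)])
        finally show ?thesis
          using geo(2) by simp
      qed
    qed
    define A where "A = (\<Union>i\<in>{i. even i}. C (s i) - Tl i)"
    have [measurable]: "A \<in> sets M"
      unfolding A_def by measurable
    have I_mono: "I n X \<le> I n Y + I n Z" if "X \<subseteq> Y \<union> Z" "X \<in> sets M" "Y \<in> sets M" "Z \<in> sets M" for n X Y Z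
    proof -
      have "I n X \<le> (LINT x|M. indicator Y x * \<psi> n x + indicator Z x * \<psi> n x)"
        unfolding I_def
        by (rule integral_mono)
          (use that int bounds(1)[of n] in \<open>auto split: split_indicator intro!: Bochner_Integration.integrable_add\<close>)
      then show ?thesis
        using int that by (simp add: I_def)
    qed
    have even: "5 * \<epsilon> \<le> I (s j) A" if "even j" for j
    proof -
      have "I (s j) (space M) \<le> I (s j) (space M - C (s j)) + I (s j) (C (s j))"
        by (rule I_mono) auto
      moreover have "I (s j) (C (s j)) \<le> I (s j) (Tl j) + I (s j) A"
        by (rule I_mono) (use that in \<open>auto simp: A_def\<close>)
      ultimately show ?thesis
        using off[of "s j"] tail[of j] n0[OF s(1)[of j]] by (simp add: \<epsilon>_def)
    qed
    have odd: "I (s j) A \<le> 2 * \<epsilon>" if "odd j" for j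
    proof -
      have "A \<subseteq> (space M - C (s j)) \<union> Tl j"
      proof
        fix x assume "x \<in> A"
        then obtain i where i: "even i" "x \<in> C (s i)" "x \<notin> Tl i"
          by (auto simp: A_def)
        \<comment> \<open>The even \<open>i\<close> and the odd \<open>j\<close> differ. For
          \<open>i < j\<close> the \<open>j\<close>-th hump belongs to the tail removed from the
          \<open>i\<close>-th, a contradiction; for \<open>j < i\<close> the \<open>i\<close>-th
          hump is part of \<open>Tl j\<close>.\<close>
        have "x \<in> Tl j" if "x \<in> C (s j)"
        proof (cases "i < j")
          case True
          then have "x \<in> Tl i"
            using that unfolding Tl_def by (intro UN_I[of "j - Suc i"]) auto
          then show ?thesis
            using i by simp
        next
          case False
          then have "j < i"
            using i(1) \<open>odd j\<close> by (metis linorder_neqE_nat)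
          then show ?thesis
            using i(2) unfolding Tl_def by (intro UN_I[of "i - Suc j"]) auto
        qed
        moreover have "x \<in> space M"
          using i(2) by (simp add: C_def)
        ultimately show "x \<in> (space M - C (s j)) \<union> Tl j"
          by auto
      qed
      then have "I (s j) A \<le> I (s j) (space M - C (s j)) + I (s j) (Tl j)"
        by (rule I_mono) auto
      then show ?thesis
        using off[of "s j"] tail[of j] n0(1)[OF s(1)[of j]] by simp
    qed
    obtain l where l: "(\<lambda>n. I n A) \<longlonglongrightarrow> l"
      using conv[of A] by (auto simp: I_def convergent_def)
    have sub: "(\<lambda>j. I (s (2 * j)) A) \<longlonglongrightarrow> l" "(\<lambda>j. I (s (2 * j + 1)) A) \<longlonglongrightarrow> l"
      using LIMSEQ_subseq_LIMSEQ[OF l strict_mono_compose[OF \<open>strict_mono s\<close>], of "\<lambda>j. 2 * j"]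
        LIMSEQ_subseq_LIMSEQ[OF l strict_mono_compose[OF \<open>strict_mono s\<close>], of "\<lambda>j. 2 * j + 1"]
      by (auto simp: strict_mono_def comp_def)
    have "5 * \<epsilon> \<le> l"
      by (rule LIMSEQ_le_const[OF sub(1)]) (use even in auto)
    moreover have "l \<le> 2 * \<epsilon>"
      by (rule LIMSEQ_le_const2[OF sub(2)]) (use odd in auto)
    ultimately show False
      using \<epsilon> by simp
  qed
  then show ?thesis
    using L by (simp add: I_space)
qed

section \<open>Integrals with respect to the noise\<close>

text \<open>Turns the almost sure identities \<open>cos (V / (m + 1)) = 1\<close> into
  \<open>V = 0\<close>: for large \<open>m\<close> the argument lies between -1 and 1, where the
  only multiple of \<open>2 pi\<close> is 0.\<close>

lemma cos_eq_1_for_all_small_multiples: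
  fixes v :: real
  assumes "\<And>m::nat. m \<ge> m0 \<Longrightarrow> cos (v / (real m + 1)) = 1"
  shows "v = 0"
proof -
  obtain m where "max \<bar>v\<bar> (real m0) < real m"
    using reals_Archimedean2 by blast
  then have m: "m \<ge> m0" "\<bar>v\<bar> < real m"
    by auto
  then obtain k :: int where k: "v / (real m + 1) = k * 2 * pi"
    using assms[OF m(1)] by (auto simp: cos_one_2pi_int)
  have "\<bar>v / (real m + 1)\<bar> < 1"
    using m by (simp add: field_simps)
  then have "\<bar>real_of_int k\<bar> * (2 * pi) < 1"
    unfolding k by (simp add: abs_mult)
  then have "\<bar>real_of_int k\<bar> < 1"
    using pi_gt3 mult_left_mono[of 1 "2 * pi" "\<bar>real_of_int k\<bar>"] by linarith
  then have "k = 0"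
    by linarith
  with k m show ?thesis
    by (simp add: field_simps add_nonneg_eq_0_iff)
qed

text \<open>Scattering gives independence along sequences of sets; transport along an injection
  makes it available for families indexed by the values of a simple function.\<close>

lemma (in prob_space) indep_vars_reindex:
  assumes inj: "inj_on g T" and ind: "indep_vars N X (g ` T)"
  shows "indep_vars (\<lambda>\<tau>. N (g \<tau>)) (\<lambda>\<tau>. X (g \<tau>)) T"
proof -
  let ?F = "\<lambda>i. {X i -` A \<inter> space M | A. A \<in> sets (N i)}"
  have sets: "indep_sets ?F (g ` T)" and rv: "\<forall>i\<in>g ` T. random_variable (N i) (X i)"
    using ind by (auto simp: indep_vars_def2)
  have "indep_sets (\<lambda>\<tau>. ?F (g \<tau>)) T"
    unfolding indep_sets_def
  proof (intro conjI ballI allI impI)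
    fix \<tau> assume "\<tau> \<in> T"
    then show "?F (g \<tau>) \<subseteq> events"
      using sets by (simp add: indep_sets_def)
  next
    fix J A assume J: "J \<subseteq> T" "J \<noteq> {}" "finite J" and A: "A \<in> Pi J (\<lambda>\<tau>. ?F (g \<tau>))"
    define B where "B i = A (the_inv_into T g i)" for i
    have B: "B (g j) = A j" if "j \<in> J" for j
      using the_inv_into_f_f[OF inj, of j] J that by (auto simp: B_def)
    have "inj_on g J"
      using inj J(1) by (rule inj_on_subset)
    have "prob (\<Inter>i\<in>g ` J. B i) = (\<Prod>i\<in>g ` J. prob (B i))"
    proof (rule sets[unfolded indep_sets_def, THEN conjunct2, rule_format])
      show "B \<in> Pi (g ` J) ?F"
      proof (rule Pi_I)
        fix i assume "i \<in> g ` J"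
        then obtain j where j: "j \<in> J" "i = g j"
          by blast
        then show "B i \<in> ?F i"
          using A B[OF j(1)] by (auto simp: Pi_iff)
      qed
    qed (use J in auto)
    then show "prob (\<Inter>j\<in>J. A j) = (\<Prod>j\<in>J. prob (A j))"
      using B by (simp add: prod.reindex[OF \<open>inj_on g J\<close>] image_image)
  qed
  then show ?thesis
    using rv by (simp add: indep_vars_def2)
qed

text \<open>All that is kept of the Levy structure is a real exponent \<psi> with a quadratic bound.
  The additive \<open>a\<close> has to be allowed: for jumps of infinite variance \<psi> is not
  \<open>O(t^2)\<close> near 0, and \<open>a\<close>, however small, accounts for the large
  jumps.\<close>

locale noise_space = prob_space M for M :: "'w measure" +
  fixes D :: "'a::euclidean_space set" and \<xi> :: "'a set \<Rightarrow> 'w \<Rightarrow> real" and \<psi> :: "real \<Rightarrow> real"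
  assumes D_borel: "D \<in> sets borel" and D_finite: "emeasure lborel D < \<infinity>"
    and scattered: "independently_scattered M D \<xi>"
    and char_xi: "\<And>A t. A \<in> sets (leb D) \<Longrightarrow>
      (LINT \<omega>|M. iexp (t * \<xi> A \<omega>)) = exp (- complex_of_real (measure lborel A * \<psi> t))"
    and psi_nonneg: "\<And>t. 0 \<le> \<psi> t"
    and psi_le: "\<And>a. 0 < a \<Longrightarrow> \<exists>b\<ge>0. \<forall>t. \<psi> t \<le> a + b * t\<^sup>2"
begin

sublocale leb: finite_measure "leb D"
  using D_finite D_borel
  by (intro finite_measureI) (simp add: emeasure_restrict_space space_restrict_space)

lemma space_leb: "space (leb D) = D"
  by (simp add: space_restrict_space)

lemma D_sets: "D \<in> sets (leb D)"
  using sets.top[of "leb D"] by (simp only: space_leb)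

lemma xi_measurable: "A \<in> sets (leb D) \<Longrightarrow> \<xi> A \<in> borel_measurable M"
  using scattered by (simp add: independently_scattered_def)

lemma psi_tendsto_0:
  assumes "X \<longlonglongrightarrow> 0"
  shows "(\<lambda>n. \<psi> (X n)) \<longlonglongrightarrow> 0"
proof (rule LIMSEQ_I)
  fix r :: real assume r: "0 < r"
  then obtain b where b: "0 \<le> b" "\<And>t. \<psi> t \<le> r / 2 + b * t\<^sup>2"
    using psi_le[of "r / 2"] by auto
  have "(\<lambda>n. b * (X n)\<^sup>2) \<longlonglongrightarrow> 0"
    using assms by (auto intro!: tendsto_eq_intros)
  from LIMSEQ_D[OF this half_gt_zero[OF r]] obtain n0 where n0: "\<And>n. n \<ge> n0 \<Longrightarrow> b * (X n)\<^sup>2 < r / 2"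
    using b(1) by auto
  have "norm (\<psi> (X n) - 0) < r" if "n \<ge> n0" for n
    using b(2)[of "X n"] n0[OF that] psi_nonneg[of "X n"] by simp
  then show "\<exists>n0. \<forall>n\<ge>n0. norm (\<psi> (X n) - 0) < r"
    by blast
qed

text \<open>The constant sequence of empty sets is disjoint, so countable additivity makes a
  constant series converge.\<close>

lemma xi_empty: "AE \<omega> in M. \<xi> {} \<omega> = 0"
proof -
  have "AE \<omega> in M. (\<lambda>n::nat. \<xi> {} \<omega>) sums \<xi> (\<Union>n::nat. {}) \<omega>"
    using scattered[unfolded independently_scattered_def, THEN conjunct2, THEN spec, of "\<lambda>_. {}"]
    by (auto simp: disjoint_family_on_def)
  then show ?thesis
    by eventually_elim (auto dest!: sums_summable simp: summable_const_iff)
qed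

text \<open>The finite family is enumerated and padded with empty sets to a sequence, to which the
  definition of scattering applies; the padding contributes 0 almost surely.\<close>

lemma xi_finite_disjoint:
  assumes T: "finite T" and disj: "disjoint_family_on A T" and A: "\<And>\<tau>. \<tau> \<in> T \<Longrightarrow> A \<tau> \<in> sets (leb D)"
  shows "indep_vars (\<lambda>_. borel) (\<lambda>\<tau>. \<xi> (A \<tau>)) T"
    and "AE \<omega> in M. \<xi> (\<Union>\<tau>\<in>T. A \<tau>) \<omega> = (\<Sum>\<tau>\<in>T. \<xi> (A \<tau>) \<omega>)"
proof -
  define N where "N = card T"
  obtain h where h: "bij_betw h {..<N} T"
    using ex_bij_betw_nat_finite[OF T] by (auto simp: N_def atLeast0LessThan)
  define B where "B n = (if n < N then A (h n) else {})" for n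
  have hT: "h n \<in> T" if "n < N" for n
    using h that by (auto simp: bij_betw_def)
  have h_inj: "h m = h n \<longleftrightarrow> m = n" if "m < N" "n < N" for m n
    using h that by (auto simp: bij_betw_def inj_on_def)
  have B: "range B \<subseteq> sets (leb D)"
    using A hT by (auto simp: B_def)
  have "disjoint_family B"
    using disj hT h_inj by (fastforce simp: disjoint_family_on_def B_def)
  with B have ind: "indep_vars (\<lambda>_. borel) (\<lambda>n. \<xi> (B n)) UNIV"
    and sums: "AE \<omega> in M. (\<lambda>n. \<xi> (B n) \<omega>) sums \<xi> (\<Union>n. B n) \<omega>"
    using scattered by (auto simp: independently_scattered_def)
  define g where "g = the_inv_into {..<N} h"
  have g: "bij_betw g T {..<N}" and gh: "h (g \<tau>) = \<tau>" "g \<tau> < N" if "\<tau> \<in> T" for \<tau>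
    using bij_betw_the_inv_into[OF h] h that f_the_inv_into_f_bij_betw[OF h, of \<tau>]
    by (auto simp: g_def bij_betw_def)
  have "inj_on g T"
    by (rule inj_on_inverseI[where g = h]) (rule gh(1))
  have "indep_vars (\<lambda>_. borel) (\<lambda>n. \<xi> (B n)) (g ` T)"
    by (rule indep_vars_subset[OF ind]) auto
  from indep_vars_reindex[OF \<open>inj_on g T\<close> this]
  have "indep_vars (\<lambda>_. borel) (\<lambda>\<tau>. \<xi> (B (g \<tau>))) T"
    by (simp add: comp_def)
  then show "indep_vars (\<lambda>_. borel) (\<lambda>\<tau>. \<xi> (A \<tau>)) T"
    by (rule indep_vars_cong[THEN iffD1, rotated 3]) (use gh in \<open>auto simp: B_def\<close>)
  have un: "(\<Union>n. B n) = (\<Union>\<tau>\<in>T. A \<tau>)"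
    using hT gh by (force simp: B_def split: if_splits)
  show "AE \<omega> in M. \<xi> (\<Union>\<tau>\<in>T. A \<tau>) \<omega> = (\<Sum>\<tau>\<in>T. \<xi> (A \<tau>) \<omega>)"
    using sums xi_empty
  proof eventually_elim
    case (elim \<omega>)
    have "(\<lambda>n. \<xi> (B n) \<omega>) sums (\<Sum>n<N. \<xi> (B n) \<omega>)"
      by (rule sums_finite) (use elim in \<open>auto simp: B_def\<close>)
    with elim have "\<xi> (\<Union>\<tau>\<in>T. A \<tau>) \<omega> = (\<Sum>n<N. \<xi> (B n) \<omega>)"
      unfolding un by (metis sums_unique2)
    also have "\<dots> = (\<Sum>n<N. \<xi> (A (h n)) \<omega>)"
      by (simp add: B_def)
    also have "\<dots> = (\<Sum>\<tau>\<in>T. \<xi> (A \<tau>) \<omega>)"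
      by (rule sum.reindex_bij_betw[OF h])
    finally show ?case .
  qed
qed

text \<open>Lets \<open>noise_simple\<close> be computed on a partition finer than the level sets.
  Applied to the pair map \<open>\<phi> x = (f x, h x)\<close>, with the linear combination and the
  two projections as \<open>\<kappa>\<close>, it yields linearity.\<close>

lemma noise_simple_via_partition:
  assumes fin: "finite (\<phi> ` D)" and level: "\<And>\<tau>. \<tau> \<in> \<phi> ` D \<Longrightarrow> {x \<in> D. \<phi> x = \<tau>} \<in> sets (leb D)"
    and A: "A \<in> sets (leb D)"
  shows "AE \<omega> in M. noise_simple D \<xi> (\<lambda>x. \<kappa> (\<phi> x)) A \<omega> = (\<Sum>\<tau>\<in>\<phi> ` D. \<kappa> \<tau> * \<xi> (A \<inter> {x \<in> D. \<phi> x = \<tau>}) \<omega>)"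
proof -
  let ?C = "(\<lambda>x. \<kappa> (\<phi> x)) ` D"
  let ?T = "\<lambda>c. {\<tau> \<in> \<phi> ` D. \<kappa> \<tau> = c}"
  have C: "?C = \<kappa> ` \<phi> ` D"
    by auto
  have "AE \<omega> in M. \<xi> (A \<inter> {x \<in> D. \<kappa> (\<phi> x) = c}) \<omega> = (\<Sum>\<tau>\<in>?T c. \<xi> (A \<inter> {x \<in> D. \<phi> x = \<tau>}) \<omega>)" for c
  proof -
    have un: "A \<inter> {x \<in> D. \<kappa> (\<phi> x) = c} = (\<Union>\<tau>\<in>?T c. A \<inter> {x \<in> D. \<phi> x = \<tau>})"
      by auto
    show ?thesis
      unfolding un
      by (rule xi_finite_disjoint(2)) (use fin level A in \<open>auto simp: disjoint_family_on_def\<close>)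
  qed
  then have "AE \<omega> in M. \<forall>c\<in>?C. \<xi> (A \<inter> {x \<in> D. \<kappa> (\<phi> x) = c}) \<omega> = (\<Sum>\<tau>\<in>?T c. \<xi> (A \<inter> {x \<in> D. \<phi> x = \<tau>}) \<omega>)"
    using fin unfolding C by (intro AE_finite_allI) auto
  then show ?thesis
  proof eventually_elim
    case (elim \<omega>)
    have "noise_simple D \<xi> (\<lambda>x. \<kappa> (\<phi> x)) A \<omega>
        = (\<Sum>c\<in>?C. \<Sum>\<tau>\<in>?T c. \<kappa> \<tau> * \<xi> (A \<inter> {x \<in> D. \<phi> x = \<tau>}) \<omega>)"
      unfolding noise_simple_def
    proof (rule sum.cong[OF refl])
      fix c assume "c \<in> ?C"
      then show "c * \<xi> (A \<inter> {x \<in> D. \<kappa> (\<phi> x) = c}) \<omega> = (\<Sum>\<tau>\<in>?T c. \<kappa> \<tau> * \<xi> (A \<inter> {x \<in> D. \<phi> x = \<tau>}) \<omega>)"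
        unfolding bspec[OF elim \<open>c \<in> ?C\<close>] by (simp add: sum_distrib_left)
    qed
    also have "\<dots> = (\<Sum>\<tau>\<in>\<phi> ` D. \<kappa> \<tau> * \<xi> (A \<inter> {x \<in> D. \<phi> x = \<tau>}) \<omega>)"
      unfolding C using fin by (intro sum.group) auto
    finally show ?case .
  qed
qed

lemma simple_level_sets:
  assumes "simple_function (leb D) f"
  shows "finite (f ` D)" "{x \<in> D. f x = c} \<in> sets (leb D)"
proof -
  show "finite (f ` D)"
    using simple_functionD(1)[OF assms] by (simp add: space_leb)
  have "f -` {c} \<inter> space (leb D) \<in> sets (leb D)"
    by (rule simple_functionD(2)[OF assms])
  moreover have "f -` {c} \<inter> space (leb D) = {x \<in> D. f x = c}"
    by (auto simp: space_leb)
  ultimately show "{x \<in> D. f x = c} \<in> sets (leb D)"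
    by simp
qed

lemma noise_simple_measurable:
  assumes "simple_function (leb D) f" "A \<in> sets (leb D)"
  shows "noise_simple D \<xi> f A \<in> borel_measurable M"
  unfolding noise_simple_def[abs_def]
  using simple_level_sets[OF assms(1)] assms(2)
  by (intro borel_measurable_sum borel_measurable_times borel_measurable_const xi_measurable sets.Int)

lemma noise_simple_lincomb:
  assumes f: "simple_function (leb D) f" and h: "simple_function (leb D) h" and A: "A \<in> sets (leb D)"
  shows "AE \<omega> in M. noise_simple D \<xi> (\<lambda>x. a * f x + b * h x) A \<omega>
    = a * noise_simple D \<xi> f A \<omega> + b * noise_simple D \<xi> h A \<omega>"
proof -
  let ?\<phi> = "\<lambda>x. (f x, h x)"
  have fin: "finite (?\<phi> ` D)"
    by (rule finite_subset[of _ "f ` D \<times> h ` D"]) (use simple_level_sets f h in auto)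
  have level: "{x \<in> D. ?\<phi> x = \<tau>} \<in> sets (leb D)" for \<tau>
  proof -
    have "{x \<in> D. ?\<phi> x = \<tau>} = {x \<in> D. f x = fst \<tau>} \<inter> {x \<in> D. h x = snd \<tau>}"
      by auto
    then show ?thesis
      using simple_level_sets(2)[OF f, of "fst \<tau>"] simple_level_sets(2)[OF h, of "snd \<tau>"] by simp
  qed
  have "AE \<omega> in M. noise_simple D \<xi> (\<lambda>x. \<kappa> (?\<phi> x)) A \<omega> = (\<Sum>\<tau>\<in>?\<phi> ` D. \<kappa> \<tau> * \<xi> (A \<inter> {x \<in> D. ?\<phi> x = \<tau>}) \<omega>)" for \<kappa>
    by (rule noise_simple_via_partition[OF fin level A])
  from this[of "\<lambda>\<tau>. a * fst \<tau> + b * snd \<tau>"] this[of fst] this[of snd]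
  show ?thesis
  proof eventually_elim
    case (elim \<omega>)
    then show ?case
      by (simp add: sum_distrib_left sum.distrib distrib_right mult.assoc)
  qed
qed

lemma integral_psi_simple:
  assumes f: "simple_function (leb D) f" and A: "A \<in> sets (leb D)"
  shows "(LINT x|leb D. indicator A x * \<psi> (t * f x)) = (\<Sum>c\<in>f ` D. measure lborel (A \<inter> {x \<in> D. f x = c}) * \<psi> (t * c))"
proof -
  note level = simple_level_sets[OF f]
  have m: "A \<inter> {x \<in> D. f x = c} \<in> sets (leb D)" for c
    using level A by auto
  have "(LINT x|leb D. indicator A x * \<psi> (t * f x))
     = (LINT x|leb D. (\<Sum>c\<in>f ` D. \<psi> (t * c) * indicator (A \<inter> {x \<in> D. f x = c}) x))"
  proof (rule Bochner_Integration.integral_cong[OF refl])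
    fix x assume "x \<in> space (leb D)"
    then have x: "x \<in> D"
      by (simp add: space_leb)
    have "(\<Sum>c\<in>f ` D. \<psi> (t * c) * indicator (A \<inter> {x \<in> D. f x = c}) x)
        = (\<Sum>c\<in>f ` D. if c = f x then \<psi> (t * c) * indicator A x else 0)"
      using x by (intro sum.cong) (auto split: split_indicator)
    then show "indicator A x * \<psi> (t * f x) = (\<Sum>c\<in>f ` D. \<psi> (t * c) * indicator (A \<inter> {x \<in> D. f x = c}) x)"
      using x level by (simp add: sum.delta' mult.commute)
  qed
  also have "\<dots> = (\<Sum>c\<in>f ` D. LINT x|leb D. \<psi> (t * c) * indicator (A \<inter> {x \<in> D. f x = c}) x)"
    by (intro Bochner_Integration.integral_sum integrable_mult_right)
      (use m in \<open>auto intro!: integrable_real_indicator simp: less_top[symmetric]\<close>)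
  also have "\<dots> = (\<Sum>c\<in>f ` D. \<psi> (t * c) * measure (leb D) (A \<inter> {x \<in> D. f x = c}))"
  proof (intro sum.cong refl)
    fix c
    have "A \<inter> {x \<in> D. f x = c} \<inter> D = A \<inter> {x \<in> D. f x = c}"
      by auto
    then show "(LINT x|leb D. \<psi> (t * c) * indicator (A \<inter> {x \<in> D. f x = c}) x) = \<psi> (t * c) * measure (leb D) (A \<inter> {x \<in> D. f x = c})"
      by (simp add: space_leb)
  qed
  also have "\<dots> = (\<Sum>c\<in>f ` D. measure lborel (A \<inter> {x \<in> D. f x = c}) * \<psi> (t * c))"
  proof (intro sum.cong refl)
    fix c
    have "measure (leb D) (A \<inter> {x \<in> D. f x = c}) = measure lborel (A \<inter> {x \<in> D. f x = c})"
      by (rule measure_restrict_space) (use D_borel in auto)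
    then show "\<psi> (t * c) * measure (leb D) (A \<inter> {x \<in> D. f x = c}) = measure lborel (A \<inter> {x \<in> D. f x = c}) * \<psi> (t * c)"
      by simp
  qed
  finally show ?thesis .
qed

text \<open>The level sets are disjoint, so the characteristic function is a product over them. Its
  exponents are real, hence it equals its real part, the cosine expectation.\<close>

lemma expectation_cos_noise_simple:
  assumes f: "simple_function (leb D) f" and A: "A \<in> sets (leb D)"
  shows "(LINT \<omega>|M. cos (t * noise_simple D \<xi> f A \<omega>)) = exp (- (LINT x|leb D. indicator A x * \<psi> (t * f x)))"
proof -
  note level = simple_level_sets[OF f]
  let ?A = "\<lambda>c. A \<inter> {x \<in> D. f x = c}"
  have m: "?A c \<in> sets (leb D)" for c
    using level A by auto
  note [measurable] = noise_simple_measurable[OF f A]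
  have ind: "indep_vars (\<lambda>_. borel) (\<lambda>c. \<xi> (?A c)) (f ` D)"
    by (rule xi_finite_disjoint(1)) (use level m in \<open>auto simp: disjoint_family_on_def\<close>)
  have "indep_vars (\<lambda>_. borel) (\<lambda>c \<omega>. c * \<xi> (?A c) \<omega>) (f ` D)"
    by (rule indep_vars_compose2[OF ind]) auto
  from char_distr_sum[OF this, of t]
  have "(LINT \<omega>|M. iexp (t * noise_simple D \<xi> f A \<omega>)) = (\<Prod>c\<in>f ` D. LINT \<omega>|M. iexp (t * (c * \<xi> (?A c) \<omega>)))"
    using xi_measurable[OF m] noise_simple_measurable[OF f A]
    by (simp add: char_def integral_distr noise_simple_def[abs_def])
  also have "\<dots> = (\<Prod>c\<in>f ` D. exp (- complex_of_real (measure lborel (?A c) * \<psi> (t * c))))"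
    using char_xi[OF m, of "t * _"] by (simp add: mult.assoc)
  also have "\<dots> = exp (complex_of_real (- (LINT x|leb D. indicator A x * \<psi> (t * f x))))"
    unfolding integral_psi_simple[OF f A] using level by (simp add: exp_sum[symmetric] sum_negf)
  finally have *: "(LINT \<omega>|M. iexp (t * noise_simple D \<xi> f A \<omega>))
      = complex_of_real (exp (- (LINT x|leb D. indicator A x * \<psi> (t * f x))))"
    by (simp only: exp_of_real)
  have "(LINT \<omega>|M. cos (t * noise_simple D \<xi> f A \<omega>)) = (LINT \<omega>|M. Re (iexp (t * noise_simple D \<xi> f A \<omega>)))"
    by (simp add: Re_exp)
  also have "\<dots> = Re (LINT \<omega>|M. iexp (t * noise_simple D \<xi> f A \<omega>))"
    by (rule integral_Re, rule integrable_const_bound[where B = 1]) auto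
  finally show ?thesis
    unfolding * by simp
qed

section \<open>The L2 seminorm and continuity in probability\<close>

lemma simple_L2:
  assumes "simple_function (leb D) f"
  shows "f \<in> L2_on D"
proof -
  have [measurable]: "f \<in> borel_measurable (leb D)"
    by (rule borel_measurable_simple_function[OF assms])
  have fin: "finite (f ` D)"
    by (rule simple_level_sets[OF assms])
  have "integrable (leb D) (\<lambda>x. (f x)\<^sup>2)"
  proof (rule leb.integrable_const_bound[where B = "\<Sum>c\<in>f ` D. c\<^sup>2"])
    have "(f x)\<^sup>2 \<le> (\<Sum>c\<in>f ` D. c\<^sup>2)" if "x \<in> D" for x
      using fin that by (intro member_le_sum) auto
    then show "AE x in leb D. norm ((f x)\<^sup>2) \<le> (\<Sum>c\<in>f ` D. c\<^sup>2)"
      by (intro AE_I2) (simp add: space_leb)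
  qed measurable
  then show ?thesis
    by (simp add: L2_on_def)
qed

definition nrm2 :: "('a \<Rightarrow> real) \<Rightarrow> real" where
  "nrm2 f = (LINT x|leb D. (f x)\<^sup>2)"

lemma nrm2_nonneg: "0 \<le> nrm2 f"
  by (simp add: nrm2_def)

lemma nrm2_lincomb:
  assumes f: "f \<in> L2_on D" and h: "h \<in> L2_on D"
  shows "nrm2 (\<lambda>x. a * f x + b * h x) \<le> 2 * a\<^sup>2 * nrm2 f + 2 * b\<^sup>2 * nrm2 h"
proof -
  have L: "(\<lambda>x. a * f x + b * h x) \<in> L2_on D"
    by (intro L2_on_add L2_on_cmult f h)
  have "(a * f x + b * h x)\<^sup>2 \<le> 2 * a\<^sup>2 * (f x)\<^sup>2 + 2 * b\<^sup>2 * (h x)\<^sup>2" for x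
    using sum_squares_ge_zero[of "a * f x - b * h x" 0] by (simp add: power2_eq_square algebra_simps)
  then have "nrm2 (\<lambda>x. a * f x + b * h x) \<le> (LINT x|leb D. 2 * a\<^sup>2 * (f x)\<^sup>2 + 2 * b\<^sup>2 * (h x)\<^sup>2)"
    unfolding nrm2_def using L f h by (intro integral_mono) (auto simp: L2_on_def)
  also have "\<dots> = 2 * a\<^sup>2 * nrm2 f + 2 * b\<^sup>2 * nrm2 h"
    using f h by (simp add: L2_on_def nrm2_def)
  finally show ?thesis .
qed

abbreviation vol :: real where "vol \<equiv> measure (leb D) D"

lemma expectation_cos_noise_simple_ge:
  assumes f: "simple_function (leb D) f" and A: "A \<in> sets (leb D)"
    and ab: "\<And>t. \<psi> t \<le> a + b * t\<^sup>2" "0 \<le> a" "0 \<le> b"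
  shows "1 - (a * vol + b * (nrm2 f * t\<^sup>2)) \<le> (LINT \<omega>|M. cos (t * noise_simple D \<xi> f A \<omega>))"
proof -
  have fL: "integrable (leb D) (\<lambda>x. (f x)\<^sup>2)"
    using simple_L2[OF f] by (simp add: L2_on_def)
  have "simple_function (leb D) (\<lambda>x. \<psi> (t * f x))"
    by (rule simple_function_compose1[OF f])
  then have "(\<lambda>x. \<psi> (t * f x)) \<in> borel_measurable (leb D)"
    by (rule borel_measurable_simple_function)
  then have m: "(\<lambda>x. indicator A x * \<psi> (t * f x)) \<in> borel_measurable (leb D)"
    using A by measurable
  have int: "integrable (leb D) (\<lambda>x. a + b * (t * f x)\<^sup>2)"
    using fL by (simp add: power_mult_distrib)
  have le: "0 \<le> indicator A x * \<psi> (t * f x) \<and> indicator A x * \<psi> (t * f x) \<le> a + b * (t * f x)\<^sup>2" for x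
    using ab psi_nonneg[of "t * f x"] order_trans[OF psi_nonneg ab(1)[of "t * f x"]] by (auto split: split_indicator)
  have "(LINT x|leb D. indicator A x * \<psi> (t * f x)) \<le> (LINT x|leb D. a + b * (t * f x)\<^sup>2)"
  proof (rule integral_mono[OF _ int])
    show "integrable (leb D) (\<lambda>x. indicator A x * \<psi> (t * f x))"
      by (rule Bochner_Integration.integrable_bound[OF int m]) (use le order_trans[OF conjunct2[OF le] abs_ge_self] in \<open>auto intro!: AE_I2\<close>)
  qed (use le in auto)
  also have "\<dots> = a * vol + b * (nrm2 f * t\<^sup>2)"
    using fL by (simp add: nrm2_def space_leb mult.commute power_mult_distrib)
  finally have "1 - (a * vol + b * (nrm2 f * t\<^sup>2)) \<le> 1 + - (LINT x|leb D. indicator A x * \<psi> (t * f x))"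
    by simp
  also have "\<dots> \<le> exp (- (LINT x|leb D. indicator A x * \<psi> (t * f x)))"
    by (rule exp_ge_add_one_self)
  finally show ?thesis
    using expectation_cos_noise_simple[OF f A, of t] by simp
qed

text \<open>Continuity at 0 from the seminorm \<open>nrm2\<close> to convergence in probability,
  uniformly in \<open>A\<close>: the one-variable case of the tail bound for sums of squares. First
  \<open>a\<close> is fixed small, which determines \<open>b\<close>; then \<open>nrm2 f\<close> is
  taken small relative to \<open>b\<close>.\<close>

lemma l0_noise_simple_small:
  assumes \<eta>: "0 < \<eta>"
  shows "\<exists>\<kappa>>0. \<forall>f A. simple_function (leb D) f \<longrightarrow> A \<in> sets (leb D) \<longrightarrow> nrm2 f \<le> \<kappa> \<longrightarrow>
    l0 M (noise_simple D \<xi> f A) \<le> \<eta>"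
proof -
  define \<delta> where "\<delta> = \<eta> / 2"
  have \<delta>: "0 < \<delta>"
    using \<eta> by (simp add: \<delta>_def)
  \<comment> \<open>The added 1, as in \<open>b'\<close> below, avoids division by 0. The constants
    make the tail probability at most \<open>\<eta> / 4\<close>, which together with
    \<open>\<delta> = \<eta> / 2\<close> stays below \<eta>.\<close>
  define v where "v = vol + 1"
  define a where "a = \<eta> / (16 * v)"
  have v: "0 < v" "vol \<le> v"
    by (auto simp: v_def intro: add_nonneg_pos)
  have a: "0 < a"
    using \<eta> v by (simp add: a_def)
  obtain b where b: "0 \<le> b" "\<And>t. \<psi> t \<le> a + b * t\<^sup>2"
    using psi_le[OF a] by auto
  define b' where "b' = b + 1"
  have b': "0 < b'" "b \<le> b'"
    using b(1) by (auto simp: b'_def)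
  define \<kappa> where "\<kappa> = \<delta>\<^sup>2 * \<eta> / (32 * b')"
  have "0 < \<kappa>"
    using \<delta> \<eta> b' by (simp add: \<kappa>_def)
  moreover have "l0 M (noise_simple D \<xi> f A) \<le> \<eta>"
    if f: "simple_function (leb D) f" and A: "A \<in> sets (leb D)" and le: "nrm2 f \<le> \<kappa>" for f A
  proof -
    note [measurable] = noise_simple_measurable[OF f A]
    have "prob {\<omega> \<in> space M. \<delta>\<^sup>2 < (\<Sum>k<1::nat. (1 * noise_simple D \<xi> f A \<omega>)\<^sup>2)}
        \<le> 2 * (a * vol + 2 * b * (\<Sum>k<1::nat. nrm2 f * 1\<^sup>2) / \<delta>\<^sup>2)"
    proof (rule prob_sum_squares_le[where X = "\<lambda>_. noise_simple D \<xi> f A" and q = "\<lambda>_. 1" and w = "\<lambda>_. nrm2 f"])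
      show "1 - (a * vol + b * (\<Sum>k<1. nrm2 f * (c k)\<^sup>2)) \<le> (LINT \<omega>|M. cos (\<Sum>k<1. c k * noise_simple D \<xi> f A \<omega>))" for c :: "nat \<Rightarrow> real"
        using expectation_cos_noise_simple_ge[OF f A b(2) less_imp_le[OF a] b(1), of "c 0"] by simp
    qed (use \<delta> in auto)
    moreover have "\<delta>\<^sup>2 < x\<^sup>2 \<longleftrightarrow> \<delta> < \<bar>x\<bar>" for x
      using \<delta> abs_le_square_iff[of x \<delta>] by (simp add: not_le[symmetric])
    ultimately have "prob {\<omega> \<in> space M. \<delta> < \<bar>noise_simple D \<xi> f A \<omega>\<bar>} \<le> 2 * (a * vol + 2 * b * nrm2 f / \<delta>\<^sup>2)"
      by simp
    also have "\<dots> \<le> 2 * (\<eta> / 16 + \<eta> / 16)"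
    proof -
      have "a * vol \<le> a * v"
        using a v by simp
      also have "\<dots> = \<eta> / 16"
        using v by (simp add: a_def)
      finally have 1: "a * vol \<le> \<eta> / 16" .
      have "2 * b * nrm2 f / \<delta>\<^sup>2 \<le> 2 * b' * \<kappa> / \<delta>\<^sup>2"
        using b b' le nrm2_nonneg[of f] by (intro divide_right_mono mult_mono) auto
      also have "\<dots> = \<eta> / 16"
        using \<delta> b' by (simp add: \<kappa>_def field_simps)
      finally show ?thesis
        using 1 by simp
    qed
    finally show ?thesis
      using l0_le_prob[of "noise_simple D \<xi> f A" \<delta>] \<eta> by (simp add: \<delta>_def)
  qed
  ultimately show ?thesis
    by blast
qed

text \<open>A relation, since limits in probability are unique only almost surely. In contrast to
  \<open>has_noise_integral\<close>, approximation is in the seminorm \<open>nrm2\<close> and only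
  the set \<open>D\<close> is tested, which makes linearity and continuity in the integrand
  direct.\<close>

definition L2_noise_integral :: "('a \<Rightarrow> real) \<Rightarrow> ('w \<Rightarrow> real) \<Rightarrow> bool" where
  "L2_noise_integral f Z \<longleftrightarrow> f \<in> L2_on D \<and>
     (\<exists>H. (\<forall>n. simple_function (leb D) (H n)) \<and> (\<lambda>n. nrm2 (\<lambda>x. H n x - f x)) \<longlonglongrightarrow> 0 \<and>
       conv_in_prob M (\<lambda>n. noise_simple D \<xi> (H n) D) Z)"

section \<open>Integration of square-integrable functions\<close>

lemma L2_simple_approximation:
  assumes "f \<in> L2_on D"
  shows "\<exists>H. (\<forall>n. simple_function (leb D) (H n)) \<and> (\<forall>x\<in>D. (\<lambda>n. H n x) \<longlonglongrightarrow> f x) \<and>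
    (\<lambda>n. nrm2 (\<lambda>x. H n x - f x)) \<longlonglongrightarrow> 0"
proof -
  have [measurable]: "f \<in> borel_measurable (leb D)" and f2: "integrable (leb D) (\<lambda>x. (f x)\<^sup>2)"
    using assms by (auto simp: L2_on_def)
  obtain H where H: "\<forall>n. simple_function (leb D) (H n)" "\<forall>x\<in>D. (\<lambda>n. H n x) \<longlonglongrightarrow> f x"
    and dist: "\<forall>n. \<forall>x\<in>D. dist (H n x) 0 \<le> 2 * dist (f x) 0"
    using borel_measurable_implies_sequence_metric[of f "leb D" 0, unfolded space_leb] \<open>f \<in> borel_measurable (leb D)\<close>
    by blast
  have [measurable]: "H n \<in> borel_measurable (leb D)" for n
    using H(1) by (blast intro: borel_measurable_simple_function)
  have "(\<lambda>n. LINT x|leb D. (H n x - f x)\<^sup>2) \<longlonglongrightarrow> (LINT x|leb D. 0)"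
  proof (rule integral_dominated_convergence[where w = "\<lambda>x. 9 * (f x)\<^sup>2"])
    show "AE x in leb D. (\<lambda>n. (H n x - f x)\<^sup>2) \<longlonglongrightarrow> 0"
    proof (rule AE_I2)
      fix x assume "x \<in> space (leb D)"
      then have "(\<lambda>n. (H n x - f x)\<^sup>2) \<longlonglongrightarrow> (f x - f x)\<^sup>2"
        by (intro tendsto_intros H(2)[rule_format]) (simp add: space_leb)
      then show "(\<lambda>n. (H n x - f x)\<^sup>2) \<longlonglongrightarrow> 0"
        by simp
    qed
    show "AE x in leb D. norm ((H n x - f x)\<^sup>2) \<le> 9 * (f x)\<^sup>2" for n
    proof (rule AE_I2)
      fix x assume "x \<in> space (leb D)"
      then have "\<bar>H n x\<bar> \<le> 2 * \<bar>f x\<bar>"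
        using dist by (simp add: space_leb)
      then have "\<bar>H n x - f x\<bar> \<le> \<bar>3 * f x\<bar>"
        by linarith
      then have "(H n x - f x)\<^sup>2 \<le> (3 * f x)\<^sup>2"
        by (simp only: abs_le_square_iff)
      then show "norm ((H n x - f x)\<^sup>2) \<le> 9 * (f x)\<^sup>2"
        by (simp add: power_mult_distrib)
    qed
  qed (use f2 in auto)
  then show ?thesis
    using H(1,2) by (intro exI[of _ H]) (auto simp: nrm2_def)
qed

lemma nrm2_diff_le:
  assumes "f \<in> L2_on D" "g \<in> L2_on D" "h \<in> L2_on D"
  shows "nrm2 (\<lambda>x. f x - g x) \<le> 2 * nrm2 (\<lambda>x. f x - h x) + 2 * nrm2 (\<lambda>x. g x - h x)"
  using nrm2_lincomb[of "\<lambda>x. f x - h x" "\<lambda>x. g x - h x" 1 "-1"] assms by (simp add: L2_on_diff)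

lemma l0_noise_simple_diff:
  assumes "simple_function (leb D) f" "simple_function (leb D) h" "A \<in> sets (leb D)"
  shows "l0 M (\<lambda>\<omega>. noise_simple D \<xi> f A \<omega> - noise_simple D \<xi> h A \<omega>) = l0 M (noise_simple D \<xi> (\<lambda>x. f x - h x) A)"
proof (rule l0_cong_AE)
  have "simple_function (leb D) (\<lambda>x. f x - h x)"
    using assms by (intro simple_function_diff)
  then show "noise_simple D \<xi> (\<lambda>x. f x - h x) A \<in> borel_measurable M"
    by (rule noise_simple_measurable[OF _ assms(3)])
  show "AE \<omega> in M. noise_simple D \<xi> f A \<omega> - noise_simple D \<xi> h A \<omega> = noise_simple D \<xi> (\<lambda>x. f x - h x) A \<omega>"
    using noise_simple_lincomb[OF assms, of 1 "-1"] by eventually_elim simp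
qed (intro borel_measurable_diff noise_simple_measurable assms)

lemma noise_simple_converges:
  assumes f: "f \<in> L2_on D" and H: "\<And>n. simple_function (leb D) (H n)"
    and lim: "(\<lambda>n. nrm2 (\<lambda>x. H n x - f x)) \<longlonglongrightarrow> 0" and A: "A \<in> sets (leb D)"
  shows "\<exists>Y. conv_in_prob M (\<lambda>n. noise_simple D \<xi> (H n) A) Y"
proof (rule l0_Cauchy_imp_conv_in_prob)
  show "noise_simple D \<xi> (H n) A \<in> borel_measurable M" for n
    by (rule noise_simple_measurable[OF H A])
  fix \<epsilon> :: real assume "0 < \<epsilon>"
  then obtain \<kappa> where \<kappa>: "\<kappa> > 0" "\<And>f. simple_function (leb D) f \<Longrightarrow> nrm2 f \<le> \<kappa> \<Longrightarrow> l0 M (noise_simple D \<xi> f A) \<le> \<epsilon>"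
    using l0_noise_simple_small A by meson
  obtain n0 where n0: "\<And>n. n \<ge> n0 \<Longrightarrow> nrm2 (\<lambda>x. H n x - f x) < \<kappa> / 4"
    using LIMSEQ_D[OF lim, of "\<kappa> / 4"] \<kappa>(1) by (auto simp: nrm2_nonneg)
  have "l0 M (\<lambda>\<omega>. noise_simple D \<xi> (H m) A \<omega> - noise_simple D \<xi> (H n) A \<omega>) \<le> \<epsilon>"
    if "m \<ge> n0" "n \<ge> n0" for m n
    unfolding l0_noise_simple_diff[OF H H A]
  proof (rule \<kappa>(2))
    show "nrm2 (\<lambda>x. H m x - H n x) \<le> \<kappa>"
      using nrm2_diff_le[OF simple_L2[OF H[of m]] simple_L2[OF H[of n]] f] n0[OF that(1)] n0[OF that(2)] by linarith
  qed (intro simple_function_diff H)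
  then show "\<exists>n0. \<forall>m\<ge>n0. \<forall>n\<ge>n0. l0 M (\<lambda>\<omega>. noise_simple D \<xi> (H m) A \<omega> - noise_simple D \<xi> (H n) A \<omega>) \<le> \<epsilon>"
    by blast
qed

lemma L2_noise_integral_exists:
  assumes "f \<in> L2_on D"
  shows "\<exists>Z. L2_noise_integral f Z"
  using L2_simple_approximation[OF assms] noise_simple_converges[OF assms _ _ D_sets] assms
  unfolding L2_noise_integral_def by meson

lemma L2_noise_integralE:
  assumes "L2_noise_integral f Z"
  obtains H where "\<And>n. simple_function (leb D) (H n)" "(\<lambda>n. nrm2 (\<lambda>x. H n x - f x)) \<longlonglongrightarrow> 0"
    "conv_in_prob M (\<lambda>n. noise_simple D \<xi> (H n) D) Z"
  using assms unfolding L2_noise_integral_def by blast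

lemma L2_noise_integral_measurable: "L2_noise_integral f Z \<Longrightarrow> Z \<in> borel_measurable M"
  by (auto simp: L2_noise_integral_def conv_in_prob_def)

lemma L2_noise_integral_L2: "L2_noise_integral f Z \<Longrightarrow> f \<in> L2_on D"
  by (simp add: L2_noise_integral_def)

lemma L2_noise_integral_lincomb:
  assumes "L2_noise_integral f Z" "L2_noise_integral h W"
  shows "L2_noise_integral (\<lambda>x. a * f x + b * h x) (\<lambda>\<omega>. a * Z \<omega> + b * W \<omega>)"
proof -
  obtain F where F: "\<And>n. simple_function (leb D) (F n)" "(\<lambda>n. nrm2 (\<lambda>x. F n x - f x)) \<longlonglongrightarrow> 0"
      "conv_in_prob M (\<lambda>n. noise_simple D \<xi> (F n) D) Z"
    by (rule L2_noise_integralE[OF assms(1)]) (rule that; assumption)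
  obtain H where H: "\<And>n. simple_function (leb D) (H n)" "(\<lambda>n. nrm2 (\<lambda>x. H n x - h x)) \<longlonglongrightarrow> 0"
      "conv_in_prob M (\<lambda>n. noise_simple D \<xi> (H n) D) W"
    by (rule L2_noise_integralE[OF assms(2)]) (rule that; assumption)
  note L = L2_noise_integral_L2[OF assms(1)] L2_noise_integral_L2[OF assms(2)]
  have s: "simple_function (leb D) (\<lambda>x. a * F n x + b * H n x)" for n
    using F(1) H(1) by (intro simple_function_add simple_function_mult simple_function_const)
  have "(\<lambda>n. nrm2 (\<lambda>x. (a * F n x + b * H n x) - (a * f x + b * h x))) \<longlonglongrightarrow> 0"
  proof (rule tendsto_sandwich[OF _ _ tendsto_const])
    show "(\<lambda>n. 2 * a\<^sup>2 * nrm2 (\<lambda>x. F n x - f x) + 2 * b\<^sup>2 * nrm2 (\<lambda>x. H n x - h x)) \<longlonglongrightarrow> 0"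
      using F(2) H(2) by (auto intro!: tendsto_eq_intros)
    have "nrm2 (\<lambda>x. (a * F n x + b * H n x) - (a * f x + b * h x))
        \<le> 2 * a\<^sup>2 * nrm2 (\<lambda>x. F n x - f x) + 2 * b\<^sup>2 * nrm2 (\<lambda>x. H n x - h x)" for n
      using nrm2_lincomb[OF L2_on_diff[OF simple_L2[OF F(1)[of n]] L(1)] L2_on_diff[OF simple_L2[OF H(1)[of n]] L(2)], of a b]
      by (simp add: algebra_simps)
    then show "\<forall>\<^sub>F n in sequentially. nrm2 (\<lambda>x. (a * F n x + b * H n x) - (a * f x + b * h x))
        \<le> 2 * a\<^sup>2 * nrm2 (\<lambda>x. F n x - f x) + 2 * b\<^sup>2 * nrm2 (\<lambda>x. H n x - h x)"
      by simp
  qed (simp add: nrm2_nonneg)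
  moreover have "conv_in_prob M (\<lambda>n. noise_simple D \<xi> (\<lambda>x. a * F n x + b * H n x) D) (\<lambda>\<omega>. a * Z \<omega> + b * W \<omega>)"
  proof (rule conv_in_prob_cong_AE[OF conv_in_prob_lincomb[OF F(3) H(3), of a b]])
    show "AE \<omega> in M. a * noise_simple D \<xi> (F n) D \<omega> + b * noise_simple D \<xi> (H n) D \<omega>
        = noise_simple D \<xi> (\<lambda>x. a * F n x + b * H n x) D \<omega>" for n
      using noise_simple_lincomb[OF F(1)[of n] H(1)[of n] D_sets, of a b] by eventually_elim simp
  qed (use L2_noise_integral_measurable assms noise_simple_measurable[OF s D_sets] in auto)
  ultimately show ?thesis
    using s L2_on_add[OF L2_on_cmult[OF L(1)] L2_on_cmult[OF L(2)]] unfolding L2_noise_integral_def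
    by (intro conjI exI[of _ "\<lambda>n x. a * F n x + b * H n x"] allI)
qed

lemma L2_noise_integral_0: "L2_noise_integral (\<lambda>_. 0) (\<lambda>_. 0)"
  unfolding L2_noise_integral_def
proof (intro conjI exI[of _ "\<lambda>_ _. 0"])
  have "noise_simple D \<xi> (\<lambda>_. 0) D = (\<lambda>_. 0)"
    unfolding noise_simple_def by (intro ext sum.neutral) auto
  then show "conv_in_prob M (\<lambda>n. noise_simple D \<xi> (\<lambda>_. 0) D) (\<lambda>_. 0)"
    by (simp add: conv_in_prob_def)
qed (auto simp: L2_on_def nrm2_def)

lemma L2_noise_integral_sum:
  assumes "finite I" "\<And>k. k \<in> I \<Longrightarrow> L2_noise_integral (f k) (Z k)"
  shows "L2_noise_integral (\<lambda>x. \<Sum>k\<in>I. c k * f k x) (\<lambda>\<omega>. \<Sum>k\<in>I. c k * Z k \<omega>)"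
  using assms
proof (induction I)
  case (insert k I)
  then show ?case
    using L2_noise_integral_lincomb[of "f k" "Z k" "\<lambda>x. \<Sum>k\<in>I. c k * f k x" "\<lambda>\<omega>. \<Sum>k\<in>I. c k * Z k \<omega>" "c k" 1] by simp
qed (simp add: L2_noise_integral_0)

lemma nrm2_simple_le:
  assumes "f \<in> L2_on D" "simple_function (leb D) h"
  shows "nrm2 h \<le> 2 * nrm2 f + 2 * nrm2 (\<lambda>x. h x - f x)"
  using nrm2_lincomb[OF assms(1) L2_on_diff[OF simple_L2[OF assms(2)] assms(1)], of 1 1] by simp

lemma l0_L2_noise_integral_small:
  assumes "0 < \<eta>"
  shows "\<exists>\<kappa>>0. \<forall>f Z. L2_noise_integral f Z \<longrightarrow> nrm2 f \<le> \<kappa> \<longrightarrow> l0 M Z \<le> \<eta>"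
proof -
  obtain \<kappa> where \<kappa>: "\<kappa> > 0" "\<And>f. simple_function (leb D) f \<Longrightarrow> nrm2 f \<le> \<kappa> \<Longrightarrow> l0 M (noise_simple D \<xi> f D) \<le> \<eta>"
    using l0_noise_simple_small[OF assms] D_sets by meson
  \<comment> \<open>The quarter leaves room for the passage to a simple \<open>H n\<close>, whose
    seminorm is at most \<open>2 nrm2 f + 2 nrm2 (H n - f)\<close> and so eventually at most
    \<kappa>.\<close>
  have "l0 M Z \<le> \<eta>" if Z: "L2_noise_integral f Z" and le: "nrm2 f \<le> \<kappa> / 4" for f Z
  proof -
    obtain H where H: "\<And>n. simple_function (leb D) (H n)" "(\<lambda>n. nrm2 (\<lambda>x. H n x - f x)) \<longlonglongrightarrow> 0"
      "conv_in_prob M (\<lambda>n. noise_simple D \<xi> (H n) D) Z"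
      by (rule L2_noise_integralE[OF Z]) (rule that; assumption)
    have lim: "(\<lambda>n. l0 M (\<lambda>\<omega>. noise_simple D \<xi> (H n) D \<omega> - Z \<omega>)) \<longlonglongrightarrow> 0"
      using H(3) by (simp add: conv_in_prob_iff_l0)
    have [measurable]: "Z \<in> borel_measurable M" "\<And>n. noise_simple D \<xi> (H n) D \<in> borel_measurable M"
      using H(3) by (auto simp: conv_in_prob_iff_l0)
    have "\<forall>\<^sub>F n in sequentially. nrm2 (\<lambda>x. H n x - f x) < \<kappa> / 4"
      by (rule order_tendstoD(2)[OF H(2)]) (use \<kappa>(1) in simp)
    then have "\<forall>\<^sub>F n in sequentially. l0 M Z \<le> \<eta> + l0 M (\<lambda>\<omega>. noise_simple D \<xi> (H n) D \<omega> - Z \<omega>)"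
    proof eventually_elim
      case (elim n)
      have "nrm2 (H n) \<le> \<kappa>"
        using nrm2_simple_le[OF L2_noise_integral_L2[OF Z] H(1)[of n]] elim le by linarith
      then have "l0 M (noise_simple D \<xi> (H n) D) \<le> \<eta>"
        by (rule \<kappa>(2)[OF H(1)])
      then show ?case
        using l0_lincomb[of "noise_simple D \<xi> (H n) D" "\<lambda>\<omega>. noise_simple D \<xi> (H n) D \<omega> - Z \<omega>" 1 "-1"] by simp
    qed
    moreover have "(\<lambda>n. \<eta> + l0 M (\<lambda>\<omega>. noise_simple D \<xi> (H n) D \<omega> - Z \<omega>)) \<longlonglongrightarrow> \<eta> + 0"
      by (intro tendsto_intros lim)
    ultimately show ?thesis
      using tendsto_lowerbound[of _ "\<eta> + 0" sequentially "l0 M Z"] by simp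
  qed
  then show ?thesis
    using \<kappa>(1) by (intro exI[of _ "\<kappa> / 4"]) auto
qed

text \<open>The difference of the two versions integrates the zero function, whose seminorm lies
  below every threshold.\<close>

lemma L2_noise_integral_unique:
  assumes "L2_noise_integral f Z" "L2_noise_integral f W"
  shows "AE \<omega> in M. Z \<omega> = W \<omega>"
proof -
  have *: "L2_noise_integral (\<lambda>x. 1 * f x + (-1) * f x) (\<lambda>\<omega>. 1 * Z \<omega> + (-1) * W \<omega>)"
    by (intro L2_noise_integral_lincomb assms)
  have "l0 M (\<lambda>\<omega>. 1 * Z \<omega> + (-1) * W \<omega>) \<le> \<eta>" if \<eta>: "0 < \<eta>" for \<eta>
    using l0_L2_noise_integral_small[OF \<eta>] * by (auto simp: nrm2_def)
  then have "l0 M (\<lambda>\<omega>. 1 * Z \<omega> + (-1) * W \<omega>) = 0"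
    by (intro antisym[OF field_le_epsilon l0_nonneg]) simp
  then show ?thesis
    using l0_eq_0_iff[OF L2_noise_integral_measurable[OF *]] by simp
qed

text \<open>For a combination of the \<open>e k\<close>, where the seminorm is the sum of the
  squared coefficients, this is the input of the Gaussian randomisation. The factor 2 is the price
  of comparing \<open>f\<close> with its simple approximations.\<close>

lemma expectation_cos_L2_noise_integral_ge:
  assumes Z: "L2_noise_integral f Z" and ab: "\<And>t. \<psi> t \<le> a + b * t\<^sup>2" "0 \<le> a" "0 \<le> b"
  shows "1 - (a * vol + b * (2 * nrm2 f)) \<le> (LINT \<omega>|M. cos (Z \<omega>))"
proof -
  obtain H where H: "\<And>n. simple_function (leb D) (H n)" "(\<lambda>n. nrm2 (\<lambda>x. H n x - f x)) \<longlonglongrightarrow> 0"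
    "conv_in_prob M (\<lambda>n. noise_simple D \<xi> (H n) D) Z"
    by (rule L2_noise_integralE[OF Z]) (rule that; assumption)
  have lim: "(\<lambda>n. LINT \<omega>|M. cos (noise_simple D \<xi> (H n) D \<omega>)) \<longlonglongrightarrow> (LINT \<omega>|M. cos (Z \<omega>))"
    using conv_in_prob_cos[OF H(3), of 1] by simp
  have lim': "(\<lambda>n. 1 - (a * vol + b * (2 * nrm2 f + 2 * nrm2 (\<lambda>x. H n x - f x)))) \<longlonglongrightarrow> 1 - (a * vol + b * (2 * nrm2 f + 2 * 0))"
    by (intro tendsto_intros H(2))
  have "1 - (a * vol + b * (2 * nrm2 f + 2 * nrm2 (\<lambda>x. H n x - f x))) \<le> (LINT \<omega>|M. cos (noise_simple D \<xi> (H n) D \<omega>))" for n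
    using expectation_cos_noise_simple_ge[OF H(1)[of n] D_sets ab, of 1]
      mult_left_mono[OF nrm2_simple_le[OF L2_noise_integral_L2[OF Z] H(1)[of n]] ab(3)] by simp
  then show ?thesis
    using LIMSEQ_le[OF lim' lim] by auto
qed

text \<open>If \<open>F\<^sub>n\<close> and \<open>H\<^sub>n\<close> are simple approximations defining the two integrals and \<open>J\<^sub>n = F\<^sub>n - H\<^sub>n\<close>, then
  \<open>J\<^sub>n \<rightarrow> 0\<close> a.e. and the setwise integrals of \<open>\<psi>(t J\<^sub>n)\<close> converge, so \<open>\<integral>\<psi>(t J\<^sub>n) \<rightarrow> 0\<close>.\<close>

lemma has_noise_integral_eq_L2_noise_integral:
  assumes X: "has_noise_integral M D \<xi> f X" and Z: "L2_noise_integral f Z"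
  shows "AE \<omega> in M. X \<omega> = Z \<omega>"
proof -
  have f: "f \<in> L2_on D"
    by (rule L2_noise_integral_L2[OF Z])
  obtain F where F: "\<And>n. simple_function (leb D) (F n)" "AE x in leb D. (\<lambda>n. F n x) \<longlonglongrightarrow> f x"
      "\<And>A. A \<in> sets (leb D) \<Longrightarrow> \<exists>Y. conv_in_prob M (\<lambda>n. noise_simple D \<xi> (F n) A) Y"
      "conv_in_prob M (\<lambda>n. noise_simple D \<xi> (F n) D) X"
    using X unfolding has_noise_integral_def by auto
  obtain H where H: "\<And>n. simple_function (leb D) (H n)" "\<And>x. x \<in> D \<Longrightarrow> (\<lambda>n. H n x) \<longlonglongrightarrow> f x"
      "(\<lambda>n. nrm2 (\<lambda>x. H n x - f x)) \<longlonglongrightarrow> 0"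
    using L2_simple_approximation[OF f] by auto
  obtain W where W: "conv_in_prob M (\<lambda>n. noise_simple D \<xi> (H n) D) W"
    using noise_simple_converges[OF f H(1,3) D_sets] by auto
  have "L2_noise_integral f W"
    unfolding L2_noise_integral_def using f H W by (intro conjI exI[of _ H] allI)
  define J where "J n x = F n x - H n x" for n x
  have J: "simple_function (leb D) (J n)" for n
    unfolding J_def by (intro simple_function_diff F H)
  have convJ: "conv_in_prob M (\<lambda>n. noise_simple D \<xi> (J n) A) (\<lambda>\<omega>. Y \<omega> - Y' \<omega>)"
    if A: "A \<in> sets (leb D)" and Y: "conv_in_prob M (\<lambda>n. noise_simple D \<xi> (F n) A) Y"
      and Y': "conv_in_prob M (\<lambda>n. noise_simple D \<xi> (H n) A) Y'" for A Y Y'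
  proof (rule conv_in_prob_cong_AE[OF conv_in_prob_lincomb[OF Y Y', of 1 "-1"]])
    show "AE \<omega> in M. 1 * noise_simple D \<xi> (F n) A \<omega> + - 1 * noise_simple D \<xi> (H n) A \<omega> = noise_simple D \<xi> (J n) A \<omega>" for n
      using noise_simple_lincomb[OF F(1)[of n] H(1)[of n] A, of 1 "-1"] unfolding J_def by eventually_elim simp
    show "(\<lambda>\<omega>. Y \<omega> - Y' \<omega>) \<in> borel_measurable M"
      using Y Y' by (intro borel_measurable_diff) (auto simp: conv_in_prob_def)
  qed (use noise_simple_measurable[OF J A] in auto)
  define V where "V \<omega> = X \<omega> - W \<omega>" for \<omega>
  have V: "conv_in_prob M (\<lambda>n. noise_simple D \<xi> (J n) D) V"
    unfolding V_def by (rule convJ[OF D_sets F(4) W])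
  then have [measurable]: "V \<in> borel_measurable M"
    by (simp add: conv_in_prob_def)
  define I where "I t n A = (LINT x|leb D. indicator A x * \<psi> (t * J n x))" for t n A
  have cosJ: "(LINT \<omega>|M. cos (t * noise_simple D \<xi> (J n) A \<omega>)) = exp (- I t n A)" if "A \<in> sets (leb D)" for t n A
    unfolding I_def by (rule expectation_cos_noise_simple[OF J that])
  have measJ: "(\<lambda>x. \<psi> (t * J n x)) \<in> borel_measurable (leb D)" for t n
    by (intro borel_measurable_simple_function simple_function_compose1[OF J])
  \<comment> \<open>A simple function takes finitely many values, so a finite sum bounds
    \<open>\<psi> (t * J n x)\<close> in \<open>x\<close>. The bound may grow with \<open>n\<close>,
    which the hump argument permits.\<close>
  define B where "B t n = (\<Sum>c\<in>J n ` D. \<psi> (t * c))" for t n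
  have B: "\<psi> (t * J n x) \<le> B t n" if "x \<in> space (leb D)" for t n x
    unfolding B_def using simple_level_sets(1)[OF J] that psi_nonneg by (intro member_le_sum) (auto simp: space_leb)
  have intJ: "integrable (leb D) (\<lambda>x. indicator A x * \<psi> (t * J n x))" if [measurable]: "A \<in> sets (leb D)" for t n A
  proof (rule leb.integrable_const_bound[where B = "\<bar>B t n\<bar>"])
    show "AE x in leb D. norm (indicator A x * \<psi> (t * J n x)) \<le> \<bar>B t n\<bar>"
      using order_trans[OF B[of _ t n] abs_ge_self] psi_nonneg by (intro AE_I2) (auto split: split_indicator)
    show "(\<lambda>x. indicator A x * \<psi> (t * J n x)) \<in> borel_measurable (leb D)"
      using measJ[of t n] by measurable
  qed
  have cos1: "(LINT \<omega>|M. cos (t * V \<omega>)) = 1" if pos: "0 < (LINT \<omega>|M. cos (t * V \<omega>))" for t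
  proof -
    have limD: "(\<lambda>n. exp (- I t n D)) \<longlonglongrightarrow> (LINT \<omega>|M. cos (t * V \<omega>))"
      using conv_in_prob_cos[OF V, of t] by (simp add: cosJ[OF D_sets])
    have "(\<lambda>n. LINT x|leb D. \<psi> (t * J n x)) \<longlonglongrightarrow> 0"
    proof (rule leb.setwise_convergent_imp_integral_tendsto_0[where c = "B t"])
      show "AE x in leb D. (\<lambda>n. \<psi> (t * J n x)) \<longlonglongrightarrow> 0"
        using F(2) AE_space
      proof eventually_elim
        case (elim x)
        have "(\<lambda>n. t * J n x) \<longlonglongrightarrow> t * (f x - f x)"
          unfolding J_def using elim by (intro tendsto_intros H(2)) (auto simp: space_leb)
        then show ?case
          by (intro psi_tendsto_0) simp
      qed
      show "convergent (\<lambda>n. LINT x|leb D. indicator A x * \<psi> (t * J n x))" if A: "A \<in> sets (leb D)" for A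
      proof -
        obtain Y Y' where Y: "conv_in_prob M (\<lambda>n. noise_simple D \<xi> (F n) A) Y" and Y': "conv_in_prob M (\<lambda>n. noise_simple D \<xi> (H n) A) Y'"
          using F(3)[OF A] noise_simple_converges[OF f H(1,3) A] by blast
        have limA: "(\<lambda>n. exp (- I t n A)) \<longlonglongrightarrow> (LINT \<omega>|M. cos (t * (Y \<omega> - Y' \<omega>)))" (is "_ \<longlonglongrightarrow> ?l")
          using conv_in_prob_cos[OF convJ[OF A Y Y'], of t] by (simp add: cosJ[OF A])
        \<comment> \<open>Setwise convergence of the integrals is read off from their exponentials
          by a logarithm. Its argument is positive: the limit for \<open>A\<close> is at least the
          limit for \<open>D\<close>, which is assumed positive.\<close>
        have "I t n A \<le> I t n D" for n
          unfolding I_def using A D_borel intJ[OF A] intJ[OF D_sets] psi_nonneg sets.sets_into_space[OF A]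
          by (intro integral_mono) (auto simp: space_leb split: split_indicator)
        then have "(LINT \<omega>|M. cos (t * V \<omega>)) \<le> ?l"
          by (intro LIMSEQ_le[OF limD limA]) auto
        then have "?l \<noteq> 0"
          using pos by simp
        from tendsto_minus[OF tendsto_ln[OF limA this]] show ?thesis
          by (auto simp: convergent_def I_def)
      qed
    qed (use measJ psi_nonneg B in auto)
    moreover have "(LINT x|leb D. \<psi> (t * J n x)) = I t n D" for n
      unfolding I_def by (rule Bochner_Integration.integral_cong) (auto simp: space_leb)
    ultimately have "(\<lambda>n. exp (- I t n D)) \<longlonglongrightarrow> exp (- 0)"
      by (intro tendsto_exp tendsto_minus) simp
    then show ?thesis
      using LIMSEQ_unique[OF limD] by simp
  qed
  \<comment> \<open>The cosine expectation tends to 1 for small arguments and so is eventually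
    positive; by \<open>cos1\<close> it then equals 1, which forces the cosine itself to be 1 almost
    surely.\<close>
  have "(\<lambda>m. LINT \<omega>|M. cos (V \<omega> / (real m + 1))) \<longlonglongrightarrow> (LINT \<omega>|M. 1)"
  proof (rule integral_dominated_convergence[where w = "\<lambda>_. 1"])
    show "AE \<omega> in M. (\<lambda>m. cos (V \<omega> / (real m + 1))) \<longlonglongrightarrow> 1"
    proof (rule AE_I2)
      fix \<omega>
      have "(\<lambda>m. V \<omega> / (real m + 1)) \<longlonglongrightarrow> 0"
        using LIMSEQ_Suc[OF lim_const_over_n[of "V \<omega>"]] by (simp add: add.commute)
      from tendsto_cos[OF this] show "(\<lambda>m. cos (V \<omega> / (real m + 1))) \<longlonglongrightarrow> 1"
        by simp
    qed
  qed auto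
  then have "\<forall>\<^sub>F m in sequentially. 0 < (LINT \<omega>|M. cos (V \<omega> / (real m + 1)))"
    by (intro order_tendstoD(1)) (auto simp: prob_space)
  then obtain m0 where m0: "\<And>m. m \<ge> m0 \<Longrightarrow> 0 < (LINT \<omega>|M. cos (V \<omega> / (real m + 1)))"
    by (auto simp: eventually_sequentially)
  have int: "integrable M (\<lambda>\<omega>. cos (V \<omega> / (real m + 1)))" for m
    by (rule integrable_const_bound[where B = 1]) auto
  have "AE \<omega> in M. cos (V \<omega> / (real m + 1)) = 1" if "m \<ge> m0" for m
  proof -
    have "(LINT \<omega>|M. cos (V \<omega> / (real m + 1))) = 1"
      using cos1[of "1 / (real m + 1)"] m0[OF that] by simp
    then have "(LINT \<omega>|M. 1 - cos (V \<omega> / (real m + 1))) = 0"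
      using int by (simp add: prob_space)
    then have "AE \<omega> in M. 1 - cos (V \<omega> / (real m + 1)) = 0"
      using integral_nonneg_eq_0_iff_AE[of M "\<lambda>\<omega>. 1 - cos (V \<omega> / (real m + 1))"] int by auto
    then show ?thesis
      by eventually_elim simp
  qed
  then have "AE \<omega> in M. \<forall>m\<ge>m0. cos (V \<omega> / (real m + 1)) = 1"
    by (simp add: AE_all_countable AE_conj_iff)
  then have "AE \<omega> in M. X \<omega> = W \<omega>"
  proof eventually_elim
    case (elim \<omega>)
    have "V \<omega> = 0"
      by (rule cos_eq_1_for_all_small_multiples[of m0]) (use elim in blast)
    then show ?case
      by (simp add: V_def)
  qed
  then show ?thesis
    using L2_noise_integral_unique[OF \<open>L2_noise_integral f W\<close> Z] by eventually_elim simp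
qed

subsection \<open>The coefficients along an orthonormal basis\<close>

text \<open>The tail bound \<open>2 * (a * vol + 4 * b * L / B)\<close> for the partial sums is
  uniform in their length. As \<open>b\<close> depends on \<open>a\<close>, first \<open>B\<close>
  grows and only then \<open>a\<close> shrinks; this leaves probability 0 for unbounded partial
  sums.\<close>

lemma AE_summable_noise_coefficients:
  fixes e :: "nat \<Rightarrow> 'a \<Rightarrow> real"
  assumes e: "orthonormal_basis_L2 D e" and X: "\<And>k. L2_noise_integral (e k) (X k)"
    and w: "\<And>k. 0 \<le> w k" "summable w"
  shows "AE \<omega> in M. summable (\<lambda>k. w k * (X k \<omega>)\<^sup>2)"
proof -
  note [measurable] = L2_noise_integral_measurable[OF X]
  define L where "L = suminf w"
  have L: "(\<Sum>k<n. w k) \<le> L" for n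
    unfolding L_def using w by (intro sum_le_suminf) auto
  have L0: "0 \<le> L"
    using L[of 0] by simp
  define S where "S n \<omega> = (\<Sum>k<n. (sqrt (w k) * X k \<omega>)\<^sup>2)" for n \<omega>
  have S: "S n \<omega> = (\<Sum>k<n. w k * (X k \<omega>)\<^sup>2)" for n \<omega>
    using w by (simp add: S_def power_mult_distrib)
  have [measurable]: "S n \<in> borel_measurable M" for n
    unfolding S_def by measurable
  have incS: "S m \<omega> \<le> S n \<omega>" if "m \<le> n" for m n \<omega>
    unfolding S_def using that by (intro sum_mono2) auto
  define U where "U B = {\<omega> \<in> space M. \<exists>n. real B < S n \<omega>}" for B :: nat
  have U_meas [measurable]: "U B \<in> events" for B
    unfolding U_def by measurable
  \<comment> \<open>The event that the partial sums are unbounded; \<open>Suc\<close> keeps the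
    denominators \<open>real (Suc B)\<close> positive.\<close>
  define V where "V = (\<Inter>B. U (Suc B))"
  have [measurable]: "V \<in> events"
    unfolding V_def by measurable
  have "prob V \<le> 2 * (a * vol)" if a: "0 < a" for a
  proof -
    obtain b where b: "0 \<le> b" "\<And>t. \<psi> t \<le> a + b * t\<^sup>2"
      using psi_le[OF a] by auto
    have tail: "prob {\<omega> \<in> space M. real (Suc B) < S n \<omega>} \<le> 2 * (a * vol + 4 * b * L / real (Suc B))" for n B
    proof -
      have "prob {\<omega> \<in> space M. real (Suc B) < S n \<omega>} \<le> 2 * (a * vol + 2 * (2 * b) * (\<Sum>k<n. 1 * (sqrt (w k))\<^sup>2) / real (Suc B))"
        unfolding S_def
      proof (rule prob_sum_squares_le[where w = "\<lambda>_. 1"])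
        show "1 - (a * vol + 2 * b * (\<Sum>k<n. 1 * (c k)\<^sup>2)) \<le> (LINT \<omega>|M. cos (\<Sum>k<n. c k * X k \<omega>))" for c
        proof -
          have "L2_noise_integral (\<lambda>x. \<Sum>k<n. c k * e k x) (\<lambda>\<omega>. \<Sum>k<n. c k * X k \<omega>)"
            using X by (intro L2_noise_integral_sum) auto
          from expectation_cos_L2_noise_integral_ge[OF this b(2) less_imp_le[OF a] b(1)]
          show ?thesis
            unfolding nrm2_def orthonormal_sum_square[OF e finite_lessThan] by (simp add: mult_ac)
        qed
      qed auto
      also have "\<dots> \<le> 2 * (a * vol + 4 * b * L / real (Suc B))"
        using w L[of n] b(1) by (intro mult_left_mono add_left_mono divide_right_mono) (auto intro: mult_left_mono)
      finally show ?thesis .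
    qed
    have "prob (U (Suc B)) \<le> 2 * (a * vol + 4 * b * L / real (Suc B))" for B
    proof (rule LIMSEQ_le_const2)
      have "U (Suc B) = (\<Union>n. {\<omega> \<in> space M. real (Suc B) < S n \<omega>})"
        by (auto simp: U_def)
      moreover have "(\<lambda>n. prob {\<omega> \<in> space M. real (Suc B) < S n \<omega>}) \<longlonglongrightarrow> prob (\<Union>n. {\<omega> \<in> space M. real (Suc B) < S n \<omega>})"
        using incS by (intro finite_Lim_measure_incseq) (auto simp: incseq_def intro: less_le_trans)
      ultimately show "(\<lambda>n. prob {\<omega> \<in> space M. real (Suc B) < S n \<omega>}) \<longlonglongrightarrow> prob (U (Suc B))"
        by simp
    qed (use tail in blast)
    moreover have "prob V \<le> prob (U (Suc B))" for B
      by (rule finite_measure_mono) (auto simp: V_def)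
    ultimately have le: "prob V \<le> 2 * (a * vol + 4 * b * L / real (Suc B))" for B
      by (rule order_trans[rotated])
    have "(\<lambda>B. 2 * (a * vol + 4 * b * L / real (Suc B))) \<longlonglongrightarrow> 2 * (a * vol + 0)"
      by (intro tendsto_intros LIMSEQ_Suc[OF lim_const_over_n])
    then show ?thesis
      using le by (intro LIMSEQ_le_const[of _ "2 * (a * vol)"]) auto
  qed
  then have small: "prob V \<le> \<epsilon>" if "0 < \<epsilon>" for \<epsilon>
  proof -
    define c where "c = vol + 1"
    have c: "0 < c" "vol \<le> c"
      by (auto simp: c_def intro: add_nonneg_pos)
    then have "prob V \<le> 2 * (\<epsilon> / (2 * c) * vol)"
      using that by (intro \<open>\<And>a. 0 < a \<Longrightarrow> prob V \<le> 2 * (a * vol)\<close>) simp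
    also have "\<dots> = \<epsilon> * (vol / c)"
      by simp
    also have "\<dots> \<le> \<epsilon>"
      using that c by (intro mult_left_le) auto
    finally show ?thesis .
  qed
  have "prob V = 0"
    by (intro antisym[OF field_le_epsilon measure_nonneg]) (use small in simp)
  then have "AE \<omega> in M. \<omega> \<notin> V"
    by (intro AE_not_in) (simp add: null_sets_def emeasure_eq_measure)
  then show ?thesis
    using AE_space
  proof eventually_elim
    case (elim \<omega>)
    then obtain B where "\<omega> \<notin> U (Suc B)"
      by (auto simp: V_def)
    then have "S n \<omega> \<le> real (Suc B)" for n
      using elim by (auto simp: U_def not_less)
    then show ?case
      using w unfolding S by (intro summableI_nonneg_bounded[where x = "real (Suc B)"]) auto
  qed
qed

text \<open>The given integral \<open>Y\<close> may come from any admissible approximation and is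
  first replaced by an L2 version \<open>Z\<close>. The difference of \<open>Z\<close> and a partial
  sum then integrates the L2 remainder of the series, which is small.\<close>

lemma L2_noise_integral_series:
  assumes g: "L2_sums D (\<lambda>k y. c k * e k y) g" and Y: "has_noise_integral M D \<xi> g Y"
    and X: "\<And>k. L2_noise_integral (e k) (X k)"
  shows "conv_in_prob M (\<lambda>n \<omega>. \<Sum>k<n. c k * X k \<omega>) Y"
proof -
  have gL: "g \<in> L2_on D" and lim: "(\<lambda>n. nrm2 (\<lambda>x. g x - (\<Sum>k<n. c k * e k x))) \<longlonglongrightarrow> 0"
    using g by (auto simp: L2_sums_def nrm2_def)
  have [measurable]: "Y \<in> borel_measurable M"
    using Y by (auto simp: has_noise_integral_def conv_in_prob_def)
  note [measurable] = L2_noise_integral_measurable[OF X]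
  obtain Z where Z: "L2_noise_integral g Z"
    using L2_noise_integral_exists[OF gL] by blast
  note [measurable] = L2_noise_integral_measurable[OF Z]
  have YZ: "AE \<omega> in M. Y \<omega> = Z \<omega>"
    by (rule has_noise_integral_eq_L2_noise_integral[OF Y Z])
  have I: "L2_noise_integral (\<lambda>x. 1 * g x + (-1) * (\<Sum>k<n. c k * e k x)) (\<lambda>\<omega>. 1 * Z \<omega> + (-1) * (\<Sum>k<n. c k * X k \<omega>))" for n
    by (intro L2_noise_integral_lincomb L2_noise_integral_sum Z X) auto
  have "conv_in_prob M (\<lambda>n \<omega>. \<Sum>k<n. c k * X k \<omega>) Z"
    unfolding conv_in_prob_iff_l0
  proof (intro conjI allI)
    show "(\<lambda>n. l0 M (\<lambda>\<omega>. (\<Sum>k<n. c k * X k \<omega>) - Z \<omega>)) \<longlonglongrightarrow> 0"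
    proof (rule LIMSEQ_I)
      fix r :: real assume r: "0 < r"
      obtain \<kappa> where \<kappa>: "\<kappa> > 0" "\<And>f Z. L2_noise_integral f Z \<Longrightarrow> nrm2 f \<le> \<kappa> \<Longrightarrow> l0 M Z \<le> r / 2"
        using l0_L2_noise_integral_small[OF half_gt_zero[OF r]] by blast
      from LIMSEQ_D[OF lim \<kappa>(1)] obtain n0 where n0: "\<And>n. n \<ge> n0 \<Longrightarrow> nrm2 (\<lambda>x. g x - (\<Sum>k<n. c k * e k x)) < \<kappa>"
        by (auto simp: nrm2_nonneg)
      have "norm (l0 M (\<lambda>\<omega>. (\<Sum>k<n. c k * X k \<omega>) - Z \<omega>) - 0) < r" if "n \<ge> n0" for n
      proof -
        have "l0 M (\<lambda>\<omega>. 1 * Z \<omega> + (-1) * (\<Sum>k<n. c k * X k \<omega>)) \<le> r / 2"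
          by (rule \<kappa>(2)[OF I]) (use n0[OF that] in simp)
        moreover have "l0 M (\<lambda>\<omega>. 1 * Z \<omega> + (-1) * (\<Sum>k<n. c k * X k \<omega>)) = l0 M (\<lambda>\<omega>. (\<Sum>k<n. c k * X k \<omega>) - Z \<omega>)"
          by (simp add: l0_def abs_minus_commute)
        ultimately show ?thesis
          using r l0_nonneg[of "\<lambda>\<omega>. (\<Sum>k<n. c k * X k \<omega>) - Z \<omega>"] by simp
      qed
      then show "\<exists>n0. \<forall>n\<ge>n0. norm (l0 M (\<lambda>\<omega>. (\<Sum>k<n. c k * X k \<omega>) - Z \<omega>) - 0) < r"
        by blast
    qed
  qed measurable
  then show ?thesis
    by (rule conv_in_prob_cong_AE) (use YZ in auto)
qed

text \<open>The expected truncated differences tend to 0 at each \<open>x\<close>; integrated over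
  \<open>D\<close> by dominated convergence they give L1 convergence on the product space. A
  subsequence converges almost everywhere there, and Fubini distributes the null set over the paths.
  The same \<open>r\<close> serves all paths.\<close>

lemma AE_subsequence_of_conv_in_prob:
  assumes u: "(\<lambda>(\<omega>, x). u x \<omega>) \<in> borel_measurable (M \<Otimes>\<^sub>M leb D)"
    and v: "\<And>n. (\<lambda>(\<omega>, x). v n x \<omega>) \<in> borel_measurable (M \<Otimes>\<^sub>M leb D)"
    and conv: "\<And>x. x \<in> D \<Longrightarrow> conv_in_prob M (\<lambda>n. v n x) (u x)"
  shows "\<exists>r. strict_mono r \<and> (AE \<omega> in M. AE x in leb D. (\<lambda>j. v (r j) x \<omega>) \<longlonglongrightarrow> u x \<omega>)"
proof -
  interpret P: pair_sigma_finite M "leb D" ..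
  interpret PF: finite_measure "M \<Otimes>\<^sub>M leb D"
    by (rule finite_measure_pair_measure) (unfold_locales)
  define d where "d n \<omega> x = min 1 \<bar>v n x \<omega> - u x \<omega>\<bar>" for n \<omega> x
  have d_eq: "(\<lambda>(\<omega>, x). d n \<omega> x) = (\<lambda>p. min 1 \<bar>(case p of (\<omega>, x) \<Rightarrow> v n x \<omega>) - (case p of (\<omega>, x) \<Rightarrow> u x \<omega>)\<bar>)" for n
    by (auto simp: d_def fun_eq_iff)
  have d_meas: "(\<lambda>(\<omega>, x). d n \<omega> x) \<in> borel_measurable (M \<Otimes>\<^sub>M leb D)" for n
    unfolding d_eq using u v[of n] by measurable
  have d_int: "integrable (M \<Otimes>\<^sub>M leb D) (\<lambda>(\<omega>, x). d n \<omega> x)" for n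
    by (rule PF.integrable_const_bound[where B = 1]) (use d_meas in \<open>auto simp: d_def\<close>)
  have fubini: "(LINT p|(M \<Otimes>\<^sub>M leb D). norm ((\<lambda>(\<omega>, x). d n \<omega> x) p)) = (LINT x|leb D. LINT \<omega>|M. d n \<omega> x)" for n
  proof -
    have "(LINT p|(M \<Otimes>\<^sub>M leb D). norm ((\<lambda>(\<omega>, x). d n \<omega> x) p)) = (LINT p|(M \<Otimes>\<^sub>M leb D). (\<lambda>(\<omega>, x). d n \<omega> x) p)"
      by (rule Bochner_Integration.integral_cong) (auto simp: d_def)
    then show ?thesis
      using P.integral_snd[OF d_int[of n]] by simp
  qed
  have "(\<lambda>n. LINT x|leb D. LINT \<omega>|M. d n \<omega> x) \<longlonglongrightarrow> (LINT x|leb D. 0)"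
  proof (rule integral_dominated_convergence[where w = "\<lambda>_. 1"])
    have "(\<lambda>n. LINT \<omega>|M. d n \<omega> x) \<longlonglongrightarrow> 0" if "x \<in> D" for x
      using conv[OF that] by (simp add: conv_in_prob_iff_l0 l0_def d_def)
    then show "AE x in leb D. (\<lambda>n. LINT \<omega>|M. d n \<omega> x) \<longlonglongrightarrow> 0"
      by (intro AE_I2) (simp add: space_leb)
    show "AE x in leb D. norm (LINT \<omega>|M. d n \<omega> x) \<le> 1" for n
    proof (rule AE_I2)
      fix x assume "x \<in> space (leb D)"
      then have m: "(\<lambda>\<omega>. v n x \<omega> - u x \<omega>) \<in> borel_measurable M"
        using conv[of x] by (intro borel_measurable_diff) (auto simp: space_leb conv_in_prob_def)
      have "(LINT \<omega>|M. d n \<omega> x) \<le> (LINT \<omega>|M. 1)"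
        unfolding d_def by (rule integral_mono) (use integrable_min1[OF m] in auto)
      moreover have "0 \<le> (LINT \<omega>|M. d n \<omega> x)"
        unfolding d_def by (rule Bochner_Integration.integral_nonneg) auto
      ultimately show "norm (LINT \<omega>|M. d n \<omega> x) \<le> 1"
        by (simp add: prob_space)
    qed
    show "(\<lambda>x. LINT \<omega>|M. d n \<omega> x) \<in> borel_measurable (leb D)" for n
      using P.integrable_snd[OF d_int[of n]] by auto
  qed auto
  then have "(\<lambda>n. LINT p|(M \<Otimes>\<^sub>M leb D). norm ((\<lambda>(\<omega>, x). d n \<omega> x) p)) \<longlonglongrightarrow> 0"
    by (simp only: fubini Bochner_Integration.integral_zero)
  from tendsto_L1_AE_subseq[OF d_int this]
  obtain r where r: "strict_mono r" and AE: "AE p in M \<Otimes>\<^sub>M leb D. (\<lambda>j. (\<lambda>(\<omega>, x). d (r j) \<omega> x) p) \<longlonglongrightarrow> 0"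
    by blast
  have "AE \<omega> in M. AE x in leb D. (\<lambda>j. d (r j) \<omega> x) \<longlonglongrightarrow> 0"
    using P.AE_pair[OF AE] by simp
  moreover have "(\<lambda>j. v (r j) x \<omega>) \<longlonglongrightarrow> u x \<omega>" if lim: "(\<lambda>j. d (r j) \<omega> x) \<longlonglongrightarrow> 0" for x \<omega>
  proof (rule LIM_zero_cancel, rule Lim_null_comparison[OF _ lim])
    have "\<forall>\<^sub>F j in sequentially. d (r j) \<omega> x < 1"
      using order_tendstoD(2)[OF lim] by simp
    then show "\<forall>\<^sub>F j in sequentially. norm (v (r j) x \<omega> - u x \<omega>) \<le> d (r j) \<omega> x"
      by eventually_elim (auto simp: d_def min_def split: if_splits)
  qed
  ultimately have "AE \<omega> in M. AE x in leb D. (\<lambda>j. v (r j) x \<omega>) \<longlonglongrightarrow> u x \<omega>"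
    by (auto elim!: eventually_mono)
  with r show ?thesis
    by blast
qed

end

section \<open>Square-summable expansions\<close>

text \<open>Cauchy-Schwarz against a unit vector, from expanding the squared norm of
  \<open>g - s h\<close> with \<open>s\<close> the inner product.\<close>

lemma L2_inner_unit_square_le:
  assumes g: "g \<in> L2_on D" and h: "h \<in> L2_on D" "(LINT x|leb D. (h x)\<^sup>2) = 1"
  shows "(LINT x|leb D. g x * h x)\<^sup>2 \<le> (LINT x|leb D. (g x)\<^sup>2)"
proof -
  define s where "s = (LINT x|leb D. g x * h x)"
  have i: "integrable (leb D) (\<lambda>x. (g x)\<^sup>2)" "integrable (leb D) (\<lambda>x. (h x)\<^sup>2)" "integrable (leb D) (\<lambda>x. g x * h x)"
    using g h L2_on_mult_integrable[OF g h(1)] by (auto simp: L2_on_def)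
  have "0 \<le> (LINT x|leb D. (g x - s * h x)\<^sup>2)"
    by simp
  also have "(\<lambda>x. (g x - s * h x)\<^sup>2) = (\<lambda>x. ((g x)\<^sup>2 - (2 * s) * (g x * h x)) + s\<^sup>2 * (h x)\<^sup>2)"
    by (auto simp: power2_eq_square algebra_simps fun_eq_iff)
  also have "(LINT x|leb D. ((g x)\<^sup>2 - (2 * s) * (g x * h x)) + s\<^sup>2 * (h x)\<^sup>2) = (LINT x|leb D. (g x)\<^sup>2) - 2 * s * s + s\<^sup>2 * 1"
    using i by (simp add: h(2) s_def)
  finally show ?thesis
    unfolding s_def[symmetric] by (simp add: power2_eq_square)
qed

text \<open>Fatou along \<open>r\<close> bounds the squared distance from \<open>f\<close> to every
  partial sum by the tail \<open>\<tau> n\<close> of the squared coefficients. So \<open>f\<close>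
  is in L2, and its \<open>k\<close>-th coefficient differs from \<open>a k\<close>, that of any
  partial sum reaching beyond \<open>k\<close>, by at most the root of the tail.\<close>

lemma AE_limit_of_orthonormal_sums:
  assumes e: "orthonormal_basis_L2 D e" and a: "summable (\<lambda>k. (a k)\<^sup>2)"
    and f [measurable]: "f \<in> borel_measurable (leb D)" and r: "strict_mono r"
    and lim: "AE x in leb D. (\<lambda>j. \<Sum>k<r j. a k * e k x) \<longlonglongrightarrow> f x"
  shows "f \<in> L2_on D" and "L2_inner D f (e k) = a k"
proof -
  have eL: "e k \<in> L2_on D" and on: "(LINT x|leb D. e j x * e k x) = (if j = k then 1 else 0)" for j k
    using e by (auto simp: orthonormal_basis_L2_def L2_inner_def)
  have [measurable]: "e k \<in> borel_measurable (leb D)" for k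
    using eL[of k] by (simp add: L2_on_def)
  define S where "S n x = (\<Sum>k<n. a k * e k x)" for n x
  have SL: "S n \<in> L2_on D" for n
    unfolding S_def by (intro L2_on_sum L2_on_cmult eL)
  have [measurable]: "S n \<in> borel_measurable (leb D)" for n
    unfolding S_def by measurable
  define \<tau> where "\<tau> n = (\<Sum>k. (a (k + n))\<^sup>2)" for n
  have \<tau>: "\<tau> \<longlonglongrightarrow> 0"
    unfolding \<tau>_def by (rule suminf_exist_split2[OF a])
  have a_shift: "summable (\<lambda>k. (a (k + n))\<^sup>2)" for n
    using a summable_iff_shift[of "\<lambda>k. (a k)\<^sup>2" n] by simp
  have fatou: "(\<integral>\<^sup>+x. ennreal ((f x - S n x)\<^sup>2) \<partial>leb D) \<le> ennreal (\<tau> n)" for n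
  proof -
    have "(\<integral>\<^sup>+x. ennreal ((f x - S n x)\<^sup>2) \<partial>leb D) = (\<integral>\<^sup>+x. liminf (\<lambda>j. ennreal ((S (r j) x - S n x)\<^sup>2)) \<partial>leb D)"
    proof (rule nn_integral_cong_AE)
      show "AE x in leb D. ennreal ((f x - S n x)\<^sup>2) = liminf (\<lambda>j. ennreal ((S (r j) x - S n x)\<^sup>2))"
        using lim
      proof eventually_elim
        case (elim x)
        have "(\<lambda>j. ennreal ((S (r j) x - S n x)\<^sup>2)) \<longlonglongrightarrow> ennreal ((f x - S n x)\<^sup>2)"
          using elim unfolding S_def by (intro tendsto_intros)
        then show ?case
          by (rule lim_imp_Liminf[OF sequentially_bot, symmetric])
      qed
    qed
    also have "\<dots> \<le> liminf (\<lambda>j. \<integral>\<^sup>+x. ennreal ((S (r j) x - S n x)\<^sup>2) \<partial>leb D)"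
      by (rule nn_integral_liminf) measurable
    also have "\<dots> \<le> ennreal (\<tau> n)"
    proof (rule Liminf_le)
      show "\<forall>\<^sub>F j in sequentially. (\<integral>\<^sup>+x. ennreal ((S (r j) x - S n x)\<^sup>2) \<partial>leb D) \<le> ennreal (\<tau> n)"
        using eventually_ge_at_top[of n]
      proof eventually_elim
        case (elim j)
        then have nj: "n \<le> r j"
          using seq_suble[OF r, of j] by simp
        have diff: "S (r j) x - S n x = (\<Sum>k\<in>{n..<r j}. a k * e k x)" for x
          unfolding S_def using nj sum.atLeastLessThan_concat[of 0 n "r j" "\<lambda>k. a k * e k x"]
          by (simp add: atLeast0LessThan)
        have "(\<integral>\<^sup>+x. ennreal ((S (r j) x - S n x)\<^sup>2) \<partial>leb D) = ennreal (LINT x|leb D. (S (r j) x - S n x)\<^sup>2)"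
          using L2_on_diff[OF SL SL, of "r j" n] by (intro nn_integral_eq_integral) (auto simp: L2_on_def)
        also have "(LINT x|leb D. (S (r j) x - S n x)\<^sup>2) = (\<Sum>k\<in>{n..<r j}. (a k)\<^sup>2)"
          unfolding diff by (rule orthonormal_sum_square[OF e]) simp
        also have "\<dots> = (\<Sum>k<r j - n. (a (k + n))\<^sup>2)"
          using nj sum.shift_bounds_nat_ivl[of "\<lambda>k. (a k)\<^sup>2" 0 n "r j - n"] by (simp add: atLeast0LessThan)
        also have "\<dots> \<le> \<tau> n"
          unfolding \<tau>_def by (intro sum_le_suminf a_shift) auto
        finally show ?case
          by (simp add: ennreal_leI)
      qed
    qed simp
    finally show ?thesis .
  qed
  have dL: "(\<lambda>x. f x - S n x) \<in> L2_on D" for n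
    unfolding L2_on_def using fatou[of n]
    by (auto intro!: integrableI_bounded simp: le_less_trans[OF _ ennreal_less_top])
  have fL: "f \<in> L2_on D"
    using L2_on_add[OF dL[of 0] SL[of 0]] by simp
  then show "f \<in> L2_on D" .
  have dle: "(LINT x|leb D. (f x - S n x)\<^sup>2) \<le> \<tau> n" for n
  proof -
    have "ennreal (LINT x|leb D. (f x - S n x)\<^sup>2) \<le> ennreal (\<tau> n)"
      using fatou[of n] nn_integral_eq_integral[of "leb D" "\<lambda>x. (f x - S n x)\<^sup>2"] dL[of n] by (simp add: L2_on_def)
    moreover have "0 \<le> \<tau> n"
      unfolding \<tau>_def by (intro suminf_nonneg a_shift) auto
    ultimately show ?thesis
      by simp
  qed
  have sq: "(L2_inner D f (e k) - a k)\<^sup>2 \<le> \<tau> n" if "n > k" for n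
  proof -
    have "(LINT x|leb D. S n x * e k x) = (LINT x|leb D. (\<Sum>j<n. a j * (e j x * e k x)))"
      by (simp add: S_def sum_distrib_right mult.assoc)
    also have "\<dots> = (\<Sum>j<n. a j * (if j = k then 1 else 0))"
      using L2_on_mult_integrable[OF eL eL] by (simp add: on)
    also have "\<dots> = a k"
      using that by (simp add: if_distrib cong: if_cong)
    finally have "L2_inner D f (e k) - a k = (LINT x|leb D. f x * e k x) - (LINT x|leb D. S n x * e k x)"
      by (simp add: L2_inner_def)
    also have "\<dots> = (LINT x|leb D. (f x - S n x) * e k x)"
      using L2_on_mult_integrable[OF fL eL] L2_on_mult_integrable[OF SL eL] by (simp add: left_diff_distrib)
    finally show ?thesis
      using L2_inner_unit_square_le[OF dL[of n] eL[of k]] on[of k k] dle[of n] by (simp add: power2_eq_square)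
  qed
  have "(L2_inner D f (e k) - a k)\<^sup>2 \<le> 0"
    by (rule LIMSEQ_le_const[OF \<tau>]) (use sq in \<open>auto intro!: exI[of _ "Suc k"]\<close>)
  then show "L2_inner D f (e k) = a k"
    by simp
qed

text \<open>Cauchy-Schwarz splits each block of the series between coefficients and functions by
  means of \<open>w\<close>; the coefficient part is a Cauchy tail that does not depend on
  \<open>x\<close>.\<close>

lemma uniformly_convergent_weighted_series:
  fixes f :: "nat \<Rightarrow> 'a \<Rightarrow> real"
  assumes w: "\<And>k. 0 < w k" and a: "summable (\<lambda>k. (a k)\<^sup>2 / w k)"
    and B: "\<And>n x. x \<in> S \<Longrightarrow> (\<Sum>k<n. w k * (f k x)\<^sup>2) \<le> B"
  shows "uniformly_convergent_on S (\<lambda>n x. \<Sum>k<n. a k * f k x)"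
proof (cases "S = {}")
  case False
  then have B0: "0 \<le> B"
    using B[of _ 0] by auto
  have "uniformly_Cauchy_on S (\<lambda>n x. \<Sum>k<n. a k * f k x)"
  proof (rule uniformly_Cauchy_onI')
    fix \<epsilon> :: real assume \<epsilon>: "0 < \<epsilon>"
    \<comment> \<open>\<open>B + 1\<close> instead of \<open>B\<close> covers \<open>B = 0\<close>
      and makes the final inequality strict.\<close>
    define \<delta> where "\<delta> = \<epsilon>\<^sup>2 / (B + 1)"
    have \<delta>: "0 < \<delta>"
      using \<epsilon> B0 by (simp add: \<delta>_def)
    obtain N where N: "\<And>m n. m \<ge> N \<Longrightarrow> norm (\<Sum>k=m..<n. (a k)\<^sup>2 / w k) < \<delta>"
      using a \<delta> unfolding summable_Cauchy by blast
    have "dist (\<Sum>k<m. a k * f k x) (\<Sum>k<n. a k * f k x) < \<epsilon>" if "x \<in> S" "m \<ge> N" "n > m" for x m n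
    proof -
      have "dist (\<Sum>k<m. a k * f k x) (\<Sum>k<n. a k * f k x) = \<bar>\<Sum>k=m..<n. a k * f k x\<bar>"
        using that(3) sum.atLeastLessThan_concat[of 0 m n "\<lambda>k. a k * f k x"]
        by (simp add: atLeast0LessThan dist_real_def)
      moreover have "(\<Sum>k=m..<n. a k * f k x)\<^sup>2 < \<epsilon>\<^sup>2"
      proof -
        have "(\<Sum>k=m..<n. a k * f k x)\<^sup>2 = (\<Sum>k=m..<n. (a k / sqrt (w k)) * (sqrt (w k) * f k x))\<^sup>2"
          using w by (simp add: less_imp_neq[symmetric])
        also have "\<dots> \<le> (\<Sum>k=m..<n. (a k / sqrt (w k))\<^sup>2) * (\<Sum>k=m..<n. (sqrt (w k) * f k x)\<^sup>2)"
          by (rule Cauchy_Schwarz_ineq_sum)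
        also have "\<dots> = (\<Sum>k=m..<n. (a k)\<^sup>2 / w k) * (\<Sum>k=m..<n. w k * (f k x)\<^sup>2)"
          using w by (simp add: power_divide power_mult_distrib less_imp_le)
        also have "\<dots> \<le> \<delta> * B"
        proof (rule mult_mono)
          show "(\<Sum>k=m..<n. (a k)\<^sup>2 / w k) \<le> \<delta>"
            using N[OF that(2), of n] by simp
          have "(\<Sum>k=m..<n. w k * (f k x)\<^sup>2) \<le> (\<Sum>k<n. w k * (f k x)\<^sup>2)"
            using w by (intro sum_mono2) (auto simp: less_imp_le)
          also have "\<dots> \<le> B"
            by (rule B[OF that(1)])
          finally show "(\<Sum>k=m..<n. w k * (f k x)\<^sup>2) \<le> B" .
        qed (use \<delta> w in \<open>auto intro!: sum_nonneg simp: less_imp_le\<close>)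
        also have "\<dots> < \<delta> * (B + 1)"
          using \<delta> by simp
        also have "\<dots> = \<epsilon>\<^sup>2"
          using B0 by (simp add: \<delta>_def)
        finally show ?thesis .
      qed
      ultimately show ?thesis
        using \<epsilon> power2_less_imp_less[of "\<bar>\<Sum>k=m..<n. a k * f k x\<bar>" \<epsilon>] by simp
    qed
    then show "\<exists>N. \<forall>x\<in>S. \<forall>m\<ge>N. \<forall>n>m. dist (\<Sum>k<m. a k * f k x) (\<Sum>k<n. a k * f k x) < \<epsilon>"
      by blast
  qed
  then show ?thesis
    by (rule Cauchy_uniformly_convergent)
qed (simp add: uniformly_convergent_on_def)

section \<open>Symmetric Levy noise\<close>

lemma symmetric_levy_measure_integrable_min:
  assumes "symmetric_levy_measure \<nu>"
  shows "integrable \<nu> (\<lambda>z. min (z\<^sup>2) 1)" and "\<And>f. f \<in> borel_measurable borel \<Longrightarrow> f \<in> borel_measurable \<nu>"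
proof -
  have sets: "sets \<nu> = sets (restrict_space borel (UNIV - {0}))"
    and fin: "(\<integral>\<^sup>+z. ennreal (min (z\<^sup>2) 1) \<partial>\<nu>) < \<infinity>"
    using assms by (auto simp: symmetric_levy_measure_def)
  show m: "f \<in> borel_measurable \<nu>" if "f \<in> borel_measurable borel" for f :: "real \<Rightarrow> 'b::topological_space"
    using measurable_restrict_space1[OF that] by (simp add: measurable_cong_sets[OF sets refl])
  show "integrable \<nu> (\<lambda>z. min (z\<^sup>2) 1)"
  proof (rule integrableI_nonneg)
    show "(\<lambda>z. min (z\<^sup>2) 1) \<in> borel_measurable \<nu>"
      by (rule m) measurable
  qed (use fin in auto)
qed

text \<open>The sets of \<nu> are the Borel sets avoiding 0, a class closed under reflection, so the
  symmetry condition says that \<nu> is its own image under \<open>uminus\<close>.\<close>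

lemma symmetric_levy_measure_integral_uminus:
  fixes f :: "real \<Rightarrow> complex"
  assumes \<nu>: "symmetric_levy_measure \<nu>" and f: "f \<in> borel_measurable borel"
  shows "(LINT z|\<nu>. f (- z)) = (LINT z|\<nu>. f z)"
proof -
  have sets: "sets \<nu> = sets (restrict_space borel (UNIV - {0}))"
    and sym: "\<And>A. A \<in> sets \<nu> \<Longrightarrow> emeasure \<nu> A = emeasure \<nu> (uminus ` A)"
    using \<nu> by (auto simp: symmetric_levy_measure_def)
  have space: "space \<nu> = UNIV - {0}"
    using sets_eq_imp_space_eq[OF sets] by (simp add: space_restrict_space)
  have um: "uminus \<in> measurable \<nu> \<nu>"
  proof -
    have "uminus \<in> measurable \<nu> (restrict_space borel (UNIV - {0 :: real}))"
      by (rule measurable_restrict_space2)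
        (use symmetric_levy_measure_integrable_min(2)[OF \<nu>, of uminus] space in auto)
    then show ?thesis
      by (simp add: measurable_cong_sets[OF refl sets])
  qed
  have "distr \<nu> \<nu> uminus = \<nu>"
  proof (rule measure_eqI)
    fix A assume A: "A \<in> sets (distr \<nu> \<nu> uminus)"
    then have "A \<subseteq> UNIV - {0}"
      using sets.sets_into_space[of A \<nu>] space by simp
    have "x \<in> uminus ` A \<longleftrightarrow> - x \<in> A" for x
      by (metis image_iff minus_minus)
    with \<open>A \<subseteq> UNIV - {0}\<close> have "uminus -` A \<inter> space \<nu> = uminus ` A"
      unfolding space by (intro set_eqI) auto
    then show "emeasure (distr \<nu> \<nu> uminus) A = emeasure \<nu> A"
      using A sym um by (simp add: emeasure_distr)
  qed simp
  then have "(LINT z|\<nu>. f z) = (LINT z|distr \<nu> \<nu> uminus. f z)"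
    by simp
  also have "\<dots> = (LINT z|\<nu>. f (- z))"
    by (rule integral_distr[OF um]) (rule symmetric_levy_measure_integrable_min(2)[OF \<nu> f])
  finally show ?thesis
    by simp
qed

text \<open>Small jumps use the Taylor remainder of second order, large jumps the trivial bound 2
  with the compensator switched off.\<close>

lemma levy_exponent_integrand_bound:
  "cmod (iexp (t * z) - 1 - \<i> * complex_of_real (t * z * indicator {-1..1} z)) \<le> (t\<^sup>2 + 2) * min (z\<^sup>2) 1"
proof (cases "\<bar>z\<bar> \<le> 1")
  case True
  then have z2: "z\<^sup>2 \<le> 1"
    by (simp add: abs_square_le_1)
  have "cmod (iexp (t * z) - 1 - \<i> * complex_of_real (t * z)) \<le> \<bar>t * z\<bar> ^ 2 / 2"
    using iexp_approx1[of "t * z" 1] by (simp add: numeral_2_eq_2 diff_diff_eq)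
  also have "\<dots> = t\<^sup>2 * z\<^sup>2 / 2"
    by (simp add: power_mult_distrib)
  also have "\<dots> \<le> (t\<^sup>2 + 2) * z\<^sup>2"
    using zero_le_power2[of z] mult_nonneg_nonneg[OF zero_le_power2[of t] zero_le_power2[of z]]
    by (simp add: algebra_simps)
  finally show ?thesis
    using True z2 by (simp add: min_def indicator_def abs_le_iff)
next
  case False
  then have "1 \<le> z\<^sup>2"
    using one_le_power[of "\<bar>z\<bar>" 2] by simp
  moreover have "cmod (iexp (t * z) - 1) \<le> 2"
    using norm_triangle_ineq4[of "iexp (t * z)" 1] by simp
  moreover have "indicator {-1..1} z = (0::real)"
    using False by (auto simp: indicator_def)
  ultimately show ?thesis
    by (simp add: min_def add_increasing)
qed

text \<open>Reflection turns the integrand into its complex conjugate, so by symmetry the integral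
  is real; taking real parts removes the compensator, which is purely imaginary.\<close>

lemma symmetric_levy_exponent:
  assumes \<nu>: "symmetric_levy_measure \<nu>"
  shows "(LINT z|\<nu>. iexp (t * z) - 1 - \<i> * complex_of_real (t * z * indicator {-1..1} z))
      = - complex_of_real (LINT z|\<nu>. 1 - cos (t * z))" (is "?Q = _")
proof -
  define q where "q z = iexp (t * z) - 1 - \<i> * complex_of_real (t * z * indicator {-1..1} z)" for z
  have qm: "q \<in> borel_measurable borel"
    unfolding q_def by measurable
  have int: "integrable \<nu> q"
  proof (rule Bochner_Integration.integrable_bound)
    show "integrable \<nu> (\<lambda>z. (t\<^sup>2 + 2) * min (z\<^sup>2) 1)"
      by (intro integrable_mult_right symmetric_levy_measure_integrable_min \<nu>)
    show "AE z in \<nu>. norm (q z) \<le> norm ((t\<^sup>2 + 2) * min (z\<^sup>2) 1)"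
      unfolding q_def using order_trans[OF levy_exponent_integrand_bound abs_ge_self] by (intro AE_I2) simp
  qed (rule symmetric_levy_measure_integrable_min(2)[OF \<nu> qm])
  have q_uminus: "q (- z) = cnj (q z)" for z
    by (auto simp: q_def exp_cnj indicator_def)
  have "cnj ?Q = (LINT z|\<nu>. q (- z))"
    by (simp only: q_uminus Bochner_Integration.integral_cnj) (simp only: q_def)
  also have "\<dots> = ?Q"
    using symmetric_levy_measure_integral_uminus[OF \<nu> qm] by (simp add: q_def)
  finally have "Im ?Q = 0"
    by (simp add: complex_eq_iff)
  moreover have "Re ?Q = (LINT z|\<nu>. Re (q z))"
    by (simp only: integral_Re[OF int]) (simp only: q_def[abs_def])
  moreover have "(LINT z|\<nu>. Re (q z)) = (LINT z|\<nu>. - (1 - cos (t * z)))"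
    by (rule Bochner_Integration.integral_cong) (auto simp: q_def Re_exp)
  ultimately show ?thesis
    by (simp only: Bochner_Integration.integral_minus complex_eq_iff) simp
qed

text \<open>Jumps larger than \<open>n\<close> contribute at most twice their mass, which for large
  \<open>n\<close> is less than \<open>a\<close>. For the others
  \<open>1 - cos (t z) <= t^2 z^2\<close> and \<open>z^2 <= n^2 * min (z^2) 1\<close>.\<close>

lemma symmetric_levy_exponent_le:
  assumes \<nu>: "symmetric_levy_measure \<nu>" and a: "0 < a"
  shows "\<exists>b\<ge>0. \<forall>t. (LINT z|\<nu>. 1 - cos (t * z)) \<le> a + b * t\<^sup>2"
proof -
  note meas = symmetric_levy_measure_integrable_min(2)[OF \<nu>]
  note intm = symmetric_levy_measure_integrable_min(1)[OF \<nu>]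
  define m where "m = (LINT z|\<nu>. min (z\<^sup>2) 1)"
  have "0 \<le> m"
    unfolding m_def by (rule Bochner_Integration.integral_nonneg) auto
  have "(\<lambda>n. LINT z|\<nu>. 2 * indicator {z. real n < \<bar>z\<bar>} z * min (z\<^sup>2) 1) \<longlonglongrightarrow> (LINT z|\<nu>. 0)"
  proof (rule integral_dominated_convergence[where w = "\<lambda>z. 2 * min (z\<^sup>2) 1"])
    show "AE z in \<nu>. (\<lambda>n. 2 * indicator {z. real n < \<bar>z\<bar>} z * min (z\<^sup>2) 1) \<longlonglongrightarrow> 0"
    proof (rule AE_I2)
      fix z :: real
      have "\<forall>\<^sub>F n in sequentially. 2 * indicator {z. real n < \<bar>z\<bar>} z * min (z\<^sup>2) 1 = (0::real)"
        using eventually_ge_at_top[of "nat \<lceil>\<bar>z\<bar>\<rceil>"]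
      proof eventually_elim
        case (elim n)
        then have "\<bar>z\<bar> \<le> real n"
          by linarith
        then show ?case
          by simp
      qed
      then show "(\<lambda>n. 2 * indicator {z. real n < \<bar>z\<bar>} z * min (z\<^sup>2) 1) \<longlonglongrightarrow> (0::real)"
        by (rule tendsto_eventually)
    qed
    show "AE z in \<nu>. norm (2 * indicator {z. real n < \<bar>z\<bar>} z * min (z\<^sup>2) 1) \<le> 2 * min (z\<^sup>2) 1" for n
      by (intro AE_I2) (auto split: split_indicator)
    show "(\<lambda>z. 2 * indicator {z. real n < \<bar>z\<bar>} z * min (z\<^sup>2) 1) \<in> borel_measurable \<nu>" for n
      by (rule meas) measurable
  qed (use intm in auto)
  then have "\<forall>\<^sub>F n in sequentially. (LINT z|\<nu>. 2 * indicator {z. real n < \<bar>z\<bar>} z * min (z\<^sup>2) 1) < a"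
    using a by (intro order_tendstoD(2)) auto
  \<comment> \<open>With \<open>1 <= n\<close> the factor \<open>min (z^2) 1\<close> is 1 on the
    large jumps, and \<open>z^2 <= n^2 * min (z^2) 1\<close> holds on the remaining ones.\<close>
  then have "\<forall>\<^sub>F n in sequentially. (LINT z|\<nu>. 2 * indicator {z. real n < \<bar>z\<bar>} z * min (z\<^sup>2) 1) < a \<and> 1 \<le> n"
    using eventually_ge_at_top[of 1] by eventually_elim auto
  then obtain n where n: "(LINT z|\<nu>. 2 * indicator {z. real n < \<bar>z\<bar>} z * min (z\<^sup>2) 1) < a" "1 \<le> n"
    by (auto simp: eventually_sequentially)
  have int1: "integrable \<nu> (\<lambda>z. 2 * indicator {z. real n < \<bar>z\<bar>} z * min (z\<^sup>2) 1)"
  proof (rule Bochner_Integration.integrable_bound)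
    show "integrable \<nu> (\<lambda>z. 2 * min (z\<^sup>2) 1)"
      using intm by simp
    show "(\<lambda>z. 2 * indicator {z. real n < \<bar>z\<bar>} z * min (z\<^sup>2) 1) \<in> borel_measurable \<nu>"
      by (rule meas) measurable
  qed (auto intro!: AE_I2 split: split_indicator)
  have le: "1 - cos (t * z) \<le> 2 * indicator {z. real n < \<bar>z\<bar>} z * min (z\<^sup>2) 1 + (real n)\<^sup>2 * t\<^sup>2 * min (z\<^sup>2) 1" for t z
  proof (cases "real n < \<bar>z\<bar>")
    case True
    then have "1 \<le> z\<^sup>2"
      using n(2) one_le_power[of "\<bar>z\<bar>" 2] by simp
    then show ?thesis
      using True cos_ge_minus_one[of "t * z"] by (simp add: min_def add_increasing2)
  next
    case False
    have "1 - cos (t * z) = 2 * (sin (t * z / 2))\<^sup>2"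
      using cos_double_sin[of "t * z / 2"] by simp
    also have "\<dots> \<le> 2 * \<bar>t * z / 2\<bar>\<^sup>2"
      using abs_sin_x_le_abs_x[of "t * z / 2"] by (subst power2_abs[symmetric]) (intro mult_left_mono power_mono, auto)
    also have "\<dots> \<le> t\<^sup>2 * z\<^sup>2"
      by (simp add: power_mult_distrib power_divide)
    also have "t\<^sup>2 * z\<^sup>2 \<le> t\<^sup>2 * ((real n)\<^sup>2 * min (z\<^sup>2) 1)"
    proof (rule mult_left_mono)
      show "z\<^sup>2 \<le> (real n)\<^sup>2 * min (z\<^sup>2) 1"
      proof (cases "z\<^sup>2 \<le> 1")
        case True
        then show ?thesis
          using n(2) one_le_power[of "real n" 2] by (simp add: min_def mult_le_cancel_right1)
      next
        case False': False
        have "\<bar>z\<bar>\<^sup>2 \<le> (real n)\<^sup>2"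
          using False by (intro power_mono) auto
        then show ?thesis
          using False' by (simp add: min_def)
      qed
    qed simp
    finally show ?thesis
      using False by (simp add: mult_ac)
  qed
  have "(LINT z|\<nu>. 1 - cos (t * z)) \<le> a + (real n)\<^sup>2 * m * t\<^sup>2" for t
  proof -
    have "(LINT z|\<nu>. 1 - cos (t * z)) \<le> (LINT z|\<nu>. 2 * indicator {z. real n < \<bar>z\<bar>} z * min (z\<^sup>2) 1 + (real n)\<^sup>2 * t\<^sup>2 * min (z\<^sup>2) 1)"
    proof (rule integral_mono[OF _ _ le])
      show int2: "integrable \<nu> (\<lambda>z. 2 * indicator {z. real n < \<bar>z\<bar>} z * min (z\<^sup>2) 1 + (real n)\<^sup>2 * t\<^sup>2 * min (z\<^sup>2) 1)"
        using int1 intm by simp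
      show "integrable \<nu> (\<lambda>z. 1 - cos (t * z))"
      proof (rule Bochner_Integration.integrable_bound[OF int2])
        show "(\<lambda>z. 1 - cos (t * z)) \<in> borel_measurable \<nu>"
          by (rule meas) measurable
        show "AE z in \<nu>. norm (1 - cos (t * z)) \<le> norm (2 * indicator {z. real n < \<bar>z\<bar>} z * min (z\<^sup>2) 1 + (real n)\<^sup>2 * t\<^sup>2 * min (z\<^sup>2) 1)"
          using order_trans[OF le abs_ge_self] by (intro AE_I2) simp
      qed
    qed
    also have "\<dots> \<le> a + (real n)\<^sup>2 * m * t\<^sup>2"
      using n(1) int1 intm by (simp add: m_def mult_ac)
    finally show ?thesis .
  qed
  then show ?thesis
    using \<open>0 \<le> m\<close> by (intro exI[of _ "(real n)\<^sup>2 * m"]) auto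
qed

lemma symmetric_levy_noise_imp_noise_space:
  assumes "prob_space M" "D \<in> sets borel" "emeasure lborel D < \<infinity>" and \<xi>: "symmetric_levy_noise M D \<nu> \<xi>"
  shows "noise_space M D \<xi> (\<lambda>t. LINT z|\<nu>. 1 - cos (t * z))"
proof -
  have \<nu>: "symmetric_levy_measure \<nu>"
    using \<xi> by (simp add: symmetric_levy_noise_def)
  interpret prob_space M
    by fact
  show ?thesis
  proof unfold_locales
    show "independently_scattered M D \<xi>"
      using \<xi> by (simp add: symmetric_levy_noise_def)
    show "(LINT \<omega>|M. iexp (t * \<xi> A \<omega>)) = exp (- complex_of_real (measure lborel A * (LINT z|\<nu>. 1 - cos (t * z))))"
      if "A \<in> sets (leb D)" for A t
    proof -
      have "(LINT \<omega>|M. iexp (t * \<xi> A \<omega>)) = exp (complex_of_real (measure lborel A) *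
          (LINT z|\<nu>. iexp (t * z) - 1 - \<i> * complex_of_real (t * z * indicator {-1..1} z)))"
        using \<xi> that unfolding symmetric_levy_noise_def by blast
      then show ?thesis
        unfolding symmetric_levy_exponent[OF \<nu>] by simp
    qed
    show "0 \<le> (LINT z|\<nu>. 1 - cos (t * z))" for t
      by (rule Bochner_Integration.integral_nonneg) simp
    show "\<exists>b\<ge>0. \<forall>t. (LINT z|\<nu>. 1 - cos (t * z)) \<le> a + b * t\<^sup>2" if "0 < a" for a
      by (rule symmetric_levy_exponent_le[OF \<nu> that])
  qed (use assms in auto)
qed

theorem theorem4p1:
  fixes M :: "'w measure" and D :: "'a::euclidean_space set" and \<nu> :: "real measure"
    and lam :: "nat \<Rightarrow> real" and e :: "nat \<Rightarrow> 'a \<Rightarrow> real" and \<gamma> :: real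
    and \<xi> :: "'a set \<Rightarrow> 'w \<Rightarrow> real" and u :: "'a \<Rightarrow> 'w \<Rightarrow> real"
  assumes "prob_space M" and "complete_measure M"
    and "smooth_bounded_domain D"
    and "dirichlet_spectral_basis D lam e"
    and "real DIM('a) / 4 < \<gamma>"
    and "symmetric_levy_noise M D \<nu> \<xi>"
    and "mild_solution M D lam e \<gamma> \<xi> u"
  shows "(\<forall>r < 2 * \<gamma> - real DIM('a) / 2. AE \<omega> in M. in_H_space D lam e r (\<lambda>x. u x \<omega>)) \<and>
         (real DIM('a) / 2 < \<gamma> \<longrightarrow> (\<exists>v. continuous_modification_on_closure M D u v))"
proof -
  have D: "open D" "bounded D" "D \<noteq> {}"
    using assms(3) by (auto simp: smooth_bounded_domain_def)
  interpret noise_space M D \<xi> "\<lambda>t. LINT z|\<nu>. 1 - cos (t * z)"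
    using D emeasure_bounded_finite[OF D(2)] assms(1,6)
    by (intro symmetric_levy_noise_imp_noise_space) auto
  note basis = assms(4)
  have on: "orthonormal_basis_L2 D e" and lam: "0 < lam k" for k
    using basis by (auto simp: dirichlet_spectral_basis_def)
  have eL: "e k \<in> L2_on D" for k
    using on by (auto simp: orthonormal_basis_L2_def)
  have [measurable]: "e k \<in> borel_measurable (leb D)" for k
    using eL[of k] by (simp add: L2_on_def)
  obtain X where X: "\<And>k. L2_noise_integral (e k) (X k)"
    using L2_noise_integral_exists[OF eL] by metis
  note X_meas [measurable] = L2_noise_integral_measurable[OF X]
  define a where "a k \<omega> = lam k powr (- \<gamma>) * X k \<omega>" for k \<omega>
  have a_meas [measurable]: "a k \<in> borel_measurable M" for k
    unfolding a_def by measurable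
  define v where "v n x \<omega> = (\<Sum>k<n. a k \<omega> * e k x)" for n x \<omega>
  have u_meas: "(\<lambda>(\<omega>, x). u x \<omega>) \<in> borel_measurable (M \<Otimes>\<^sub>M leb D)"
    using assms(7) by (simp add: mild_solution_def)
  have v_meas: "(\<lambda>(\<omega>, x). v n x \<omega>) \<in> borel_measurable (M \<Otimes>\<^sub>M leb D)" for n
    unfolding v_def by measurable
  have conv: "conv_in_prob M (\<lambda>n. v n x) (u x)" if "x \<in> D" for x
  proof -
    have "\<forall>x\<in>D. \<exists>g. green_section D lam e \<gamma> x g \<and> has_noise_integral M D \<xi> g (u x)"
      using assms(7) unfolding mild_solution_def by (rule conjunct2)
    then obtain g where g: "green_section D lam e \<gamma> x g" "has_noise_integral M D \<xi> g (u x)"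
      using \<open>x \<in> D\<close> by fast
    \<comment> \<open>For fixed \<open>x\<close> the factor \<open>e k x\<close> belongs to the
      coefficient, which leaves an expansion in the functions \<open>e k\<close> with integrals
      \<open>X k\<close>.\<close>
    have "L2_sums D (\<lambda>k y. (lam k powr (- \<gamma>) * e k x) * e k y) g"
      using g(1) by (simp add: green_section_def)
    from L2_noise_integral_series[OF this g(2) X]
    have "conv_in_prob M (\<lambda>n \<omega>. \<Sum>k<n. (lam k powr (- \<gamma>) * e k x) * X k \<omega>) (u x)" .
    then show ?thesis
      by (simp add: v_def[abs_def] a_def mult_ac)
  qed
  have sum_X: "AE \<omega> in M. summable (\<lambda>k. lam k powr (- s) * (X k \<omega>)\<^sup>2)" if "real DIM('a) / 2 < s" for s
    using summable_dirichlet_eigenvalues_powr[OF D basis that]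
    by (intro AE_summable_noise_coefficients[OF on X]) auto
  have a2: "(a k \<omega>)\<^sup>2 = lam k powr (- (2 * \<gamma>)) * (X k \<omega>)\<^sup>2" for k \<omega>
    using lam[of k] by (simp add: a_def power_mult_distrib powr_power mult.commute)
  obtain r where r: "strict_mono r" and AE_lim: "AE \<omega> in M. AE x in leb D. (\<lambda>j. v (r j) x \<omega>) \<longlonglongrightarrow> u x \<omega>"
    using AE_subsequence_of_conv_in_prob[OF u_meas v_meas conv] by blast
  have H: "AE \<omega> in M. in_H_space D lam e \<rho> (\<lambda>x. u x \<omega>)" if \<rho>: "\<rho> < 2 * \<gamma> - real DIM('a) / 2" for \<rho>
  proof -
    \<comment> \<open>\<open>s1\<close> yields the weighted sum that defines membership in the space
      of order \<rho>; \<open>s2\<close>, a restatement of \<open>\<gamma> > d/4\<close>, yields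
      plain square summability, by which the path is in L2 and its coefficients are
      identified.\<close>
    have s1: "real DIM('a) / 2 < 2 * \<gamma> - \<rho>" and s2: "real DIM('a) / 2 < 2 * \<gamma>"
      using \<rho> assms(5) by auto
    show ?thesis
      using sum_X[OF s1] sum_X[OF s2] AE_lim AE_space
    proof eventually_elim
      case (elim \<omega>)
      have f: "(\<lambda>x. u x \<omega>) \<in> borel_measurable (leb D)"
        using measurable_compose[OF measurable_Pair1'[OF elim(4)] u_meas] by simp
      have "summable (\<lambda>k. (a k \<omega>)\<^sup>2)"
        unfolding a2 by (rule elim(2))
      note lim = AE_limit_of_orthonormal_sums[OF on this f r elim(3)[unfolded v_def]]
      have "lam k powr \<rho> * (a k \<omega>)\<^sup>2 = lam k powr (- (2 * \<gamma> - \<rho>)) * (X k \<omega>)\<^sup>2" for k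
        unfolding a2 by (simp add: powr_add[symmetric] mult.assoc[symmetric])
      then have "summable (\<lambda>k. lam k powr \<rho> * (a k \<omega>)\<^sup>2)"
        using elim(1) by simp
      then show ?case
        using lim(2) L2_on_mult_integrable[OF lim(1) eL] by (simp add: in_H_space_def H_space_def)
    qed
  qed
  have C: "\<exists>v. continuous_modification_on_closure M D u v" if \<gamma>: "real DIM('a) / 2 < \<gamma>"
  proof -
    \<comment> \<open>The convergence event is made explicit and measurable because the modification
      must be continuous for every outcome; off \<open>G\<close> it is set to 0.\<close>
    define G where "G = {\<omega> \<in> space M. summable (\<lambda>k. lam k powr (- \<gamma>) * (X k \<omega>)\<^sup>2)}"
    have [measurable]: "G \<in> events"
      unfolding G_def summable_iff_convergent Cauchy_convergent_iff[symmetric]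
      by (rule sets_Collect_Cauchy) measurable
    obtain B where B: "\<And>n x. x \<in> closure D \<Longrightarrow> (\<Sum>k<n. lam k powr (- \<gamma>) * (e k x)\<^sup>2) \<le> B"
      using dirichlet_spectral_zeta_bound[OF D basis \<gamma>] by blast
    have unif: "uniform_limit (closure D) (\<lambda>n x. v n x \<omega>) (\<lambda>x. lim (\<lambda>n. v n x \<omega>)) sequentially" if "\<omega> \<in> G" for \<omega>
    proof -
      \<comment> \<open>The decay \<open>lam k powr (- 2 \<gamma>)\<close> of the squared
        coefficients is shared equally: one half makes the sum over the \<open>X k\<close> finite,
        the other bounds the sum over the eigenfunctions. Each half requires
        \<open>\<gamma> > d/2\<close>.\<close>
      have "(a k \<omega>)\<^sup>2 / lam k powr (- \<gamma>) = lam k powr (- \<gamma>) * (X k \<omega>)\<^sup>2" for k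
      proof -
        have "lam k powr (- (2 * \<gamma>)) / lam k powr (- \<gamma>) = lam k powr (- \<gamma>)"
          by (simp add: powr_diff[symmetric])
        then show ?thesis
          unfolding a2 by (metis times_divide_eq_left)
      qed
      then have "summable (\<lambda>k. (a k \<omega>)\<^sup>2 / lam k powr (- \<gamma>))"
        using that by (simp add: G_def)
      then have "uniformly_convergent_on (closure D) (\<lambda>n x. \<Sum>k<n. a k \<omega> * e k x)"
        using B less_imp_neq[OF lam, symmetric]
        by (intro uniformly_convergent_weighted_series[where w = "\<lambda>k. lam k powr (- \<gamma>)"]) auto
      then show ?thesis
        unfolding v_def uniformly_convergent_uniform_limit_iff .
    qed
    define w where "w x \<omega> = (if \<omega> \<in> G then lim (\<lambda>n. v n x \<omega>) else 0)" for x \<omega>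
    have ec: "continuous_on (closure D) (e k)" for k
      using basis by (auto simp: dirichlet_spectral_basis_def dirichlet_eigenfunction_def)
    have v_meas': "v n x \<in> borel_measurable M" for n x
      unfolding v_def by measurable
    have w_meas: "w x \<in> borel_measurable M" for x
    proof -
      note [measurable] = v_meas'
      show ?thesis
        unfolding w_def by measurable
    qed
    have "continuous_modification_on_closure M D u w"
      unfolding continuous_modification_on_closure_def
    proof (intro conjI ballI)
      fix \<omega> assume "\<omega> \<in> space M"
      show "continuous_on (closure D) (\<lambda>x. w x \<omega>)"
      proof (cases "\<omega> \<in> G")
        case True
        have "continuous_on (closure D) (\<lambda>x. lim (\<lambda>n. v n x \<omega>))"
        proof (rule uniform_limit_theorem[OF _ unif[OF True]])
          show "\<forall>\<^sub>F n in sequentially. continuous_on (closure D) (\<lambda>x. v n x \<omega>)"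
            unfolding v_def by (intro always_eventually allI continuous_intros ec)
        qed simp
        then show ?thesis
          using True by (simp add: w_def)
      qed (simp add: w_def)
    next
      fix x assume x: "x \<in> D"
      \<comment> \<open>The partial sums converge to \<open>w x\<close> almost surely and to
        \<open>u x\<close> in probability, so the two limits agree almost surely at each point of
        \<open>D\<close>.\<close>
      have "AE \<omega> in M. (\<lambda>n. v n x \<omega>) \<longlonglongrightarrow> w x \<omega>"
        using sum_X[OF \<gamma>] AE_space
      proof eventually_elim
        case (elim \<omega>)
        then have G: "\<omega> \<in> G"
          by (simp add: G_def)
        show ?case
          using tendsto_uniform_limitI[OF unif[OF G], of x] x closure_subset G by (auto simp: w_def)
      qed
      then have "(\<lambda>n. l0 M (\<lambda>\<omega>. v n x \<omega> - w x \<omega>)) \<longlonglongrightarrow> 0"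
        by (intro l0_tendsto_AE v_meas' w_meas)
      then have "conv_in_prob M (\<lambda>n. v n x) (w x)"
        by (simp add: conv_in_prob_iff_l0 v_meas' w_meas)
      then show "AE \<omega> in M. w x \<omega> = u x \<omega>"
        by (rule conv_in_prob_unique) (rule conv[OF x])
    qed (rule w_meas)
    then show ?thesis
      by blast
  qed
  show ?thesis
    using H C by blast
qed

end
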